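(* Let $d\in\mathbb N$ and $1<q\le2<p<\infty$. Then $$ \sigma_m(\mathbf W^{1/q}_q)_p\asymp m^{-1/2}(\log m)^{d(1-1/q)} . $$ The upper bounds are achieved by a constructive greedy-type algorithm.
   Context: All functions are complex-valued, $2\pi$-periodic in each of $d$ variables, i.e. defined on $\mathbb T^d$; $\|\cdot\|_p$ is the $L_p(\mathbb T^d)$ norm with respect to the normalized measure $(2\pi)^{-d}d\mathbf x$, and convolution is $(\varphi*F)(\mathbf x)=(2\pi)^{-d}\int_{\mathbb T^d}\varphi(\mathbf y)F(\mathbf x-\mathbf y)\,d\mathbf y$. For a function $f$, the best $m$-term trigonometric approximation is $$\sigma_m(f)_p:=\inf\Big\|f-\sum_{j=1}^m c_je^{i(\mathbf k_j,\mathbf x)}\Big\|_p,$$ the infimum over all $\mathbf k_1,\dots,\mathbf k_m\in\mathbb Z^d$ and complex coefficients $c_1,\dots,c_m$; for a class $\mathbf W$ of functions, $\sigma_m(\mathbf W)_p:=\sup_{f\in\mathbf W}\sigma_m(f)_p$. For $r>0$ let $F_r(x):=1+2\sum_{k=1}^\infty k^{-r}\cos(kx-r\pi/2)$ for $x\in\mathbb T$, $F_r(\mathbf x):=\prod_{j=1}^dF_r(x_j)$ for $\mathbf x\in\mathbb T^d$, and $$\mathbf W^r_q:=\{f: f=\varphi*F_r,\ \|\varphi\|_q\le1\}$$ (here used with $r=1/q$). $A_m\asymp B_m$ means $c\,B_m\le A_m\le C\,B_m$ for all sufficiently large $m$, with constants $0<c\le C$ independent of $m$ (they may depend on the fixed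 parameters $d,q,p$). "Constructive greedy-type algorithm" is meant in the following sense: an explicit procedure assigns to each $f$ in the class a trigonometric polynomial with at most $m$ terms that attains the upper bound up to a constant; the procedure is assembled from Fourier partial sums, selection of dyadic Fourier blocks with largest norms, and constructive greedy-type methods $G^p_m$ producing $m$-term trigonometric polynomials with $\|g-G^p_m(g)\|_p\le C_1(d)(\max(m,1))^{-1/2}p^{1/2}\|g\|_A$ and $\|G^p_m(g)\|_A\le C_2(d)\|g\|_A$ for $2\le p<\infty$, where $\|g\|_A:=\sum_{\mathbf k}|\hat g(\mathbf k)|$ and $\hat g(\mathbf k):=(2\pi)^{-d}\int_{\mathbb T^d}g(\mathbf x)e^{-i(\mathbf k,\mathbf x)}d\mathbf x$. *)

theory Defs
  imports "HOL-Analysis.Analysis"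
begin

text \<open>
  A function on the \<open>d\<close>-dimensional torus is a function on \<open>real ^ 'd\<close>, \<open>d = CARD('d)\<close>, that is
  \<open>2\<pi>\<close>-periodic in every variable.  The measure is Lebesgue measure on the period cell, normalized
  to have total mass one.
\<close>

type_synonym 'd tfun = "real ^ 'd \<Rightarrow> complex"

definition torus :: "(real ^ 'd) measure" where
  "torus = uniform_measure lborel (cbox 0 (\<chi> j. 2 * pi))"

definition periodic :: "'d::finite tfun \<Rightarrow> bool" where
  "periodic f \<longleftrightarrow> (\<forall>x j. f (x + axis j (2 * pi)) = f x)"

definition Lp :: "real \<Rightarrow> ('d::finite tfun) set" where
  "Lp p = {f \<in> borel_measurable borel. periodic f \<and> integrable torus (\<lambda>x. cmod (f x) powr p)}"

text \<open>Norms take values in \<open>ennreal\<close> and are infinite outside \<open>Lp p\<close>, so that no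
  estimate can hold because of the default value of a divergent integral.\<close>

definition Lp_norm :: "real \<Rightarrow> 'd::finite tfun \<Rightarrow> ennreal" where
  "Lp_norm p f =
     (if f \<in> Lp p then ennreal ((\<integral>x. cmod (f x) powr p \<partial>torus) powr (1 / p)) else \<infinity>)"

definition convolution :: "'d::finite tfun \<Rightarrow> 'd tfun \<Rightarrow> 'd tfun" where
  "convolution \<phi> F x = (\<integral>y. \<phi> y * F (x - y) \<partial>torus)"

definition character :: "int ^ 'd \<Rightarrow> 'd::finite tfun" where
  "character k x = cis (\<Sum>j\<in>UNIV. of_int (k $ j) * x $ j)"

definition fourier :: "'d::finite tfun \<Rightarrow> int ^ 'd \<Rightarrow> complex" where
  "fourier f k = (\<integral>x. f x * cnj (character k x) \<partial>torus)"

definition Wiener :: "('d::finite tfun) set" where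
  "Wiener = {f \<in> Lp 1. (\<lambda>k. cmod (fourier f k)) summable_on UNIV}"

definition A_norm :: "'d::finite tfun \<Rightarrow> real" where
  "A_norm f = (\<Sum>\<^sub>\<infinity>k\<in>UNIV. cmod (fourier f k))"

text \<open>The frequencies may repeat and the coefficients may vanish: these are the trigonometric
  polynomials with at most \<open>m\<close> terms.\<close>

definition m_term :: "nat \<Rightarrow> ('d::finite tfun) set" where
  "m_term m = {t. \<exists>(k :: nat \<Rightarrow> int ^ 'd) (c :: nat \<Rightarrow> complex).
                    t = (\<lambda>x. \<Sum>j<m. c j * character (k j) x)}"

definition best_m_term :: "nat \<Rightarrow> 'd::finite tfun \<Rightarrow> real \<Rightarrow> ennreal" where
  "best_m_term m f p = (INF t\<in>m_term m. Lp_norm p (\<lambda>x. f x - t x))"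

definition best_m_term_class :: "nat \<Rightarrow> ('d::finite tfun) set \<Rightarrow> real \<Rightarrow> ennreal" where
  "best_m_term_class m W p = (SUP f\<in>W. best_m_term m f p)"

definition same_order :: "(nat \<Rightarrow> ennreal) \<Rightarrow> (nat \<Rightarrow> real) \<Rightarrow> bool" where
  "same_order A B \<longleftrightarrow>
     (\<exists>c C :: real. 0 < c \<and> c \<le> C \<and>
        (\<forall>\<^sub>F m in sequentially. ennreal (c * B m) \<le> A m \<and> A m \<le> ennreal (C * B m)))"

text \<open>For \<open>0 < r \<le> 1\<close> the series diverges on a null set (the multiples of \<open>2\<pi>\<close>);
  the value assigned there is immaterial.\<close>

definition F_kernel :: "real \<Rightarrow> real \<Rightarrow> real" where
  "F_kernel r x =
     1 + 2 * (\<Sum>n. real (Suc n) powr (- r) * cos (real (Suc n) * x - r * pi / 2))"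

definition F_kernel_mixed :: "real \<Rightarrow> 'd::finite tfun" where
  "F_kernel_mixed r x = complex_of_real (\<Prod>j\<in>UNIV. F_kernel r (x $ j))"

text \<open>The kernel is unbounded for \<open>r < 1\<close>, so the convolution integral exists only
  almost everywhere; the class contains every representative.\<close>

definition W_class :: "real \<Rightarrow> real \<Rightarrow> ('d::finite tfun) set" where
  "W_class r q =
     {f \<in> borel_measurable borel. periodic f \<and>
        (\<exists>\<phi>. Lp_norm q \<phi> \<le> 1 \<and>
             (AE x in torus. f x = convolution \<phi> (F_kernel_mixed r) x))}"

text \<open>Families \<open>G t m\<close> of \<open>m\<close>-term approximation methods in \<open>L\<^sub>t\<close>, \<open>2 \<le> t < \<infinity>\<close>, with
  the characteristic estimates; the constants depend on neither \<open>t\<close> nor \<open>m\<close>.\<close>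

definition greedy_type_methods ::
    "real \<Rightarrow> real \<Rightarrow> (real \<Rightarrow> nat \<Rightarrow> 'd::finite tfun \<Rightarrow> 'd tfun) \<Rightarrow> bool" where
  "greedy_type_methods C1 C2 G \<longleftrightarrow>
     (\<forall>t\<ge>2. \<forall>m. \<forall>g\<in>Wiener.
        G t m g \<in> m_term m \<and>
        Lp_norm t (\<lambda>x. g x - G t m g x)
          \<le> ennreal (C1 * real (max m 1) powr (- 1/2) * t powr (1/2) * A_norm g) \<and>
        A_norm (G t m g) \<le> C2 * A_norm g)"

text \<open>
  The incremental greedy algorithm in \<open>L\<^sub>t\<close> with respect to the trigonometric system.
  Up to a positive factor, the norming functional of the residual \<open>g - h\<close> is
  \<open>u \<mapsto> Re (\<integral>u * cnj \<psi>)\<close> with \<open>\<psi> = |g - h| ^ (t - 2) * (g - h)\<close>, so among the elements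
  \<open>c * character k\<close>, \<open>|c| = 1\<close>, it is largest when \<open>k\<close> maximizes \<open>|fourier \<psi> k|\<close> and
  \<open>c = sgn (fourier \<psi> k)\<close>.
\<close>

definition norming :: "real \<Rightarrow> 'd::finite tfun \<Rightarrow> 'd tfun" where
  "norming t f x = complex_of_real (cmod (f x) powr (t - 2)) * f x"

inductive greedy_output :: "real \<Rightarrow> 'd::finite tfun \<Rightarrow> nat \<Rightarrow> 'd tfun \<Rightarrow> bool"
  for t g where
  start: "greedy_output t g 0 (\<lambda>x. 0)"
| step: "\<lbrakk>greedy_output t g m h; \<psi> = norming t (\<lambda>x. g x - h x);
          is_arg_max (\<lambda>k. cmod (fourier \<psi> k)) (\<lambda>_. True) k\<rbrakk>
         \<Longrightarrow> greedy_output t g (Suc m)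
               (\<lambda>x. (1 - 1 / of_nat (Suc m)) * h x
                    + of_real (A_norm g) / of_nat (Suc m) * sgn (fourier \<psi> k) * character k x)"

definition incremental_greedy :: "(real \<Rightarrow> nat \<Rightarrow> 'd::finite tfun \<Rightarrow> 'd tfun) \<Rightarrow> bool" where
  "incremental_greedy G \<longleftrightarrow> (\<forall>t\<ge>2. \<forall>m. \<forall>g\<in>Wiener. greedy_output t g m (G t m g))"

text \<open>For \<open>s $ j = 0\<close> the \<open>j\<close>-th factor of the dyadic block consists of the frequency \<open>0\<close>.\<close>

definition dyadic_freqs :: "nat ^ 'd \<Rightarrow> (int ^ 'd::finite) set" where
  "dyadic_freqs s = {k. \<forall>j. 2 ^ (s $ j) div 2 \<le> \<bar>k $ j\<bar> \<and> \<bar>k $ j\<bar> < 2 ^ (s $ j)}"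

definition dyadic_block :: "nat ^ 'd \<Rightarrow> 'd::finite tfun \<Rightarrow> 'd tfun" where
  "dyadic_block s f x = (\<Sum>k\<in>dyadic_freqs s. fourier f k * character k x)"

text \<open>
  A scheme is a finite program built from the admissible operations; none of its parameters
  depends on the function it is run on.  \<open>Largest_Blocks t v ss\<close> keeps the \<open>v\<close> blocks from the
  list \<open>ss\<close> whose \<open>L\<^sub>t\<close> norms are largest, ties being decided by the position in \<open>ss\<close>.
\<close>

datatype ('d::finite) scheme =
    Partial_Sum "(nat ^ 'd) list"
  | Largest_Blocks real nat "(nat ^ 'd) list"
  | Greedy real nat
  | Compose "'d scheme" "'d scheme"
  | Add "'d scheme" "'d scheme"

primrec run ::
    "(real \<Rightarrow> nat \<Rightarrow> 'd tfun \<Rightarrow> 'd tfun) \<Rightarrow> 'd::finite scheme \<Rightarrow> 'd tfun \<Rightarrow> 'd tfun" where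
  "run G (Partial_Sum ss) f = (\<lambda>x. \<Sum>s\<in>set ss. dyadic_block s f x)"
| "run G (Largest_Blocks t v ss) f =
     (\<lambda>x. \<Sum>s\<in>set (take v (rev (sort_key (\<lambda>s. Lp_norm (max 1 t) (dyadic_block s f))
                                   (remdups ss)))).
            dyadic_block s f x)"
| "run G (Greedy t m) f = G t m f"
| "run G (Compose a b) f = run G a (run G b f)"
| "run G (Add a b) f = (\<lambda>x. run G a f x + run G b f x)"

definition attains_order ::
    "(real \<Rightarrow> nat \<Rightarrow> 'd tfun \<Rightarrow> 'd tfun) \<Rightarrow> (nat \<Rightarrow> 'd::finite scheme) \<Rightarrow>
     'd tfun set \<Rightarrow> real \<Rightarrow> (nat \<Rightarrow> real) \<Rightarrow> bool" where
  "attains_order G a W p B \<longleftrightarrow>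
     (\<exists>C>0. \<forall>\<^sub>F m in sequentially. \<forall>f\<in>W.
        run G (a m) f \<in> m_term m \<and>
        Lp_norm p (\<lambda>x. f x - run G (a m) f x) \<le> ennreal (C * B m))"

end

theory Submission
  imports Defs "HOL-Probability.Probability_Measure" "HOL-Real_Asymp.Real_Asymp"
begin

text \<open>
  The smoothness \<open>1/q\<close> is the borderline at which the Wiener norm \<open>\<Sum>k. |f^(k)|\<close> ceases to be bounded on
  the class, and it does so only by powers of logarithms.  A function \<open>f = \<phi> * F\<close> of the class has
  \<open>|f^(k)| = W(k) powr (-1/q) |\<phi>^(k)|\<close> with \<open>W(k) = \<Prod>j. max 1 |k_j|\<close>.  The Hardy-Littlewood
  inequality \<open>\<Sum>k. W(k) powr (q - 2) |\<phi>^(k)| powr q \<le> C \<integral> |\<phi>| powr q\<close> (lemma \<open>hardy_littlewood\<close>)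
  and Hoelder's inequality give \<open>\<Sum> |f^(k)| \<le> C n powr (d (1 - 1/q))\<close> over the cube \<open>|k_j| < 2^n\<close>
  (lemma \<open>W_class_fourier\<close>).  So the partial sum over the cube has a Wiener norm that grows only like a
  power of \<open>n\<close>.  The remainder decays exponentially in \<open>n\<close>: the difference of two consecutive cube
  sums has a supremum norm of at most a power of \<open>n\<close>, an exponentially small \<open>L_2\<close> norm, and hence an
  exponentially small \<open>L_p\<close> norm (lemma \<open>cube_sum_approximation\<close>).  With \<open>n\<close> a large multiple of
  \<open>log m\<close> the remainder is below \<open>m powr (-1/2)\<close>, and one greedy approximation of the cube sum
  costs \<open>m powr (-1/2)\<close> times its Wiener norm, which is the upper bound.

  The lower bound rests on duality.  The function with coefficients \<open>1 / W(k)\<close> on the box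
  \<open>m powr (1/d) \<le> k_j \<le> m powr (p/(2d)) / 2\<close>, divided by \<open>(log m) powr (d/q)\<close>, belongs to the class up
  to a constant (lemma \<open>extremal_function\<close>).  It is tested against a Fejer kernel from which the
  at most \<open>m\<close> frequencies of the approximant have been deleted.  The kernel is built from at
  most \<open>m powr (p/2)\<close> frequencies and therefore has \<open>L_p'\<close> norm at most \<open>m powr (1/2)\<close>, where \<open>p'\<close> is
  the exponent conjugate to \<open>p\<close>; the deleted part has \<open>L_2\<close> norm at most \<open>m powr (1/2)\<close>.
  Every coefficient \<open>1 / W(k)\<close> is at most \<open>1/m\<close>, so the deletion removes at most \<open>1\<close> from the sum of
  the coefficients, which is of order \<open>(log m) powr d\<close> (lemma \<open>m_term_error_lower_bound\<close>).  The
  hypothesis \<open>2 < p\<close> makes the box contain a range of scales proportional to \<open>log m\<close>.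

  The greedy methods exist because the norm of \<open>L_t\<close> is smooth of power type two with a constant
  proportional to \<open>t\<close> (lemma \<open>smoothness_step\<close>): the choice of the frequency makes the linear term
  of the expansion at the residual nonpositive, and the norms \<open>\<rho>_m\<close> of the residuals are controlled,
  once \<open>m\<close> exceeds a multiple of \<open>t\<close>, by the recursion
  \<open>m^2 \<rho>_m^2 \<le> (m - 1)^2 \<rho>_(m-1)^2 + 12 t A^2\<close>, where \<open>A\<close> is the Wiener norm of the function.

  Both directions identify functions with their Fourier series, which requires that an integrable
  function is determined by its coefficients (lemma \<open>fourier_unique\<close>).
\<close>

section \<open>The torus as a product of circles\<close>

text \<open>Integrals over the torus factor over the coordinates; the factor is this measure.\<close>

definition circle :: "real measure" where
  "circle = uniform_measure lborel {0..2 * pi}"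

lemma sets_circle [simp, measurable_cong]: "sets circle = sets borel"
  and space_circle [simp]: "space circle = UNIV"
  by (simp_all add: circle_def)

lemma sets_torus [simp, measurable_cong]: "sets torus = sets borel"
  and space_torus [simp]: "space torus = UNIV"
  by (simp_all add: torus_def)

lemma prob_space_circle: "prob_space circle"
  unfolding circle_def by (intro prob_space_uniform_measure) auto

lemma emeasure_circle:
  assumes "A \<in> sets borel"
  shows "emeasure circle A = emeasure lborel ({0..2*pi} \<inter> A) / ennreal (2*pi)"
  using assms by (simp add: circle_def)

interpretation circle: prob_space circle by (rule prob_space_circle)

interpretation circles: product_prob_space "\<lambda>_::'i. circle"
  by unfold_locales

lemma measurable_vec_lambda:
  "(\<lambda>w. \<chi> j. w j) \<in> (\<Pi>\<^sub>M j\<in>(UNIV::'d::finite set). (borel::real measure)) \<rightarrow>\<^sub>M borel"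
proof (subst borel_measurable_euclidean_space, rule ballI)
  fix b :: "real^'d" assume "b \<in> Basis"
  then obtain j where b: "b = axis j 1" by (auto simp: Basis_vec_def)
  show "(\<lambda>w. (\<chi> j. w j) \<bullet> b) \<in> borel_measurable (\<Pi>\<^sub>M j\<in>(UNIV::'d set). (borel::real measure))"
    by (simp add: b inner_axis)
qed

lemma lborel_eq_distr_PiM:
  "(lborel :: (real^'d::finite) measure) = distr (\<Pi>\<^sub>M j\<in>UNIV. lborel) borel (\<lambda>w. \<chi> j. w j)"
proof (rule lborel_eqI)
  interpret L: product_sigma_finite "\<lambda>_::'d. lborel :: real measure"
    by unfold_locales
  fix l u :: "real^'d" assume lu: "\<And>b. b \<in> Basis \<Longrightarrow> l \<bullet> b \<le> u \<bullet> b"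
  have lu': "l $ j \<le> u $ j" for j using lu[of "axis j 1"] by (auto simp: inner_axis Basis_vec_def)
  have "(\<lambda>w. \<chi> j. w j) -` box l u = PiE UNIV (\<lambda>j. {l$j<..<u$j})"
    by (auto simp: mem_box_cart PiE_UNIV_domain Pi_def)
  then have "emeasure (distr (\<Pi>\<^sub>M j\<in>UNIV. lborel) borel (\<lambda>w. \<chi> j. w j)) (box l u)
      = emeasure (\<Pi>\<^sub>M j\<in>UNIV. lborel) (PiE UNIV (\<lambda>j. {l$j<..<u$j}))"
    using measurable_vec_lambda by (subst emeasure_distr) (auto simp: space_PiM PiE_UNIV_domain cong: measurable_cong_sets sets_PiM_cong)
  also have "\<dots> = (\<Prod>j\<in>UNIV. ennreal (u$j - l$j))"
    by (subst L.emeasure_PiM) (auto simp: lu')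
  also have "\<dots> = ennreal (\<Prod>j\<in>UNIV. (u$j - l$j))"
    by (rule prod_ennreal) (simp add: lu')
  also have "(\<Prod>j\<in>UNIV. (u$j - l$j)) = (\<Prod>b\<in>Basis. (u - l) \<bullet> b)"
  proof -
    have B: "(Basis :: (real^'d) set) = (\<lambda>j. axis j 1) ` UNIV" by (auto simp: Basis_vec_def)
    show ?thesis unfolding B
      by (subst prod.reindex) (auto simp: inj_on_def axis_eq_axis inner_axis)
  qed
  finally show "emeasure (distr (\<Pi>\<^sub>M j\<in>UNIV. lborel) borel (\<lambda>w. \<chi> j. w j)) (box l u) = ennreal (\<Prod>b\<in>Basis. (u - l) \<bullet> b)"
    by (simp add: prod_ennreal)
qed simp

lemma emeasure_lborel_product_set:
  assumes "\<And>j. A j \<in> sets borel"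
  shows "emeasure lborel {x::real^'d::finite. \<forall>j. x $ j \<in> A j} = (\<Prod>j\<in>UNIV. emeasure lborel (A j))"
proof -
  interpret L: product_sigma_finite "\<lambda>_::'d. lborel :: real measure" by unfold_locales
  have [measurable]: "{x::real^'d. \<forall>j. x $ j \<in> A j} \<in> sets borel"
  proof -
    have [measurable]: "\<And>j. A j \<in> sets borel" using assms .
    show ?thesis by measurable
  qed
  have "emeasure lborel {x::real^'d::finite. \<forall>j. x $ j \<in> A j} =
     emeasure (\<Pi>\<^sub>M j\<in>UNIV. lborel) (PiE UNIV A)"
    using measurable_vec_lambda
    by (subst lborel_eq_distr_PiM, subst emeasure_distr)
       (auto simp: space_PiM PiE_UNIV_domain vimage_def Pi_def cong: measurable_cong_sets sets_PiM_cong)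
  then show ?thesis using assms by (simp add: L.emeasure_PiM)
qed

lemma emeasure_torus_product_set:
  assumes "\<And>j. A j \<in> sets borel"
  shows "emeasure torus {x::real^'d::finite. \<forall>j. x $ j \<in> A j} = (\<Prod>j\<in>UNIV. emeasure circle (A j))"
proof -
  have cb: "(cbox 0 (\<chi> j. 2 * pi) :: (real^'d) set) = {x. \<forall>j. x $ j \<in> {0..2*pi}}"
    by (auto simp: mem_box_cart)
  have e: "emeasure lborel (cbox 0 (\<chi> j. 2 * pi) :: (real^'d) set) = ennreal (2*pi) ^ CARD('d)"
    unfolding cb by (subst emeasure_lborel_product_set) (auto simp del: atLeastAtMost_iff)
  have m: "{x::real^'d. \<forall>j. x $ j \<in> A j} \<in> sets borel"
  proof -
    have [measurable]: "\<And>j. A j \<in> sets borel" using assms .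
    show ?thesis by measurable
  qed
  have "emeasure torus {x::real^'d. \<forall>j. x $ j \<in> A j} =
     emeasure lborel {x::real^'d. \<forall>j. x $ j \<in> {0..2*pi} \<inter> A j} / ennreal (2*pi) ^ CARD('d)"
  proof -
    have "(cbox 0 (\<chi> j. 2 * pi)) \<inter> {x::real^'d. \<forall>j. x $ j \<in> A j} = {x::real^'d. \<forall>j. x $ j \<in> {0..2*pi} \<inter> A j}"
      by (auto simp: cb)
    then show ?thesis
      unfolding torus_def using m by (subst emeasure_uniform_measure) (simp_all add: e)
  qed
  also have "\<dots> = (\<Prod>j\<in>UNIV. emeasure lborel ({0..2*pi} \<inter> A j)) / ennreal (2*pi) ^ CARD('d)"
    using assms by (subst emeasure_lborel_product_set) auto
  also have "\<dots> = (\<Prod>j\<in>UNIV. emeasure lborel ({0..2*pi} \<inter> A j) / ennreal (2*pi))"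
  proof -
    have fin: "emeasure lborel ({0..2*pi} \<inter> A j) < \<infinity>" for j
      by (rule le_less_trans[OF emeasure_mono[of _ "{0..2*pi}"]]) auto
    have "ennreal (2*pi) ^ n = ennreal ((2*pi) ^ n)" for n by (simp add: ennreal_power)
    have "(\<Prod>j\<in>UNIV. emeasure lborel ({0..2*pi} \<inter> A j) / ennreal (2*pi))
       = (\<Prod>j\<in>UNIV. emeasure lborel ({0..2*pi} \<inter> A j) * inverse (ennreal (2*pi)))"
      by (simp add: divide_ennreal_def)
    also have "\<dots> = (\<Prod>j\<in>UNIV. emeasure lborel ({0..2*pi} \<inter> A j)) * inverse (ennreal (2*pi)) ^ CARD('d)"
      by (simp add: prod.distrib)
    also have "inverse (ennreal (2*pi)) ^ CARD('d) = inverse (ennreal (2*pi) ^ CARD('d))"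
      by (simp add: ennreal_power inverse_ennreal power_mult_distrib field_simps)
    finally show ?thesis by (simp add: divide_ennreal_def)
  qed
  also have "\<dots> = (\<Prod>j\<in>UNIV. emeasure circle (A j))"
    using assms by (simp add: emeasure_circle)
  finally show ?thesis .
qed

text \<open>Two finite measures that agree on products of Borel sets are equal, and on such products both
  sides are the product of the measures of the sides.  Through this identity Fubini's theorem for
  finite product spaces becomes available on the torus.\<close>

lemma torus_eq_distr:
  "(torus :: (real^'d::finite) measure) = distr (\<Pi>\<^sub>M j\<in>UNIV. circle) borel (\<lambda>w. \<chi> j. w j)"
proof -
  have mt: "(\<lambda>x::real^'d. \<lambda>j\<in>UNIV. x $ j) \<in> torus \<rightarrow>\<^sub>M (\<Pi>\<^sub>M j\<in>UNIV. circle)"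
    by (rule measurable_restrict) simp
  have ml: "(\<lambda>w. \<chi> j. w j) \<in> (\<Pi>\<^sub>M j\<in>(UNIV::'d set). circle) \<rightarrow>\<^sub>M borel"
    using measurable_vec_lambda by (simp cong: measurable_cong_sets sets_PiM_cong)
  have *: "distr torus (\<Pi>\<^sub>M j\<in>UNIV. circle) (\<lambda>x::real^'d. \<lambda>j\<in>UNIV. x $ j) = (\<Pi>\<^sub>M j\<in>UNIV. circle)"
  proof (rule circles.PiM_eqI)
    fix A :: "'d \<Rightarrow> real set" assume A: "\<And>i. i \<in> UNIV \<Longrightarrow> A i \<in> sets circle"
    have "(\<lambda>x::real^'d. \<lambda>j\<in>UNIV. x $ j) -` PiE UNIV A = {x. \<forall>j. x $ j \<in> A j}"
      by (auto simp: PiE_UNIV_domain Pi_def)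
    then show "emeasure (distr torus (\<Pi>\<^sub>M j\<in>UNIV. circle) (\<lambda>x::real^'d. \<lambda>j\<in>UNIV. x $ j)) (Pi\<^sub>E UNIV A)
      = (\<Prod>i\<in>UNIV. emeasure circle (A i))"
      using mt A by (subst emeasure_distr) (auto intro!: sets_PiM_I_finite emeasure_torus_product_set)
  qed auto
  have "distr (\<Pi>\<^sub>M j\<in>UNIV. circle) borel (\<lambda>w. \<chi> j. w j)
     = distr torus borel ((\<lambda>w. \<chi> j. w j) \<circ> (\<lambda>x::real^'d. \<lambda>j\<in>UNIV. x $ j))"
    by (subst *[symmetric], rule distr_distr[OF ml mt])
  also have "\<dots> = distr torus torus (\<lambda>x. x)"
    by (rule distr_cong) (auto simp: vec_eq_iff)
  also have "\<dots> = torus" by (rule distr_id)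
  finally show ?thesis ..
qed

lemma measurable_vec_lambda_circle [measurable]:
  "(\<lambda>w. \<chi> j. w j) \<in> (\<Pi>\<^sub>M j\<in>(UNIV::'d::finite set). circle) \<rightarrow>\<^sub>M borel"
  using measurable_vec_lambda by (simp cong: measurable_cong_sets sets_PiM_cong)

lemma prob_space_torus: "prob_space (torus :: (real^'d::finite) measure)"
  by (rule prob_spaceI) (use emeasure_torus_product_set[of "\<lambda>_. UNIV"] circle.emeasure_space_1 in simp)

interpretation torus: prob_space "torus :: (real^'d::finite) measure"
  by (rule prob_space_torus)

lemma nn_integral_torus:
  fixes f :: "real^'d::finite \<Rightarrow> ennreal"
  assumes "f \<in> borel_measurable borel"
  shows "(\<integral>\<^sup>+x. f x \<partial>torus) = (\<integral>\<^sup>+w. f (\<chi> j. w j) \<partial>(\<Pi>\<^sub>M j\<in>UNIV. circle))"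
  by (subst torus_eq_distr, subst nn_integral_distr) (use assms in auto)

lemma integral_torus_prod:
  fixes f :: "'d::finite \<Rightarrow> real \<Rightarrow> complex"
  assumes "\<And>j. integrable circle (f j)"
  shows "integrable torus (\<lambda>x. \<Prod>j\<in>UNIV. f j (x $ j))"
    and "(\<integral>x. (\<Prod>j\<in>UNIV. f j (x $ j)) \<partial>torus) = (\<Prod>j\<in>UNIV. \<integral>t. f j t \<partial>circle)"
proof -
  have [measurable]: "f j \<in> borel_measurable borel" for j
    using borel_measurable_integrable[OF assms[of j]] by (simp cong: measurable_cong_sets)
  have m: "(\<lambda>x::real^'d. \<Prod>j\<in>UNIV. f j (x $ j)) \<in> borel_measurable borel" by measurable
  show "integrable torus (\<lambda>x. \<Prod>j\<in>UNIV. f j (x $ j))"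
    unfolding torus_eq_distr
    using circles.product_integrable_prod[of UNIV f] assms m
    by (subst integrable_distr_eq) auto
  show "(\<integral>x. (\<Prod>j\<in>UNIV. f j (x $ j)) \<partial>torus) = (\<Prod>j\<in>UNIV. \<integral>t. f j t \<partial>circle)"
    unfolding torus_eq_distr
    using circles.product_integral_prod[of UNIV f] assms m
    by (subst integral_distr) auto
qed

lemma circle_eq_density: "circle = density lborel (\<lambda>t. ennreal (indicator {0..2*pi} t / (2*pi)))"
  unfolding circle_def uniform_measure_def
  by (intro arg_cong2[where f=density] refl ext)
     (auto simp: indicator_def divide_ennreal[symmetric])

lemma integrable_scale_iff:
  fixes f :: "'a \<Rightarrow> 'b::{banach, second_countable_topology}"
  assumes "a \<noteq> 0"
  shows "integrable M (\<lambda>x. a *\<^sub>R f x) \<longleftrightarrow> integrable M f"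
proof
  assume "integrable M (\<lambda>x. a *\<^sub>R f x)"
  from integrable_scaleR_right[of "1/a", OF this]
  have "integrable M (\<lambda>x. (1/a) *\<^sub>R a *\<^sub>R f x)" .
  moreover have "(\<lambda>x. (1/a) *\<^sub>R a *\<^sub>R f x) = f" using assms by auto
  ultimately show "integrable M f" by simp
qed simp

lemma integral_circle:
  fixes f :: "real \<Rightarrow> 'b::{banach, second_countable_topology}"
  assumes "f \<in> borel_measurable borel"
  shows "(\<integral>t. f t \<partial>circle) = (1 / (2*pi)) *\<^sub>R (\<integral>t\<in>{0..2*pi}. f t \<partial>lborel)"
    and "integrable circle f \<longleftrightarrow> set_integrable lborel {0..2*pi} f"
proof -
  have e: "(\<lambda>t. (indicator {0..2*pi} t / (2*pi)) *\<^sub>R f t) = (\<lambda>t. (1/(2*pi)) *\<^sub>R indicator {0..2*pi} t *\<^sub>R f t)"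
    by auto
  show "(\<integral>t. f t \<partial>circle) = (1 / (2*pi)) *\<^sub>R (\<integral>t\<in>{0..2*pi}. f t \<partial>lborel)"
    unfolding circle_eq_density set_lebesgue_integral_def
    using assms by (subst integral_density) (simp, simp, simp, simp only: e integral_scaleR_right)
  show "integrable circle f \<longleftrightarrow> set_integrable lborel {0..2*pi} f"
    unfolding circle_eq_density set_integrable_def
    using assms by (subst integrable_density) (simp, simp, simp, simp only: e, rule integrable_scale_iff, simp)
qed

lemma nn_integral_circle:
  assumes "f \<in> borel_measurable borel"
  shows "(\<integral>\<^sup>+t. f t \<partial>circle) = ennreal (1 / (2*pi)) * (\<integral>\<^sup>+t\<in>{0..2*pi}. f t \<partial>lborel)"
proof -
  have "(\<integral>\<^sup>+t. f t \<partial>circle) = (\<integral>\<^sup>+t. ennreal (1 / (2*pi)) * (f t * indicator {0..2*pi} t) \<partial>lborel)"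
    unfolding circle_eq_density using assms
    by (subst nn_integral_density) (auto intro!: nn_integral_cong simp: indicator_def)
  then show ?thesis
    using assms by (simp add: nn_integral_cmult)
qed

lemma emeasure_circle_open_interval: "emeasure circle {0<..<2*pi} = 1"
proof (subst emeasure_circle)
  have "{0..2*pi} \<inter> {0<..<2*pi} = {0<..<2*pi}" by auto
  then show "emeasure lborel ({0..2*pi} \<inter> {0<..<2*pi}) / ennreal (2*pi) = 1"
    by (simp add: divide_ennreal)
qed simp

abbreviation mode :: "int \<Rightarrow> real \<Rightarrow> complex" where
  "mode n t \<equiv> cis (of_int n * t)"

lemma measurable_mode [measurable]: "mode n \<in> borel_measurable borel"
  by (intro borel_measurable_continuous_onI continuous_intros)

lemma integral_mode: "(\<integral>t. mode n t \<partial>circle) = (if n = 0 then 1 else 0)"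
proof (cases "n = 0")
  case True
  then show ?thesis using circle.prob_space by simp
next
  case False
  define F where "F t = cis (of_int n * t) / (\<i> * of_int n)" for t :: real
  have d: "((\<lambda>t. cis (of_int n * t)) has_vector_derivative (\<i> * of_int n) * cis (of_int n * x)) (at x within A)" for x :: real and A
  proof -
    have "((\<lambda>t. of_int n * t) has_derivative (\<lambda>t. of_int n * t)) (at x within A)"
      by (auto intro!: derivative_eq_intros)
    from has_derivative_cis[OF this] show ?thesis
      by (simp add: has_vector_derivative_def scaleR_conv_of_real algebra_simps)
  qed
  have "(\<integral>t. indicator {0..2*pi} t *\<^sub>R mode n t \<partial>lborel) = F (2*pi) - F 0"
  proof (rule integral_FTC_Icc)
    show "(F has_vector_derivative mode n x) (at x within {0..2 * pi})" for x
      unfolding F_def using has_vector_derivative_divide[OF d[of x "{0..2*pi}"], of "\<i> * of_int n"] False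
      by simp
    show "continuous_on {0..2 * pi} (mode n)" by (intro continuous_intros)
  qed simp
  also have "\<dots> = 0"
    using cis_multiple_2pi[of "of_int n"] by (simp add: F_def mult.commute)
  finally show ?thesis using False
    by (simp add: integral_circle set_lebesgue_integral_def)
qed

lemma character_eq_prod: "character k x = (\<Prod>j\<in>UNIV. mode (k $ j) (x $ j))"
proof -
  have "cis (sum f A) = (\<Prod>j\<in>A. cis (f j))" if "finite A" for f :: "'a \<Rightarrow> real" and A
    using that by induction (auto simp: cis_mult[symmetric])
  then show ?thesis by (simp add: character_def)
qed

lemma measurable_character [measurable]: "character k \<in> borel_measurable borel"
proof -
  have "character k = (\<lambda>x. \<Prod>j\<in>UNIV. mode (k $ j) (x $ j))" by (rule ext) (rule character_eq_prod)
  then show ?thesis by simp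
qed

lemma norm_character [simp]: "cmod (character k x) = 1"
  by (simp add: character_def)

lemma character_add: "character (k + l) x = character k x * character l x"
  by (simp add: character_def cis_mult sum.distrib algebra_simps)

lemma cnj_character: "cnj (character k x) = character (- k) x"
  by (simp add: character_def cis_cnj sum_negf)

lemma integral_character: "(\<integral>x. character k x \<partial>torus) = (if k = 0 then 1 else 0)"
proof -
  have i: "integrable circle (mode n)" for n
    by (rule circle.integrable_const_bound[of _ 1]) auto
  have "(\<integral>x. character k x \<partial>torus) = (\<Prod>j\<in>UNIV. if k $ j = 0 then 1 else 0)"
    unfolding character_eq_prod by (subst integral_torus_prod(2)) (auto simp: integral_mode i intro!: prod.cong)
  also have "\<dots> = (if k = 0 then 1 else 0)"
    by (auto simp: vec_eq_iff)
  finally show ?thesis .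
qed

section \<open>Bounded orthonormal systems\<close>

lemma borel_measurable_cnj [measurable (raw)]:
  "f \<in> borel_measurable M \<Longrightarrow> (\<lambda>x. cnj (f x)) \<in> borel_measurable M"
  by (rule borel_measurable_continuous_on[where f=cnj]) (auto intro: continuous_intros)

text \<open>The exponentials on the circle and the characters of the torus are used in the same way, and the
  Hardy-Littlewood inequality depends only on boundedness and orthonormality.\<close>

locale bounded_orthonormal = prob_space M for M :: "'a measure" +
  fixes e :: "'k \<Rightarrow> 'a \<Rightarrow> complex"
  assumes measurable_e [measurable]: "\<And>k. e k \<in> borel_measurable M"
    and norm_e: "\<And>k x. cmod (e k x) \<le> 1"
    and orthonormal: "\<And>k l. (\<integral>x. e k x * cnj (e l x) \<partial>M) = (if k = l then 1 else 0)"
begin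

lemma integrable_times_e:
  assumes "integrable M f"
  shows "integrable M (\<lambda>x. f x * cnj (e k x))"
proof -
  have [measurable]: "f \<in> borel_measurable M" using assms by simp
  have [measurable]: "(\<lambda>x. cnj (e k x)) \<in> borel_measurable M"
    by (rule borel_measurable_cnj) simp
  show ?thesis
    by (rule Bochner_Integration.integrable_bound[OF assms])
       (use norm_e in \<open>auto simp: norm_mult intro!: mult_left_le\<close>)
qed

lemma integrable_e_e: "integrable M (\<lambda>x. e k x * cnj (e l x))"
  by (rule integrable_times_e, rule integrable_const_bound[of _ 1]) (auto simp: norm_e)

lemma integral_poly_e:
  assumes "finite S"
  shows "(\<integral>x. (\<Sum>k\<in>S. c k * e k x) * cnj (e l x) \<partial>M) = (if l \<in> S then c l else 0)"
proof -
  have "(\<integral>x. (\<Sum>k\<in>S. c k * e k x) * cnj (e l x) \<partial>M) = (\<integral>x. (\<Sum>k\<in>S. c k * (e k x * cnj (e l x))) \<partial>M)"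
    by (simp add: sum_distrib_right mult.assoc)
  also have "\<dots> = (\<Sum>k\<in>S. c k * (if k = l then 1 else 0))"
    by (subst Bochner_Integration.integral_sum) (auto simp: orthonormal integrable_e_e intro!: sum.cong)
  also have "\<dots> = (if l \<in> S then c l else 0)"
    using assms by (simp add: if_distrib cong: if_cong)
  finally show ?thesis .
qed

lemma bounded_poly: "cmod (\<Sum>k\<in>S. c k * e k x) \<le> (\<Sum>k\<in>S. cmod (c k))"
  by (rule sum_norm_le) (simp add: norm_mult norm_e mult_left_le)

lemma integrable_poly: "integrable M (\<lambda>x. \<Sum>k\<in>S. c k * e k x)"
  by (rule integrable_const_bound[of _ "\<Sum>k\<in>S. cmod (c k)"]) (auto simp: bounded_poly)

lemma integral_times_cnj_poly:
  assumes "integrable M f"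
  shows "(\<integral>x. f x * cnj (\<Sum>k\<in>S. c k * e k x) \<partial>M) = (\<Sum>k\<in>S. cnj (c k) * (\<integral>x. f x * cnj (e k x) \<partial>M))"
proof -
  have "(\<integral>x. f x * cnj (\<Sum>k\<in>S. c k * e k x) \<partial>M) = (\<integral>x. (\<Sum>k\<in>S. cnj (c k) * (f x * cnj (e k x))) \<partial>M)"
    by (simp add: sum_distrib_left mult_ac)
  also have "\<dots> = (\<Sum>k\<in>S. cnj (c k) * (\<integral>x. f x * cnj (e k x) \<partial>M))"
    by (subst Bochner_Integration.integral_sum) (auto simp: integrable_times_e[OF assms])
  finally show ?thesis .
qed

lemma parseval_poly:
  assumes "finite S"
  shows "(\<integral>x. (cmod (\<Sum>k\<in>S. c k * e k x))\<^sup>2 \<partial>M) = (\<Sum>k\<in>S. (cmod (c k))\<^sup>2)"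
proof -
  let ?P = "\<lambda>x. \<Sum>k\<in>S. c k * e k x"
  have "complex_of_real (\<integral>x. (cmod (?P x))\<^sup>2 \<partial>M) = (\<integral>x. ?P x * cnj (?P x) \<partial>M)"
    unfolding complex_norm_square[symmetric] by (rule integral_complex_of_real[symmetric])
  also have "\<dots> = (\<Sum>k\<in>S. cnj (c k) * c k)"
    by (subst integral_times_cnj_poly[OF integrable_poly]) (simp add: integral_poly_e[OF assms])
  also have "\<dots> = complex_of_real (\<Sum>k\<in>S. (cmod (c k))\<^sup>2)"
    by (simp only: complex_norm_square of_real_sum mult.commute)
  finally show ?thesis by (simp only: of_real_eq_iff)
qed

text \<open>The squared distance from \<open>f\<close> to its partial sum is nonnegative.\<close>

lemma bessel:
  assumes [measurable]: "f \<in> borel_measurable M" and f2: "integrable M (\<lambda>x. (cmod (f x))\<^sup>2)" and S: "finite S"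
  shows "(\<Sum>k\<in>S. (cmod (\<integral>x. f x * cnj (e k x) \<partial>M))\<^sup>2) \<le> (\<integral>x. (cmod (f x))\<^sup>2 \<partial>M)"
proof -
  define c where "c k = (\<integral>x. f x * cnj (e k x) \<partial>M)" for k
  define P where "P x = (\<Sum>k\<in>S. c k * e k x)" for x
  have f1: "integrable M f"
  proof (rule Bochner_Integration.integrable_bound[of _ "\<lambda>x. 1 + (cmod (f x))\<^sup>2"])
    have "cmod (f x) \<le> 1 + (cmod (f x))\<^sup>2" for x
      using zero_le_power2[of "cmod (f x) - 1"] norm_ge_zero[of "f x"] unfolding power2_diff power_one by linarith
    then show "AE x in M. cmod (f x) \<le> norm (1 + (cmod (f x))\<^sup>2)" by (auto intro!: AE_I2)
  qed (use f2 in auto)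
  have iP: "integrable M (\<lambda>x. (cmod (P x))\<^sup>2)"
    unfolding P_def
    by (rule integrable_const_bound[of _ "(\<Sum>k\<in>S. cmod (c k))\<^sup>2"]) (auto intro!: power_mono bounded_poly)
  have ifP: "integrable M (\<lambda>x. f x * cnj (P x))"
    unfolding P_def cnj_sum complex_cnj_mult sum_distrib_left
    by (rule Bochner_Integration.integrable_sum)
       (use integrable_times_e[OF f1] in \<open>simp add: mult.left_commute[of "f _"]\<close>)
  have c2: "complex_of_real (\<Sum>k\<in>S. (cmod (c k))\<^sup>2) = (\<integral>x. f x * cnj (P x) \<partial>M)"
    unfolding P_def by (subst integral_times_cnj_poly[OF f1])
      (simp only: complex_norm_square of_real_sum mult.commute c_def[symmetric])
  have re: "(\<Sum>k\<in>S. (cmod (c k))\<^sup>2) = (\<integral>x. Re (f x * cnj (P x)) \<partial>M)"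
    using c2 integral_Re[OF ifP] by (metis Re_complex_of_real)
  have "0 \<le> (\<integral>x. (cmod (f x))\<^sup>2 - 2 * Re (f x * cnj (P x)) + (cmod (P x))\<^sup>2 \<partial>M)"
  proof (rule integral_nonneg_AE, rule AE_I2)
    fix x
    have "(cmod (f x - P x))\<^sup>2 = (cmod (f x))\<^sup>2 - 2 * Re (f x * cnj (P x)) + (cmod (P x))\<^sup>2"
      unfolding cmod_power2 by (simp add: power2_eq_square algebra_simps)
    then show "0 \<le> (cmod (f x))\<^sup>2 - 2 * Re (f x * cnj (P x)) + (cmod (P x))\<^sup>2"
      by (metis zero_le_power2)
  qed
  also have "\<dots> = (\<integral>x. (cmod (f x))\<^sup>2 \<partial>M) - 2 * (\<integral>x. Re (f x * cnj (P x)) \<partial>M) + (\<integral>x. (cmod (P x))\<^sup>2 \<partial>M)"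
    using f2 iP integrable_Re[OF ifP]
    by (simp only: Bochner_Integration.integral_add Bochner_Integration.integral_diff
          Bochner_Integration.integrable_diff integrable_mult_right integral_mult_right_zero)
  also have "(\<integral>x. (cmod (P x))\<^sup>2 \<partial>M) = (\<Sum>k\<in>S. (cmod (c k))\<^sup>2)"
    unfolding P_def by (rule parseval_poly[OF S])
  finally show ?thesis using re by (simp add: c_def)
qed

end

interpretation modes: bounded_orthonormal circle mode
proof
  fix k l
  have "(\<integral>x. mode k x * cnj (mode l x) \<partial>circle) = (\<integral>x. mode (k - l) x \<partial>circle)"
    by (simp add: cis_cnj cis_mult algebra_simps)
  then show "(\<integral>x. mode k x * cnj (mode l x) \<partial>circle) = (if k = l then 1 else 0)"
    by (simp add: integral_mode del: of_int_diff)
qed auto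

interpretation characters: bounded_orthonormal torus character
proof
  fix k l :: "int^'a"
  have "(\<integral>x. character k x * cnj (character l x) \<partial>torus) = (\<integral>x. character (k - l) x \<partial>torus)"
    by (simp add: cnj_character character_add[symmetric])
  then show "(\<integral>x. character k x * cnj (character l x) \<partial>torus) = (if k = l then 1 else 0)"
    by (simp add: integral_character)
qed auto

lemma fourier_poly:
  assumes "finite S"
  shows "fourier (\<lambda>x. \<Sum>k\<in>S. c k * character k x) l = (if l \<in> S then c l else 0)"
  unfolding fourier_def by (rule characters.integral_poly_e[OF assms])

section \<open>Uniqueness of Fourier coefficients\<close>

text \<open>Trigonometric polynomials as an inductive class: closure under products is then an induction,
  without bookkeeping of frequencies and coefficients.\<close>

inductive trig_poly :: "'d::finite tfun \<Rightarrow> bool" where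
  monomial: "trig_poly (\<lambda>x. c * character k x)"
| add: "trig_poly u \<Longrightarrow> trig_poly v \<Longrightarrow> trig_poly (\<lambda>x. u x + v x)"

lemma trig_poly_mult:
  assumes "trig_poly u" "trig_poly v"
  shows "trig_poly (\<lambda>x. u x * v x)"
  using assms(1)
proof induction
  case (monomial c k)
  show ?case using assms(2)
  proof induction
    case (monomial c' k')
    have "(\<lambda>x. c * character k x * (c' * character k' x)) = (\<lambda>x. (c * c') * character (k + k') x)"
      by (auto simp: character_add)
    then show ?case using trig_poly.monomial by metis
  next
    case (add u v)
    then show ?case using trig_poly.add by (fastforce simp: distrib_left)
  qed
next
  case (add u v)
  then show ?case using trig_poly.add by (fastforce simp: distrib_right)
qed

lemma character_zero [simp]: "character 0 x = 1"
  by (simp add: character_def)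

lemma trig_poly_const: "trig_poly (\<lambda>x. c)"
  using trig_poly.monomial[of c 0] by simp

lemma trig_poly_bounded_measurable:
  assumes "trig_poly u"
  shows "u \<in> borel_measurable borel \<and> (\<exists>B. \<forall>x. cmod (u x) \<le> B)"
  using assms
proof induction
  case (monomial c k)
  then show ?case by (auto simp: norm_mult)
next
  case (add u v)
  then obtain A B where "\<And>x. cmod (u x) \<le> A" "\<And>x. cmod (v x) \<le> B" by blast
  then have "cmod (u x + v x) \<le> A + B" for x by (meson add_mono norm_triangle_le)
  with add show ?case by auto
qed

lemma integrable_times_bounded:
  fixes f u :: "'a \<Rightarrow> complex"
  assumes f: "integrable M f" and [measurable]: "u \<in> borel_measurable M" and B: "\<And>x. cmod (u x) \<le> B"
  shows "integrable M (\<lambda>x. f x * u x)"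
proof -
  have [measurable]: "f \<in> borel_measurable M" using f by simp
  show ?thesis
  proof (rule Bochner_Integration.integrable_bound[of _ "\<lambda>x. B * cmod (f x)"])
    have "B * cmod (f x) \<ge> cmod (u x) * cmod (f x)" for x
      by (intro mult_right_mono B) auto
    then show "AE x in M. cmod (f x * u x) \<le> norm (B * cmod (f x))"
      by (auto simp: norm_mult mult.commute intro!: AE_I2 order_trans[OF _ abs_ge_self])
  qed (use f in auto)
qed

lemma integral_times_trig_poly:
  assumes "trig_poly u" and f: "integrable torus f" and z: "\<And>k. fourier f k = 0"
  shows "(\<integral>x. f x * u x \<partial>torus) = 0"
  using assms(1)
proof induction
  case (monomial c k)
  have "(\<integral>x. f x * (c * character k x) \<partial>torus) = c * (\<integral>x. f x * cnj (character (- k) x) \<partial>torus)"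
    by (simp add: cnj_character mult.left_commute)
  then show ?case using z[of "-k"] by (simp add: fourier_def)
next
  case (add u v)
  have "integrable torus (\<lambda>x. f x * u x)" if u: "trig_poly u" for u
    using trig_poly_bounded_measurable[OF u] by (auto intro: integrable_times_bounded[OF f])
  with add show ?case by (simp add: distrib_left)
qed

abbreviation embed_torus :: "real^'d::finite \<Rightarrow> complex^'d" where
  "embed_torus x \<equiv> (\<chi> j. cis (x $ j))"

text \<open>On the period cell itself the trigonometric polynomials do not separate opposite faces.  They do
  on the image of the torus under \<open>x \<mapsto> (cis x_j)\<close>, a compact set in \<open>complex ^ 'd\<close>.\<close>

definition torus_set :: "(complex^'d::finite) set" where
  "torus_set = {z. \<forall>j. cmod (z $ j) = 1}"

lemma compact_torus_set: "compact (torus_set :: (complex^'d::finite) set)"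
proof -
  have "closed (torus_set :: (complex^'d::finite) set)"
    unfolding torus_set_def by (intro closed_Collect_all closed_Collect_eq continuous_intros)
  moreover have "norm z \<le> CARD('d)" if "z \<in> torus_set" for z :: "complex^'d"
    using L2_set_le_sum[of UNIV "\<lambda>j. norm (z $ j)"] that by (simp add: torus_set_def norm_vec_def)
  then have "bounded (torus_set :: (complex^'d::finite) set)"
    unfolding bounded_iff by blast
  ultimately show ?thesis by (simp add: compact_eq_bounded_closed)
qed

lemma continuous_embed_torus: "continuous_on A (embed_torus :: real^'d::finite \<Rightarrow> _)"
  by (intro continuous_on_vec_lambda continuous_intros)

lemma character_axis: "character (axis j n) x = cis (of_int n * x $ j)"
proof -
  have "(\<Sum>i\<in>UNIV. of_int (axis j n $ i) * x $ i) = (\<Sum>i\<in>UNIV. if i = j then of_int n * x $ j else 0)"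
    by (intro sum.cong) (auto simp: axis_def)
  then show ?thesis by (simp add: character_def)
qed

lemma trig_poly_coordinates:
  shows "trig_poly (\<lambda>x. complex_of_real (Re (embed_torus x $ j)))"
    and "trig_poly (\<lambda>x. complex_of_real (Im (embed_torus x $ j)))"
proof -
  have r: "complex_of_real (Re (embed_torus x $ j)) = (1/2) * character (axis j 1) x + (1/2) * character (axis j (-1)) x" for x
    by (simp add: character_axis complex_eq_iff)
  show "trig_poly (\<lambda>x. complex_of_real (Re (embed_torus x $ j)))"
    unfolding r by (intro trig_poly.intros)
  have i: "complex_of_real (Im (embed_torus x $ j)) = (-\<i>/2) * character (axis j 1) x + (\<i>/2) * character (axis j (-1)) x" for x
    by (simp add: character_axis complex_eq_iff)
  show "trig_poly (\<lambda>x. complex_of_real (Im (embed_torus x $ j)))"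
    unfolding i by (intro trig_poly.intros)
qed

text \<open>By the Stone-Weierstrass theorem a continuous function on the torus is a uniform limit of
  trigonometric polynomials, and these are orthogonal to \<open>f\<close>.\<close>

lemma integral_times_continuous:
  fixes h :: "complex^'d::finite \<Rightarrow> real"
  assumes f: "integrable torus f" and z: "\<And>k. fourier f k = 0" and h: "continuous_on torus_set h"
  shows "(\<integral>x. f x * complex_of_real (h (embed_torus x)) \<partial>torus) = 0"
proof -
  define P where "P h \<longleftrightarrow> continuous_on torus_set h \<and> trig_poly (\<lambda>x. complex_of_real (h (embed_torus x)))"
    for h :: "complex^'d \<Rightarrow> real"
  have emb: "embed_torus x \<in> torus_set" for x :: "real^'d" by (simp add: torus_set_def)
  have mh: "(\<lambda>x. complex_of_real (h (embed_torus x))) \<in> borel_measurable borel"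
    by (intro borel_measurable_continuous_onI continuous_on_of_real
          continuous_on_compose2[OF h continuous_embed_torus]) (use emb in auto)
  have appr: "\<exists>g. P g \<and> (\<forall>x\<in>torus_set. \<bar>h x - g x\<bar> < \<epsilon>)" if "\<epsilon> > 0" for \<epsilon>
  proof (rule Stone_Weierstrass_HOL[OF compact_torus_set _ _ _ _ _ h that])
    show "P (\<lambda>x. c)" for c by (simp add: P_def trig_poly_const)
    show "P f \<Longrightarrow> continuous_on torus_set f" for f by (simp add: P_def)
    show "P (\<lambda>x. f x + g x)" if "P f \<and> P g" for f g
      using that by (auto simp: P_def intro!: continuous_intros trig_poly.add)
    show "P (\<lambda>x. f x * g x)" if "P f \<and> P g" for f g
      using that by (auto simp: P_def intro!: continuous_intros trig_poly_mult)
    show "\<exists>f. P f \<and> f x \<noteq> f y" if "x \<in> torus_set \<and> y \<in> torus_set \<and> x \<noteq> y" for x y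
    proof -
      from that obtain j where "x $ j \<noteq> y $ j" by (auto simp: vec_eq_iff)
      then consider "Re (x $ j) \<noteq> Re (y $ j)" | "Im (x $ j) \<noteq> Im (y $ j)" by (auto simp: complex_eq_iff)
      then show ?thesis
      proof cases
        case 1
        have "P (\<lambda>z. Re (z $ j))" unfolding P_def using trig_poly_coordinates(1)[of j] by (auto intro!: continuous_intros)
        with 1 show ?thesis by blast
      next
        case 2
        have "P (\<lambda>z. Im (z $ j))" unfolding P_def using trig_poly_coordinates(2)[of j] by (auto intro!: continuous_intros)
        with 2 show ?thesis by blast
      qed
    qed
  qed
  have "compact (h ` torus_set)" by (rule compact_continuous_image[OF h compact_torus_set])
  then obtain B where B: "\<And>x. x \<in> torus_set \<Longrightarrow> \<bar>h x\<bar> \<le> B"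
    by (metis bounded_iff compact_imp_bounded image_eqI real_norm_def)
  have ih: "integrable torus (\<lambda>x. f x * complex_of_real (h (embed_torus x)))"
    using mh by (intro integrable_times_bounded[OF f, of _ B]) (use B emb in auto)
  have small: "cmod (\<integral>x. f x * complex_of_real (h (embed_torus x)) \<partial>torus) \<le> \<epsilon> * (\<integral>x. cmod (f x) \<partial>torus)" if e: "\<epsilon> > 0" for \<epsilon>
  proof -
    obtain g where g: "P g" "\<And>x. x \<in> torus_set \<Longrightarrow> \<bar>h x - g x\<bar> < \<epsilon>" using appr[OF e] by blast
    let ?g = "\<lambda>x. complex_of_real (g (embed_torus x))"
    have tg: "trig_poly ?g" using g by (simp add: P_def)
    obtain Bg where Bg: "\<And>x. cmod (?g x) \<le> Bg" and mg: "?g \<in> borel_measurable borel"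
      using trig_poly_bounded_measurable[OF tg] by blast
    have ig: "integrable torus (\<lambda>x. f x * ?g x)"
      using mg by (intro integrable_times_bounded[OF f _ Bg]) simp
    have "(\<integral>x. f x * complex_of_real (h (embed_torus x)) \<partial>torus)
       = (\<integral>x. f x * complex_of_real (h (embed_torus x)) \<partial>torus) - (\<integral>x. f x * ?g x \<partial>torus)"
      using integral_times_trig_poly[OF tg f z] by simp
    also have "\<dots> = (\<integral>x. f x * complex_of_real (h (embed_torus x)) - f x * ?g x \<partial>torus)"
      using ih ig by simp
    also have "cmod \<dots> \<le> (\<integral>x. \<epsilon> * cmod (f x) \<partial>torus)"
    proof (rule order_trans[OF integral_norm_bound integral_mono])
      show "cmod (f x * complex_of_real (h (embed_torus x)) - f x * ?g x) \<le> \<epsilon> * cmod (f x)" for x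
      proof -
        have "cmod (f x * complex_of_real (h (embed_torus x)) - f x * ?g x) = cmod (f x) * \<bar>h (embed_torus x) - g (embed_torus x)\<bar>"
          by (simp add: right_diff_distrib[symmetric] norm_mult of_real_diff[symmetric] del: of_real_diff)
        also have "\<dots> \<le> cmod (f x) * \<epsilon>"
          using g(2)[OF emb[of x]] by (intro mult_left_mono) auto
        finally show ?thesis by (simp add: mult.commute)
      qed
    qed (use f ih ig in auto)
    finally show ?thesis by simp
  qed
  define I where "I = (\<integral>x. cmod (f x) \<partial>torus)"
  have I0: "I \<ge> 0" by (simp add: I_def)
  have "cmod (\<integral>x. f x * complex_of_real (h (embed_torus x)) \<partial>torus) \<le> 0 + \<epsilon>" if "\<epsilon> > 0" for \<epsilon>
  proof -
    have "\<epsilon> / (I + 1) * I \<le> \<epsilon>" using I0 that by (simp add: field_simps)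
    with small[of "\<epsilon> / (I + 1)"] that I0 show ?thesis by (fold I_def) simp
  qed
  then show ?thesis using field_le_epsilon[of "cmod (\<integral>x. f x * complex_of_real (h (embed_torus x)) \<partial>torus)" 0] by simp
qed

text \<open>A periodic continuous description of an interval: this is what makes the indicator function of a
  box a limit of continuous functions on the torus.\<close>

lemma cos_less_iff_in_interval:
  fixes a b x :: real
  assumes "0 \<le> a" "a < b" "b \<le> 2*pi" "0 \<le> x" "x \<le> 2*pi"
  shows "cos ((b - a) / 2) < cos (x - (a + b) / 2) \<longleftrightarrow> a < x \<and> x < b"
proof -
  define y where "y = \<bar>x - (a + b) / 2\<bar>"
  have cy: "cos (x - (a + b) / 2) = cos y" by (simp add: y_def)
  have ab: "a < x \<and> x < b \<longleftrightarrow> y < (b - a) / 2" unfolding y_def abs_if by (auto simp: field_simps)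
  have h: "0 < (b - a) / 2" "(b - a) / 2 \<le> pi" using assms by auto
  have y: "0 \<le> y" by (simp add: y_def)
  show ?thesis
  proof (cases "y \<le> pi")
    case True
    then show ?thesis unfolding cy ab using cos_mono_less_eq[of "(b-a)/2" y] h y by simp
  next
    case False
    have le: "2*pi - y \<ge> (b - a) / 2" using assms unfolding y_def abs_if by (auto simp: field_simps)
    have "cos y = cos (2*pi - y)" by (simp add: cos_diff)
    also have "\<dots> \<le> cos ((b - a) / 2)"
      using cos_mono_le_eq[of "2*pi - y" "(b-a)/2"] h le False by auto
    finally show ?thesis unfolding cy ab using False h by auto
  qed
qed

text \<open>The functions \<open>min 1 (n \<Prod>j. (cos (x_j - c_j) - cos h_j)^+)\<close>, where \<open>c_j\<close> and \<open>h_j\<close> are the midpoint and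
  half the length of the \<open>j\<close>-th side, are continuous on the torus and increase to the indicator
  function of the box.\<close>

lemma integral_open_box_zero:
  fixes f :: "'d::finite tfun"
  assumes f: "integrable torus f" and z: "\<And>k. fourier f k = 0"
    and ab: "\<And>j. 0 \<le> a $ j" "\<And>j. a $ j < b $ j" "\<And>j. b $ j \<le> 2*pi"
  shows "(\<integral>x. f x * indicator (box a b) x \<partial>torus) = 0"
proof -
  define w where "w j z = max 0 (Re (z * cis (- (a$j + b$j)/2)) - cos ((b$j - a$j)/2))" for j z
  define h where "h n z = min 1 (real n * (\<Prod>j\<in>UNIV. w j (z $ j)))" for n and z :: "complex^'d"
  have ch: "continuous_on torus_set (h n)" for n
    unfolding h_def w_def by (intro continuous_intros)
  have w0: "w j z \<ge> 0" for j z by (simp add: w_def)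
  have h01: "0 \<le> h n z" "h n z \<le> 1" for n z
    by (auto simp: h_def intro!: mult_nonneg_nonneg prod_nonneg w0)
  have wpos: "w j (cis t) > 0 \<longleftrightarrow> a $ j < t \<and> t < b $ j" if "0 \<le> t" "t \<le> 2*pi" for j t
  proof -
    have "Re (cis t * cis (- (a$j + b$j)/2)) = cos (t - (a$j + b$j)/2)"
    proof -
      have "t + - (a$j + b$j)/2 = t - (a$j + b$j)/2" by argo
      then show ?thesis by (simp only: cis_mult cis.sel)
    qed
    then show ?thesis using cos_less_iff_in_interval[OF ab(1) ab(2) ab(3) that, of j]
      by (auto simp: w_def less_max_iff_disj)
  qed
  have mh: "(\<lambda>x. complex_of_real (h n (embed_torus x))) \<in> borel_measurable borel" for n
    by (intro borel_measurable_continuous_onI continuous_on_of_real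
          continuous_on_compose2[OF ch continuous_embed_torus]) (auto simp: torus_set_def)
  have cell: "AE x in (torus :: (real^'d) measure). \<forall>j. 0 \<le> x $ j \<and> x $ j \<le> 2 * pi"
  proof -
    have "AE x in (torus :: (real^'d) measure). x \<in> cbox 0 (\<chi> j. 2 * pi)"
      unfolding torus_def by (rule AE_uniform_measureI) auto
    then show ?thesis by (auto simp: mem_box_cart)
  qed
  have "(\<lambda>n. \<integral>x. f x * complex_of_real (h n (embed_torus x)) \<partial>torus) \<longlonglongrightarrow> (\<integral>x. f x * indicator (box a b) x \<partial>torus)"
  proof (rule integral_dominated_convergence[where w="\<lambda>x. cmod (f x)"])
    show "AE x in torus. (\<lambda>n. f x * complex_of_real (h n (embed_torus x))) \<longlonglongrightarrow> f x * indicator (box a b) x"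
    proof (use cell in eventually_elim)
      fix x :: "real^'d" assume x: "\<forall>j. 0 \<le> x $ j \<and> x $ j \<le> 2 * pi"
      define p where "p = (\<Prod>j\<in>UNIV. w j (cis (x $ j)))"
      have "(\<lambda>n. h n (embed_torus x)) \<longlonglongrightarrow> indicator (box a b) x"
      proof (cases "x \<in> box a b")
        case True
        then have "p > 0" unfolding p_def using x by (intro prod_pos) (auto simp: wpos mem_box_cart)
        then obtain N where N: "1 \<le> real N * p"
          by (metis reals_Archimedean3 less_imp_le)
        have "h n (embed_torus x) = 1" if "n \<ge> N" for n
        proof -
          have "real N * p \<le> real n * p" using that \<open>p > 0\<close> by (intro mult_right_mono) auto
          with N show ?thesis by (simp add: h_def p_def)
        qed
        then have "\<forall>\<^sub>F n in sequentially. h n (embed_torus x) = 1" by (auto simp: eventually_sequentially)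
        with True show ?thesis by (simp add: tendsto_eventually)
      next
        case False
        then obtain j where "\<not> (a $ j < x $ j \<and> x $ j < b $ j)" by (auto simp: mem_box_cart)
        then have "\<not> w j (cis (x $ j)) > 0" using x by (simp add: wpos)
        then have "w j (cis (x $ j)) = 0" using w0[of j "cis (x $ j)"] by linarith
        then have "p = 0" unfolding p_def by (intro prod_zero) auto
        moreover have "h n (embed_torus x) = min 1 (real n * p)" for n by (simp add: h_def p_def)
        ultimately have "h n (embed_torus x) = 0" for n by simp
        with False show ?thesis by simp
      qed
      from tendsto_mult_left[OF tendsto_of_real[OF this], of "f x"]
      show "(\<lambda>n. f x * complex_of_real (h n (embed_torus x))) \<longlonglongrightarrow> f x * indicator (box a b) x"
        by (simp add: indicator_def of_bool_def split: if_splits)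
    qed
    show "AE x in torus. cmod (f x * complex_of_real (h n (embed_torus x))) \<le> cmod (f x)" for n
      using h01 by (auto simp: norm_mult mult_left_le intro!: AE_I2)
  qed (use f mh in auto)
  then show ?thesis
    using integral_times_continuous[OF f z ch] by (simp add: LIMSEQ_const_iff)
qed

lemma AE_torus_open_cell: "AE x in torus. \<forall>j. 0 < x $ j \<and> x $ j < 2 * pi"
proof -
  have "emeasure torus {x::real^'d. \<forall>j. x $ j \<in> {0<..<2*pi}} = 1"
    by (subst emeasure_torus_product_set) (auto simp: emeasure_circle_open_interval)
  then have "AE x in torus. x \<in> {x::real^'d. \<forall>j. x $ j \<in> {0<..<2*pi}}"
    by (subst torus.AE_in_set_eq_1) (auto simp: torus.emeasure_eq_measure)
  then show ?thesis by simp
qed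

text \<open>Boxes form a system stable under intersection that generates the Borel sets, so the integral of
  \<open>f\<close> vanishes over every Borel set.\<close>

lemma fourier_unique_zero:
  fixes f :: "'d::finite tfun"
  assumes f: "integrable torus f" and z: "\<And>k. fourier f k = 0"
  shows "AE x in torus. f x = 0"
proof (rule torus.density_zero[OF f])
  have [measurable]: "f \<in> borel_measurable borel" using f by (auto dest: borel_measurable_integrable)
  have b: "(\<integral>x. f x * indicator (box a b) x \<partial>torus) = 0" for a b :: "real^'d"
  proof -
    define a' b' :: "real^'d" where "a' = (\<chi> j. max 0 (a $ j))" and "b' = (\<chi> j. min (2*pi) (b $ j))"
    have "(\<integral>x. f x * indicator (box a b) x \<partial>torus) = (\<integral>x. f x * indicator (box a' b') x \<partial>torus)"
      by (rule integral_cong_AE, simp, simp, use AE_torus_open_cell in eventually_elim)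
         (auto simp: indicator_def mem_box_cart a'_def b'_def)
    also have "\<dots> = 0"
    proof (cases "\<forall>j. a' $ j < b' $ j")
      case True
      then show ?thesis
        by (intro integral_open_box_zero[OF f z]) (auto simp: a'_def b'_def)
    next
      case False
      then obtain j where j: "\<not> a' $ j < b' $ j" by auto
      have "box a' b' = {}"
        using j less_trans unfolding set_eq_iff mem_box_cart by blast
      then show ?thesis by simp
    qed
    finally show ?thesis .
  qed
  have key: "(\<integral>x. f x * indicator A x \<partial>torus) = 0" if "A \<in> sets borel" for A :: "(real^'d) set"
  proof -
    have *: "A \<in> sigma_sets UNIV (range (\<lambda>(a, b). box a b))"
      using that unfolding borel_eq_box by simp
    have S: "sigma_sets UNIV (range (\<lambda>(a, b). box a b :: (real^'d) set)) = sets borel"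
      unfolding borel_eq_box by simp
    have int: "integrable torus (\<lambda>x. f x * indicator A x)" if "A \<in> sets borel" for A :: "(real^'d) set"
      using that by (intro integrable_times_bounded[OF f, of _ 1]) (auto simp: indicator_def)
    show ?thesis
      using _ _ *
    proof (rule sigma_sets_induct_disjoint)
      show "Int_stable (range (\<lambda>(a, b). box a b :: (real^'d) set))"
        by (auto simp: Int_stable_def box_Int_box)
      show "(\<integral>x. f x * indicator A x \<partial>torus) = 0" if "A \<in> range (\<lambda>(a, b). box a b)" for A :: "(real^'d) set"
        using that b by auto
      show "(\<integral>x. f x * indicator (UNIV - A) x \<partial>torus) = 0"
        if A: "A \<in> sigma_sets UNIV (range (\<lambda>(a, b). box a b))" and I: "(\<integral>x. f x * indicator A x \<partial>torus) = 0" for A :: "(real^'d) set"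
      proof -
        have "(\<integral>x. f x * indicator (UNIV - A) x \<partial>torus) = (\<integral>x. f x - f x * indicator A x \<partial>torus)"
          by (intro Bochner_Integration.integral_cong) (auto simp: indicator_def)
        also have "\<dots> = (\<integral>x. f x \<partial>torus)"
          using I f int[of A] A unfolding S by simp
        also have "\<dots> = fourier f 0" by (simp add: fourier_def)
        finally show ?thesis using z by simp
      qed
      show "(\<integral>x. f x * indicator (\<Union>i. A i) x \<partial>torus) = 0"
        if dis: "disjoint_family A" and "range A \<subseteq> sigma_sets UNIV (range (\<lambda>(a, b). box a b))"
          and I: "\<And>i. (\<integral>x. f x * indicator (A i) x \<partial>torus) = 0" for A :: "nat \<Rightarrow> (real^'d) set"
      proof -
        have A: "A i \<in> sets borel" for i using that S by auto
        have e: "complex_set_lebesgue_integral torus B f = (\<integral>x. f x * indicator B x \<partial>torus)" for B :: "(real^'d) set"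
          unfolding set_lebesgue_integral_def
          by (intro Bochner_Integration.integral_cong) (auto simp: indicator_def)
        have "(LINT x:(\<Union>i. A i)|torus. f x) = (\<Sum>i. (LINT x:(A i)|torus. f x))"
        proof (rule lebesgue_integral_countable_add)
          show "set_integrable torus (\<Union> (range A)) f"
            unfolding set_integrable_def by (rule integrable_mult_indicator) (use A f in auto)
        qed (use A dis in \<open>auto simp: disjoint_family_on_def\<close>)
        then show ?thesis unfolding e using I by simp
      qed
    qed auto
  qed
  fix A assume "A \<in> sets (torus :: (real^'d) measure)"
  then have "(\<integral>x. f x * indicator A x \<partial>torus) = 0" by (intro key) simp
  moreover have "(\<integral>x. indicator A x *\<^sub>R f x \<partial>torus) = (\<integral>x. f x * indicator A x \<partial>torus)"
    by (intro Bochner_Integration.integral_cong) (auto simp: indicator_def)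
  ultimately show "complex_set_lebesgue_integral torus A f = 0"
    unfolding set_lebesgue_integral_def by simp
qed

lemma fourier_unique:
  fixes f g :: "'d::finite tfun"
  assumes f: "integrable torus f" and g: "integrable torus g" and e: "\<And>k. fourier f k = fourier g k"
  shows "AE x in torus. f x = g x"
proof -
  have "fourier (\<lambda>x. f x - g x) k = 0" for k
    unfolding fourier_def left_diff_distrib
    using e[of k] characters.integrable_times_e[OF f, of k] characters.integrable_times_e[OF g, of k]
    by (simp add: fourier_def)
  from fourier_unique_zero[OF _ this] f g show ?thesis by simp
qed

section \<open>The one-dimensional kernel and its Fourier coefficients\<close>

lemma sum_powr_le:
  fixes r :: real
  assumes r: "0 < r" "r < 1"
  shows "(\<Sum>k=1..n. real k powr (- r)) \<le> real n powr (1 - r) / (1 - r)"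
proof (induction n)
  case (Suc n)
  have step: "real (Suc n) powr (- r) \<le> (real (Suc n) powr (1 - r) - real n powr (1 - r)) / (1 - r)"
  proof (cases "n = 0")
    case True
    then show ?thesis using r by simp
  next
    case False
    have "\<exists>z. real n < z \<and> z < real (Suc n) \<and>
        real (Suc n) powr (1 - r) - real n powr (1 - r) = (real (Suc n) - real n) * ((1 - r) * z powr (1 - r - 1))"
      by (rule MVT2, simp, rule has_real_derivative_powr) (use False in auto)
    then obtain z where z: "real n < z" "z < real (Suc n)"
      "real (Suc n) powr (1 - r) - real n powr (1 - r) = (1 - r) * z powr (- r)" by auto
    have "real (Suc n) powr (- r) \<le> z powr (- r)"
      using z False r by (intro powr_mono2') auto
    then show ?thesis unfolding z(3) using r by simp
  qed
  have "(\<Sum>k=1..Suc n. real k powr (- r)) \<le> real n powr (1 - r) / (1 - r) + real (Suc n) powr (- r)"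
    using Suc by simp
  also have "\<dots> \<le> real (Suc n) powr (1 - r) / (1 - r)"
    using step by (simp add: diff_divide_distrib)
  finally show ?case .
qed (use r in auto)

text \<open>Multiplication by \<open>1 - z\<close> turns the sum into a telescoping one with decreasing weights.\<close>

lemma abel_bound:
  fixes u :: "nat \<Rightarrow> real" and z :: complex
  assumes dec: "\<And>k. a \<le> k \<Longrightarrow> k < b \<Longrightarrow> u (Suc k) \<le> u k" and nn: "\<And>k. a \<le> k \<Longrightarrow> k \<le> b \<Longrightarrow> 0 \<le> u k"
    and z: "cmod z = 1" and ab: "a \<le> b"
  shows "cmod (1 - z) * cmod (\<Sum>k=a..b. of_real (u k) * z ^ k) \<le> 2 * u a"
proof -
  have "\<exists>R. (1 - z) * (\<Sum>k=a..b. of_real (u k) * z ^ k) = of_real (u a) * z ^ a - of_real (u b) * z ^ (Suc b) + R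
     \<and> cmod R \<le> u a - u b"
    using ab dec nn
  proof (induction b rule: dec_induct)
    case base
    then show ?case by (intro exI[of _ 0]) (auto simp: algebra_simps)
  next
    case (step n)
    from step obtain R where R: "(1 - z) * (\<Sum>k=a..n. of_real (u k) * z ^ k) = of_real (u a) * z ^ a - of_real (u n) * z ^ (Suc n) + R"
      "cmod R \<le> u a - u n" by auto
    define R' where "R' = R + of_real (u (Suc n) - u n) * z ^ (Suc n)"
    have "cmod R' \<le> cmod R + \<bar>u (Suc n) - u n\<bar>"
      unfolding R'_def by (rule order_trans[OF norm_triangle_ineq]) (simp add: norm_mult norm_power z del: of_real_diff)
    also have "\<dots> \<le> u a - u (Suc n)" using R(2) step by auto
    finally have 1: "cmod R' \<le> u a - u (Suc n)" .
    have "(1 - z) * (\<Sum>k=a..Suc n. of_real (u k) * z ^ k)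
        = (1 - z) * (\<Sum>k=a..n. of_real (u k) * z ^ k) + (1 - z) * (of_real (u (Suc n)) * z ^ Suc n)"
      using step by (simp add: distrib_left)
    also have "\<dots> = of_real (u a) * z ^ a - of_real (u (Suc n)) * z ^ (Suc (Suc n)) + R'"
      unfolding R(1) R'_def by (simp add: algebra_simps)
    finally show ?case using 1 by blast
  qed
  then obtain R where R: "(1 - z) * (\<Sum>k=a..b. of_real (u k) * z ^ k) = of_real (u a) * z ^ a - of_real (u b) * z ^ (Suc b) + R"
      "cmod R \<le> u a - u b" by blast
  have "cmod (1 - z) * cmod (\<Sum>k=a..b. of_real (u k) * z ^ k) = cmod (of_real (u a) * z ^ a - of_real (u b) * z ^ (Suc b) + R)"
    using R(1) by (simp add: norm_mult[symmetric])
  also have "\<dots> \<le> (cmod (of_real (u a) * z ^ a) + cmod (of_real (u b) * z ^ (Suc b))) + cmod R"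
    by (intro order_trans[OF norm_triangle_ineq] add_right_mono norm_triangle_ineq4)
  also have "\<dots> = u a + u b + cmod R"
    using nn[of a] nn[of b] ab by (simp add: norm_mult norm_power z del: power_Suc)
  also have "\<dots> \<le> 2 * u a" using R(2) by simp
  finally show ?thesis .
qed

text \<open>The distance between \<open>1\<close> and \<open>cis t\<close>: a periodic substitute for \<open>|t|\<close> near the multiples of \<open>2\<pi>\<close>.\<close>

definition chord :: "real \<Rightarrow> real" where
  "chord t = cmod (1 - cis t)"

lemma chord_le_2: "chord t \<le> 2"
  unfolding chord_def using norm_triangle_ineq4[of 1 "cis t"] by simp

lemma chord_nonneg: "0 \<le> chord t" by (simp add: chord_def)

lemma measurable_chord [measurable]: "chord \<in> borel_measurable borel"
  unfolding chord_def by (intro borel_measurable_continuous_onI continuous_intros)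

lemma chord_eq_sin: "chord t = 2 * \<bar>sin (t / 2)\<bar>"
proof -
  have "(chord t)\<^sup>2 = (2 * \<bar>sin (t / 2)\<bar>)\<^sup>2"
  proof -
    have "(chord t)\<^sup>2 = (1 - cos t)\<^sup>2 + (sin t)\<^sup>2"
      by (simp add: chord_def cmod_power2)
    also have "\<dots> = 2 * (1 - cos t)" 
      using sin_cos_squared_add[of t] by (simp add: power2_eq_square algebra_simps)
    also have "cos t = 1 - 2 * (sin (t/2))\<^sup>2" using cos_double_sin[of "t/2"] by simp
    finally show ?thesis by (simp add: power2_eq_square)
  qed
  then show ?thesis by (rule power2_eq_imp_eq) (simp_all add: chord_nonneg)
qed

lemma sin_ge_linear:
  fixes t :: real
  assumes "0 \<le> t" "t \<le> pi/2"
  shows "sin t \<ge> 2 / pi * t"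
proof -
  have "concave_on {0..pi/2} sin"
  proof (rule f''_le0_imp_concave[where f' = cos and f'' = "\<lambda>x. - sin x"])
    show "- sin x \<le> 0" if "x \<in> {0..pi/2}" for x :: real
      using that sin_ge_zero[of x] by auto
  qed (auto intro!: derivative_eq_intros)
  then have "sin ((1 - 2/pi*t) *\<^sub>R 0 + (2/pi*t) *\<^sub>R (pi/2)) \<ge> (1 - 2/pi*t) * sin 0 + (2/pi*t) * sin (pi/2)"
    using assms by (intro concave_onD) (auto simp: field_simps)
  then show ?thesis by simp
qed

lemma chord_ge:
  assumes "0 \<le> t" "t \<le> 2*pi"
  shows "t \<le> pi \<Longrightarrow> chord t \<ge> 2/pi * t" and "pi \<le> t \<Longrightarrow> chord t \<ge> 2/pi * (2*pi - t)"
proof -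
  have s: "chord t = 2 * sin (t/2)" unfolding chord_eq_sin using assms by (simp add: sin_ge_zero)
  show "chord t \<ge> 2/pi * t" if "t \<le> pi"
    unfolding s using sin_ge_linear[of "t/2"] assms that by simp
  show "chord t \<ge> 2/pi * (2*pi - t)" if "pi \<le> t"
  proof -
    have "sin (t/2) = sin (pi - t/2)" by simp
    also have "\<dots> \<ge> 2/pi * (pi - t/2)" using assms that by (intro sin_ge_linear) auto
    finally show ?thesis unfolding s by (simp add: field_simps)
  qed
qed

text \<open>The terms with \<open>k \<le> 1 / chord x\<close> are bounded by absolute values, the remaining ones by Abel
  summation; both contributions are of size \<open>chord x powr (r - 1)\<close>.  The bound is uniform in \<open>n\<close> and
  integrable, which settles the convergence of the kernel, and it also controls the extremal
  function of the lower bound.\<close>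

lemma trig_sum_bound:
  fixes r :: real
  assumes r: "0 < r" "r < 1" and x: "chord x > 0"
  shows "cmod (\<Sum>k=1..n. of_real (real k powr (- r)) * cis (real k * x)) \<le> (3 / (1 - r) + 2) * chord x powr (r - 1)"
proof -
  define D where "D = chord x"
  have D: "0 < D" "D \<le> 2" using x chord_le_2 by (auto simp: D_def)
  \<comment> \<open>The index at which the two ways of estimating the terms balance.\<close>
  define N where "N = nat \<lceil>1 / D\<rceil>"
  have N: "1 / D \<le> real N" "real N \<le> 3 / D"
  proof -
    show "1 / D \<le> real N" unfolding N_def by linarith
    have "real N \<le> 1 / D + 1" unfolding N_def using D by (simp add: of_nat_nat)
    also have "\<dots> \<le> 3 / D" using D by (simp add: field_simps)
    finally show "real N \<le> 3 / D" .
  qed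
  let ?s = "\<lambda>k. of_real (real k powr (- r)) * cis (real k * x) :: complex"
  have cr: "1 powr (r-1) = (1::real)" by simp
  have head: "cmod (\<Sum>k=1..m. ?s k) \<le> 3 / (1 - r) * D powr (r - 1)" if "m \<le> N" for m
  proof -
    have "cmod (\<Sum>k=1..m. ?s k) \<le> (\<Sum>k=1..m. real k powr (- r))"
      by (rule sum_norm_le) (simp add: norm_mult)
    also have "\<dots> \<le> real m powr (1 - r) / (1 - r)" by (rule sum_powr_le[OF r])
    also have "\<dots> \<le> (3 / D) powr (1 - r) / (1 - r)"
      using N that r by (intro divide_right_mono powr_mono2) auto
    also have "(3 / D) powr (1 - r) = 3 powr (1 - r) * D powr (r - 1)"
      using D by (simp add: powr_divide powr_minus_divide[symmetric] powr_mult divide_powr_uminus)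
    also have "3 powr (1 - r) * D powr (r - 1) / (1 - r) \<le> 3 * D powr (r - 1) / (1 - r)"
      using r powr_mono[of "1-r" 1 3] by (intro divide_right_mono mult_right_mono) auto
    finally show ?thesis by simp
  qed
  show ?thesis
  proof (cases "n \<le> N")
    case True
    have "0 \<le> 2 * D powr (r - 1)" by simp
    with head[OF True] show ?thesis unfolding D_def[symmetric] distrib_right by linarith
  next
    case False
    have "(\<Sum>k=1..n. ?s k) = (\<Sum>k=1..N. ?s k) + (\<Sum>k=Suc N..n. ?s k)"
      using False sum.ub_add_nat[of 1 N ?s "n - N"] by simp
    moreover have "cmod (\<Sum>k=Suc N..n. ?s k) \<le> 2 * D powr (r - 1)"
    proof -
      have "D * cmod (\<Sum>k=Suc N..n. of_real (real k powr (- r)) * cis x ^ k) \<le> 2 * real (Suc N) powr (- r)"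
        unfolding D_def chord_def
        by (rule abel_bound) (use False r in \<open>auto intro!: powr_mono2'\<close>)
      also have "real (Suc N) powr (- r) \<le> (1 / D) powr (- r)"
        using N D r by (intro powr_mono2') auto
      also have "(1 / D) powr (- r) = D powr r" using D by (simp add: powr_divide powr_minus_divide)
      finally have "cmod (\<Sum>k=Suc N..n. of_real (real k powr (- r)) * cis x ^ k) \<le> 2 * D powr r / D"
        using D by (simp add: field_simps)
      also have "2 * D powr r / D = 2 * D powr (r - 1)" using D by (simp add: powr_diff)
      finally show ?thesis by (simp add: Complex.DeMoivre)
    qed
    ultimately show ?thesis using head[of N]
      by (simp add: D_def distrib_right del: times_divide_eq_left)
         (meson add_mono norm_triangle_le order_trans)
  qed
qed

lemma integrable_chord_powr:
  assumes "0 < r"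
  shows "integrable circle (\<lambda>x. chord x powr (r - 1))"
proof (cases "r \<ge> 1")
  case True
  then have "chord x powr (r - 1) \<le> 2 powr (r - 1)" for x
    by (intro powr_mono2 chord_nonneg chord_le_2) auto
  then show ?thesis by (intro circle.integrable_const_bound[of _ "2 powr (r - 1)"]) auto
next
  case False
  \<comment> \<open>A majorant near the left end of the period; its reflection serves the right end.\<close>
  define g where "g x = (2/pi) powr (r - 1) * x powr (r - 1)" for x :: real
  have "(\<lambda>x. x powr (r - 1)) integrable_on {0..2*pi}"
    using has_integral_powr_from_0[of "r-1" "2*pi"] assms by (auto intro: has_integral_integrable)
  then have "(\<lambda>x. x powr (r - 1)) absolutely_integrable_on {0..2*pi}"
    by (rule nonnegative_absolutely_integrable_1) simp
  then have i0: "set_integrable lborel {0..2*pi} (\<lambda>x. x powr (r - 1))"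
    unfolding set_integrable_def by (subst (asm) integrable_completion) auto
  have i1: "set_integrable lborel {0..2*pi} g"
    using i0 unfolding g_def by simp
  have i2: "set_integrable lborel {0..2*pi} (\<lambda>x. g (2*pi - x))"
  proof -
    have "integrable lborel (\<lambda>x. indicator {0..2*pi} (2*pi + (-1) * x) *\<^sub>R g (2*pi + (-1) * x))"
      using i1 unfolding set_integrable_def by (intro lborel_integrable_real_affine) auto
    moreover have "(\<lambda>x. indicator {0..2*pi} (2*pi + (-1) * x) *\<^sub>R g (2*pi + (-1) * x)) = (\<lambda>x. indicator {0..2*pi} x *\<^sub>R g (2*pi - x))"
      by (auto simp: indicator_def)
    ultimately show ?thesis unfolding set_integrable_def by simp
  qed
  have mg: "g \<in> borel_measurable borel" unfolding g_def by measurable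
  show ?thesis
    unfolding integral_circle(2)[of "\<lambda>x. chord x powr (r - 1)", simplified]
  proof (rule set_integrable_bound[OF set_integral_add(1)[OF i1 i2]])
    have "chord x powr (r - 1) \<le> g x + g (2*pi - x)" if "x \<in> {0<..<2*pi}" for x
    proof (cases "x \<le> pi")
      case True
      have "chord x powr (r - 1) \<le> (2/pi * x) powr (r - 1)"
        using chord_ge(1)[of x] True that False by (intro powr_mono2') auto
      also have "\<dots> = g x" unfolding g_def by (rule powr_mult)
      finally show ?thesis by (simp add: g_def add_increasing2)
    next
      case F: False
      have "chord x powr (r - 1) \<le> (2/pi * (2*pi - x)) powr (r - 1)"
        using chord_ge(2)[of x] F that False by (intro powr_mono2') auto
      also have "\<dots> = g (2*pi - x)" unfolding g_def by (rule powr_mult)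
      finally show ?thesis by (simp add: g_def add_increasing)
    qed
    moreover have "chord x powr (r - 1) = 0" if "x \<in> {0, 2*pi}" for x
      using that by (auto simp: chord_def)
    moreover have "0 \<le> g x" for x by (simp add: g_def)
    ultimately have "chord x powr (r - 1) \<le> g x + g (2*pi - x)" if "x \<in> {0..2*pi}" for x
      using that by (cases "x \<in> {0, 2*pi}") (auto intro: add_nonneg_nonneg)
    then show "AE x in lborel. x \<in> {0..2*pi} \<longrightarrow> norm (chord x powr (r - 1)) \<le> norm (g x + g (2*pi - x))"
      by (auto simp: g_def intro!: AE_I2)
  qed (auto simp: set_borel_measurable_def)
qed

text \<open>The \<open>n\<close>-th Fourier coefficient of the kernel.\<close>

definition F_coeff :: "real \<Rightarrow> int \<Rightarrow> complex" where
  "F_coeff r n = (if n = 0 then 1 else of_real (real_of_int \<bar>n\<bar> powr (- r)) * cis (- (sgn (real_of_int n) * r * pi / 2)))"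

definition F_partial :: "real \<Rightarrow> nat \<Rightarrow> real \<Rightarrow> real" where
  "F_partial r N x = 1 + 2 * (\<Sum>n<N. real (Suc n) powr (- r) * cos (real (Suc n) * x - r * pi / 2))"

lemma F_partial_modes:
  "complex_of_real (F_partial r N x) = (\<Sum>n\<in>{- int N..int N}. F_coeff r n * mode n x)"
proof (induction N)
  case 0
  then show ?case by (simp add: F_partial_def F_coeff_def)
next
  case (Suc N)
  have S: "{- int (Suc N)..int (Suc N)} = insert (int (Suc N)) (insert (- int (Suc N)) {- int N..int N})"
    by auto
  have 2: "F_coeff r (int (Suc N)) * mode (int (Suc N)) x + F_coeff r (- int (Suc N)) * mode (- int (Suc N)) x
     = complex_of_real (2 * (real (Suc N) powr (- r) * cos (real (Suc N) * x - r * pi / 2)))"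
  proof -
    define y where "y = real (Suc N) * x - r * pi / 2"
    have "cis (- (r * pi / 2)) * cis (real (Suc N) * x) = cis y" by (simp add: cis_mult y_def)
    moreover have "cis (r * pi / 2) * cis (- (real (Suc N) * x)) = cnj (cis y)"
      by (simp add: cis_mult y_def cis_cnj)
    ultimately have "F_coeff r (int (Suc N)) * mode (int (Suc N)) x + F_coeff r (- int (Suc N)) * mode (- int (Suc N)) x
      = of_real (real (Suc N) powr (- r)) * (cis y + cnj (cis y))"
      by (simp add: F_coeff_def mult.assoc distrib_left del: cis_mult of_nat_Suc)
    also have "cis y + cnj (cis y) = of_real (2 * cos y)" by (simp add: complex_eq_iff)
    finally show ?thesis by (simp add: y_def del: of_nat_Suc)
  qed
  show ?case
    unfolding S using 2 Suc.IH
    by (subst sum.insert, simp, simp, subst sum.insert, simp, simp)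
       (simp add: F_partial_def add.assoc[symmetric] distrib_left del: of_nat_Suc)
qed

lemma F_partial_eq_Re:
  "F_partial r N x = 1 + 2 * Re (cis (- (r * pi / 2)) * (\<Sum>k=1..N. of_real (real k powr (- r)) * cis (real k * x)))"
proof -
  have "Re (cis (- (r * pi / 2)) * (\<Sum>k=1..N. of_real (real k powr (- r)) * cis (real k * x)))
     = (\<Sum>k=1..N. real k powr (- r) * cos (real k * x - r * pi / 2))"
    unfolding sum_distrib_left Re_sum
  proof (rule sum.cong)
    fix k
    have eq: "cis (- (r * pi / 2)) * (of_real (real k powr (- r)) * cis (real k * x)) = of_real (real k powr (- r)) * cis (real k * x - r * pi / 2)"
      by (simp add: mult.left_commute cis_mult)
    show "Re (cis (- (r * pi / 2)) * (of_real (real k powr (- r)) * cis (real k * x))) = real k powr (- r) * cos (real k * x - r * pi / 2)"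
      unfolding eq by simp
  qed simp
  moreover have "(\<Sum>n<N. real (Suc n) powr (- r) * cos (real (Suc n) * x - r * pi / 2))
     = (\<Sum>k=1..N. real k powr (- r) * cos (real k * x - r * pi / 2))"
    by (rule sum.reindex_bij_witness[of _ "\<lambda>k. k - 1" Suc]) auto
  ultimately show ?thesis by (simp add: F_partial_def)
qed

lemma F_partial_bound:
  assumes r: "0 < r" "r < 1" and x: "chord x > 0"
  shows "\<bar>F_partial r N x\<bar> \<le> 1 + 2 * (3 / (1 - r) + 2) * chord x powr (r - 1)"
proof -
  let ?S = "\<Sum>k=1..N. of_real (real k powr (- r)) * cis (real k * x) :: complex"
  have "\<bar>Re (cis (- (r * pi / 2)) * ?S)\<bar> \<le> cmod (cis (- (r * pi / 2)) * ?S)" by (rule abs_Re_le_cmod)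
  also have "\<dots> = cmod ?S" by (simp add: norm_mult)
  also have "\<dots> \<le> (3 / (1 - r) + 2) * chord x powr (r - 1)" by (rule trig_sum_bound[OF assms])
  finally show ?thesis unfolding F_partial_eq_Re mult.assoc by linarith
qed

lemma F_partial_tendsto:
  assumes r: "0 < r" "r < 1" and x: "chord x > 0"
  shows "(\<lambda>N. F_partial r N x) \<longlonglongrightarrow> F_kernel r x"
proof -
  let ?S = "\<lambda>N. \<Sum>k=1..N. of_real (real k powr (- r)) * cis (real k * x) :: complex"
  have tail: "cmod (?S n - ?S m) \<le> 2 * real (Suc m) powr (- r) / chord x" if "m < n" for m n
  proof -
    have "?S n - ?S m = (\<Sum>k=Suc m..n. of_real (real k powr (- r)) * cis x ^ k)"
      using that sum.ub_add_nat[of 1 m "\<lambda>k. of_real (real k powr (- r)) * cis (real k * x)" "n - m"]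
      by (simp add: Complex.DeMoivre)
    moreover have "chord x * cmod (\<Sum>k=Suc m..n. of_real (real k powr (- r)) * cis x ^ k) \<le> 2 * real (Suc m) powr (- r)"
      unfolding chord_def by (rule abel_bound) (use that r in \<open>auto intro!: powr_mono2'\<close>)
    ultimately show ?thesis using x by (simp add: field_simps)
  qed
  have "Cauchy ?S"
  proof (rule CauchyI')
    fix e :: real assume "e > 0"
    have "(\<lambda>m. 2 * real (Suc m) powr (- r) / chord x) \<longlonglongrightarrow> 2 * 0 / chord x"
      using r x by (intro tendsto_intros tendsto_neg_powr filterlim_compose[OF filterlim_real_sequentially filterlim_Suc]) auto
    then have "\<forall>\<^sub>F m in sequentially. 2 * real (Suc m) powr (- r) / chord x < e"
      by (rule order_tendstoD(2)) (use \<open>e > 0\<close> in simp)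
    then obtain M where M: "\<And>m. m \<ge> M \<Longrightarrow> 2 * real (Suc m) powr (- r) / chord x < e"
      by (auto simp: eventually_sequentially)
    have "dist (?S m) (?S n) < e" if "m \<ge> M" "n > m" for m n
      using tail[OF that(2)] M[OF that(1)] by (simp add: dist_norm norm_minus_commute)
    then show "\<exists>M. \<forall>m\<ge>M. \<forall>n>m. dist (?S m) (?S n) < e" by blast
  qed
  then obtain L where L: "?S \<longlonglongrightarrow> L" by (auto simp: Cauchy_convergent_iff convergent_def)
  have "(\<lambda>N. F_partial r N x) \<longlonglongrightarrow> 1 + 2 * Re (cis (- (r * pi / 2)) * L)"
    unfolding F_partial_eq_Re by (intro tendsto_intros L)
  then obtain L' where "(\<lambda>N. F_partial r N x) \<longlonglongrightarrow> L'" by blast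
  then have c: "(\<lambda>N. (F_partial r N x - 1) / 2) \<longlonglongrightarrow> (L' - 1) / 2" by (intro tendsto_intros) auto
  have eq: "(\<Sum>n<N. real (Suc n) powr (- r) * cos (real (Suc n) * x - r * pi / 2)) = (F_partial r N x - 1) / 2" for N
    by (simp add: F_partial_def)
  have "summable (\<lambda>n. real (Suc n) powr (- r) * cos (real (Suc n) * x - r * pi / 2))"
    unfolding summable_iff_convergent eq using c unfolding convergent_def by blast
  from summable_LIMSEQ[OF this] show ?thesis
    unfolding F_kernel_def F_partial_def by (intro tendsto_intros)
qed

lemma AE_chord_pos: "AE x in circle. chord x > 0"
proof -
  have "AE x in circle. x \<in> {0<..<2*pi}"
    using emeasure_circle_open_interval
    by (subst circle.AE_in_set_eq_1) (auto simp: circle.emeasure_eq_measure)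
  then show ?thesis
  proof eventually_elim
    case (elim x)
    then have "sin (x/2) > 0" by (intro sin_gt_zero) auto
    then show ?case by (simp add: chord_eq_sin)
  qed
qed

lemma measurable_F_kernel [measurable]: "F_kernel r \<in> borel_measurable borel"
  unfolding F_kernel_def by measurable

lemma measurable_F_partial [measurable]: "F_partial r N \<in> borel_measurable borel"
  unfolding F_partial_def by measurable

text \<open>For \<open>r \<le> 1/2\<close> the coefficients are not square summable and the series converges only conditionally;
  dominated convergence applies because of the uniform bound on the partial sums.\<close>

lemma F_kernel_fourier:
  assumes r: "0 < r" "r < 1"
  shows "integrable circle (F_kernel r)"
    and "(\<integral>x. complex_of_real (F_kernel r x) * cnj (mode n x) \<partial>circle) = F_coeff r n"
proof -
  define w where "w x = 1 + 2 * (3 / (1 - r) + 2) * chord x powr (r - 1)" for x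
  have w: "integrable circle w"
    unfolding w_def using integrable_chord_powr[OF r(1)] by simp
  show i: "integrable circle (F_kernel r)"
  proof (rule integrable_dominated_convergence[where s="F_partial r" and w=w])
    show "AE x in circle. (\<lambda>N. F_partial r N x) \<longlonglongrightarrow> F_kernel r x"
      using AE_chord_pos by eventually_elim (rule F_partial_tendsto[OF r])
    show "AE x in circle. norm (F_partial r N x) \<le> w x" for N
      using AE_chord_pos by eventually_elim (unfold w_def real_norm_def, rule F_partial_bound[OF r])
  qed (use w in auto)
  have "(\<lambda>N. \<integral>x. complex_of_real (F_partial r N x) * cnj (mode n x) \<partial>circle) \<longlonglongrightarrow>
     (\<integral>x. complex_of_real (F_kernel r x) * cnj (mode n x) \<partial>circle)"
  proof (rule integral_dominated_convergence[where w=w])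
    show "AE x in circle. (\<lambda>N. complex_of_real (F_partial r N x) * cnj (mode n x)) \<longlonglongrightarrow> complex_of_real (F_kernel r x) * cnj (mode n x)"
      using AE_chord_pos by eventually_elim (intro tendsto_intros F_partial_tendsto[OF r])
    show "AE x in circle. cmod (complex_of_real (F_partial r N x) * cnj (mode n x)) \<le> w x" for N
      using AE_chord_pos by eventually_elim (unfold w_def norm_mult norm_cis complex_mod_cnj norm_of_real mult_1_right, rule F_partial_bound[OF r])
  qed (use w in auto)
  moreover have "(\<integral>x. complex_of_real (F_partial r N x) * cnj (mode n x) \<partial>circle) = F_coeff r n" if "N \<ge> nat \<bar>n\<bar>" for N
    unfolding F_partial_modes by (subst modes.integral_poly_e) (use that in auto)
  then have "(\<lambda>N. \<integral>x. complex_of_real (F_partial r N x) * cnj (mode n x) \<partial>circle) \<longlonglongrightarrow> F_coeff r n"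
    by (intro tendsto_eventually) (auto simp: eventually_sequentially)
  ultimately show "(\<integral>x. complex_of_real (F_kernel r x) * cnj (mode n x) \<partial>circle) = F_coeff r n"
    by (rule LIMSEQ_unique)
qed

lemma norm_F_coeff: "cmod (F_coeff r n) = real_of_int (max 1 \<bar>n\<bar>) powr (- r)"
  by (auto simp: F_coeff_def norm_mult max_def)

section \<open>Convolution with the kernel\<close>

text \<open>Reduction modulo \<open>2\<pi>\<close>.  Translation invariance of the circle becomes the statement that a measure
  is preserved, from which the invariance of all kinds of integrals follows at once.\<close>

definition wrap :: "real \<Rightarrow> real" where
  "wrap t = t - 2 * pi * of_int \<lfloor>t / (2 * pi)\<rfloor>"

lemma measurable_wrap [measurable]: "wrap \<in> borel_measurable borel"
  unfolding wrap_def by measurable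

lemma wrap_range: "wrap t \<in> {0..<2 * pi}"
proof -
  define n where "n = \<lfloor>t / (2*pi)\<rfloor>"
  have "of_int n \<le> t / (2*pi)" "t / (2*pi) < of_int n + 1" unfolding n_def by linarith+
  then show ?thesis unfolding wrap_def n_def[symmetric] by (simp add: field_simps)
qed

lemma wrap_id: "t \<in> {0..<2 * pi} \<Longrightarrow> wrap t = t"
  by (simp add: wrap_def floor_eq_iff)

lemma periodic_of_int:
  fixes f :: "real \<Rightarrow> 'b"
  assumes "\<And>t. f (t + 2 * pi) = f t"
  shows "f (t + 2 * pi * of_int n) = f t"
proof (induction n rule: int_induct[of _ 0])
  case (step1 i)
  then show ?case using assms[of "t + 2 * pi * of_int i"] by (simp add: algebra_simps)
next
  case (step2 i)
  then show ?case using assms[of "t + 2 * pi * of_int (i - 1)"] by (simp add: algebra_simps)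
qed simp

lemma periodic_wrap:
  fixes f :: "real \<Rightarrow> 'b"
  assumes "\<And>t. f (t + 2 * pi) = f t"
  shows "f (wrap t) = f t"
  using periodic_of_int[where f=f, OF assms, of t "- \<lfloor>t / (2 * pi)\<rfloor>"] by (simp add: wrap_def)

lemma wrap_periodic: "wrap (t + 2 * pi) = wrap t"
proof -
  have "(t + 2*pi) / (2*pi) = t / (2*pi) + 1" by (simp add: field_simps)
  then show ?thesis by (simp add: wrap_def algebra_simps)
qed

lemma nn_integral_shift_lborel:
  fixes f :: "real \<Rightarrow> ennreal"
  assumes [measurable]: "f \<in> borel_measurable borel"
  shows "(\<integral>\<^sup>+t\<in>{a..<b}. f (t + c) \<partial>lborel) = (\<integral>\<^sup>+t\<in>{a + c..<b + c}. f t \<partial>lborel)"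
proof -
  have "(\<integral>\<^sup>+t. f t * indicator {a + c..<b + c} t \<partial>lborel) = (\<integral>\<^sup>+t. f (c + 1 * t) * indicator {a + c..<b + c} (c + 1 * t) \<partial>lborel)"
    by (subst nn_integral_real_affine[where c=1 and t=c]) auto
  also have "\<dots> = (\<integral>\<^sup>+t\<in>{a..<b}. f (t + c) \<partial>lborel)"
    by (intro nn_integral_cong) (auto simp: indicator_def add.commute)
  finally show ?thesis ..
qed

text \<open>The window is moved by full periods into position \<open>s \<in> [0, 2\<pi>)\<close>, and the part beyond \<open>2\<pi>\<close> is moved
  back by one period.\<close>

lemma nn_integral_periodic_window:
  fixes f :: "real \<Rightarrow> ennreal"
  assumes [measurable]: "f \<in> borel_measurable borel" and per: "\<And>t. f (t + 2 * pi) = f t"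
  shows "(\<integral>\<^sup>+t\<in>{a..<a + 2 * pi}. f t \<partial>lborel) = (\<integral>\<^sup>+t\<in>{0..<2 * pi}. f t \<partial>lborel)"
proof -
  define s n where "s = wrap a" and "n = \<lfloor>a / (2 * pi)\<rfloor>"
  have a: "a = s + 2 * pi * of_int n" by (simp add: s_def n_def wrap_def)
  have s: "0 \<le> s" "s < 2 * pi" using wrap_range[of a] by (auto simp: s_def)
  have split: "(\<integral>\<^sup>+t\<in>{u..<v}. f t \<partial>lborel) + (\<integral>\<^sup>+t\<in>{v..<w}. f t \<partial>lborel) = (\<integral>\<^sup>+t\<in>{u..<w}. f t \<partial>lborel)"
    if "u \<le> v" "v \<le> w" for u v w
    using that by (subst nn_integral_add[symmetric]) (auto intro!: nn_integral_cong simp: indicator_def)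
  have "(\<integral>\<^sup>+t\<in>{a..<a + 2 * pi}. f t \<partial>lborel) = (\<integral>\<^sup>+t\<in>{s..<s + 2 * pi}. f (t + 2 * pi * of_int n) \<partial>lborel)"
    by (subst nn_integral_shift_lborel) (auto simp: a add_ac)
  also have "\<dots> = (\<integral>\<^sup>+t\<in>{s..<s + 2 * pi}. f t \<partial>lborel)"
    by (simp add: periodic_of_int[of f, OF per])
  also have "\<dots> = (\<integral>\<^sup>+t\<in>{s..<2 * pi}. f t \<partial>lborel) + (\<integral>\<^sup>+t\<in>{0 + 2 * pi..<s + 2 * pi}. f t \<partial>lborel)"
    using s split[of s "2*pi" "s + 2*pi"] by simp
  also have "(\<integral>\<^sup>+t\<in>{0 + 2 * pi..<s + 2 * pi}. f t \<partial>lborel) = (\<integral>\<^sup>+t\<in>{0..<s}. f (t + 2 * pi) \<partial>lborel)"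
    by (rule nn_integral_shift_lborel[symmetric]) simp
  also have "\<dots> = (\<integral>\<^sup>+t\<in>{0..<s}. f t \<partial>lborel)" by (simp add: per)
  also have "(\<integral>\<^sup>+t\<in>{s..<2 * pi}. f t \<partial>lborel) + (\<integral>\<^sup>+t\<in>{0..<s}. f t \<partial>lborel) = (\<integral>\<^sup>+t\<in>{0..<2 * pi}. f t \<partial>lborel)"
    using s split[of 0 s "2*pi"] by (simp add: add.commute)
  finally show ?thesis .
qed

lemma nn_integral_circle_half_open:
  assumes "f \<in> borel_measurable borel"
  shows "(\<integral>\<^sup>+t. f t \<partial>circle) = ennreal (1 / (2*pi)) * (\<integral>\<^sup>+t\<in>{0..<2*pi}. f t \<partial>lborel)"
proof -
  have "(\<integral>\<^sup>+t\<in>{0..2*pi}. f t \<partial>lborel) = (\<integral>\<^sup>+t\<in>{0..<2*pi}. f t \<partial>lborel)"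
    by (rule nn_integral_cong_AE, use AE_lborel_singleton[of "2*pi"] in eventually_elim)
       (auto simp: indicator_def)
  then show ?thesis using assms by (simp add: nn_integral_circle)
qed

lemma distr_circle_shift: "distr circle borel (\<lambda>t. wrap (t - y)) = circle"
proof (rule measure_eqI)
  fix A :: "real set" assume "A \<in> sets (distr circle borel (\<lambda>t. wrap (t - y)))"
  then have [measurable]: "A \<in> sets borel" by simp
  let ?f = "\<lambda>t. indicator A (wrap t) :: ennreal"
  have "emeasure (distr circle borel (\<lambda>t. wrap (t - y))) A = (\<integral>\<^sup>+t. indicator A t \<partial>distr circle borel (\<lambda>t. wrap (t - y)))"
    by (subst nn_integral_indicator) auto
  also have "\<dots> = (\<integral>\<^sup>+t. ?f (t + - y) \<partial>circle)"
    by (subst nn_integral_distr) (auto simp: diff_conv_add_uminus simp del: add_uminus_conv_diff)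
  also have "\<dots> = ennreal (1 / (2*pi)) * (\<integral>\<^sup>+t\<in>{0..<2*pi}. ?f (t + - y) \<partial>lborel)"
    by (rule nn_integral_circle_half_open) measurable
  also have "(\<integral>\<^sup>+t\<in>{0..<2*pi}. ?f (t + - y) \<partial>lborel) = (\<integral>\<^sup>+t\<in>{0 + - y..<2*pi + - y}. ?f t \<partial>lborel)"
    by (rule nn_integral_shift_lborel) measurable
  also have "\<dots> = (\<integral>\<^sup>+t\<in>{0..<2*pi}. ?f t \<partial>lborel)"
    using nn_integral_periodic_window[of ?f "- y"] by (simp add: wrap_periodic add.commute)
  also have "\<dots> = (\<integral>\<^sup>+t\<in>{0..<2*pi}. indicator A t \<partial>lborel)"
    by (intro nn_integral_cong) (auto simp: indicator_def wrap_id)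
  also have "ennreal (1 / (2*pi)) * \<dots> = (\<integral>\<^sup>+t. indicator A t \<partial>circle)"
    by (rule nn_integral_circle_half_open[symmetric]) measurable
  also have "\<dots> = emeasure circle A" by (subst nn_integral_indicator) auto
  finally show "emeasure (distr circle borel (\<lambda>t. wrap (t - y))) A = emeasure circle A" .
qed simp

lemma circle_shift:
  fixes f :: "real \<Rightarrow> 'b::{banach, second_countable_topology}"
  assumes [measurable]: "f \<in> borel_measurable borel" and per: "\<And>t. f (t + 2 * pi) = f t"
  shows "integrable circle (\<lambda>t. f (t - y)) \<longleftrightarrow> integrable circle f"
    and "(\<integral>t. f (t - y) \<partial>circle) = (\<integral>t. f t \<partial>circle)"
proof -
  have e: "(\<lambda>t. f (t - y)) = (\<lambda>t. f (wrap (t - y)))" by (simp add: periodic_wrap[of f, OF per])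
  show "integrable circle (\<lambda>t. f (t - y)) \<longleftrightarrow> integrable circle f"
    by (subst (2) distr_circle_shift[of y, symmetric], subst integrable_distr_eq) (auto simp: e)
  show "(\<integral>t. f (t - y) \<partial>circle) = (\<integral>t. f t \<partial>circle)"
    by (subst (2) distr_circle_shift[of y, symmetric], subst integral_distr) (auto simp: e)
qed

lemma F_kernel_periodic: "F_kernel r (t + 2 * pi) = F_kernel r t"
proof -
  have "cos (real (Suc n) * (t + 2*pi) - r*pi/2) = cos (real (Suc n) * t - r*pi/2)" for n
  proof -
    have "real (Suc n) * (t + 2*pi) - r*pi/2 = (real (Suc n) * t - r*pi/2) + 2 * pi * of_int (int (Suc n))"
      by (simp add: algebra_simps)
    then show ?thesis using periodic_of_int[of cos "real (Suc n) * t - r*pi/2" "int (Suc n)"] by (metis cos_periodic)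
  qed
  then show ?thesis by (simp only: F_kernel_def)
qed

lemma mode_periodic: "mode n (t + 2 * pi) = mode n t"
proof -
  have "mode n (t + 2*pi) = mode n t * cis (2 * pi * of_int n)"
    by (simp add: cis_mult algebra_simps)
  also have "cis (2 * pi * of_int n) = 1" by (rule cis_multiple_2pi) simp
  finally show ?thesis by simp
qed

lemma measurable_F_kernel_mixed [measurable]: "F_kernel_mixed r \<in> borel_measurable borel"
proof -
  have "(\<lambda>x::real^'d::finite. complex_of_real (\<Prod>j\<in>UNIV. F_kernel r (x $ j))) \<in> borel_measurable borel"
    by measurable
  then show ?thesis unfolding F_kernel_mixed_def[abs_def] .
qed

text \<open>Each of these integrals factors, because the kernel and the character are products; the factors are
  handled by the translation invariance of the circle.\<close>

lemma F_kernel_mixed_shift: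
  fixes y :: "real^'d::finite"
  assumes r: "0 < r" "r < 1"
  shows "integrable torus (\<lambda>x. F_kernel_mixed r (x - y))"
    and "(\<integral>x. cmod (F_kernel_mixed r (x - y)) \<partial>torus) = (\<integral>t. \<bar>F_kernel r t\<bar> \<partial>circle) ^ CARD('d)"
    and "(\<integral>x. F_kernel_mixed r (x - y) * cnj (character k x) \<partial>torus)
         = (\<Prod>j\<in>UNIV. F_coeff r (k $ j)) * cnj (character k y)"
proof -
  note iF = F_kernel_fourier(1)[OF r]
  have i1: "integrable circle (\<lambda>t. complex_of_real (F_kernel r (t - c)))" for c
    using circle_shift(1)[of "F_kernel r" c] iF by (simp add: F_kernel_periodic)
  show "integrable torus (\<lambda>x. F_kernel_mixed r (x - y))"
    unfolding F_kernel_mixed_def of_real_prod using integral_torus_prod(1)[OF i1, of "\<lambda>j. y $ j"] by simp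
  have i2: "integrable circle (\<lambda>t. complex_of_real \<bar>F_kernel r (t - c)\<bar>)" for c
    using integrable_norm[OF i1[of c]] by simp
  have "complex_of_real (\<integral>x. cmod (F_kernel_mixed r (x - y)) \<partial>torus)
      = (\<integral>x. (\<Prod>j\<in>UNIV. complex_of_real \<bar>F_kernel r (x $ j - y $ j)\<bar>) \<partial>torus)"
    by (subst integral_complex_of_real[symmetric])
       (simp add: F_kernel_mixed_def prod_norm[symmetric])
  also have "\<dots> = (\<Prod>j\<in>UNIV. \<integral>t. complex_of_real \<bar>F_kernel r (t - y $ j)\<bar> \<partial>circle)"
    by (rule integral_torus_prod(2)[OF i2, of "\<lambda>j. y $ j"])
  also have "\<dots> = (\<Prod>j\<in>(UNIV::'d set). complex_of_real (\<integral>t. \<bar>F_kernel r t\<bar> \<partial>circle))"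
    using circle_shift(2)[of "\<lambda>t. \<bar>F_kernel r t\<bar>"] by (simp add: F_kernel_periodic)
  also have "\<dots> = complex_of_real ((\<integral>t. \<bar>F_kernel r t\<bar> \<partial>circle) ^ CARD('d))" by simp
  finally show "(\<integral>x. cmod (F_kernel_mixed r (x - y)) \<partial>torus) = (\<integral>t. \<bar>F_kernel r t\<bar> \<partial>circle) ^ CARD('d)"
    by (simp only: of_real_eq_iff)
  have i3: "integrable circle (\<lambda>t. complex_of_real (F_kernel r (t - c)) * cnj (mode n t))" for c n
    by (rule modes.integrable_times_e[OF i1])
  have v: "(\<integral>t. complex_of_real (F_kernel r (t - c)) * cnj (mode n t) \<partial>circle) = F_coeff r n * cnj (mode n c)" for c n
  proof -
    have e: "cnj (mode n t) = cnj (mode n (t - c)) * cnj (mode n c)" for t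
      by (simp add: cis_cnj cis_mult algebra_simps)
    have "(\<integral>t. complex_of_real (F_kernel r (t - c)) * cnj (mode n t) \<partial>circle)
      = (\<integral>t. (\<lambda>t. complex_of_real (F_kernel r t) * cnj (mode n t)) (t - c) * cnj (mode n c) \<partial>circle)"
      by (subst e) (simp only: mult.assoc)
    also have "\<dots> = (\<integral>t. (\<lambda>t. complex_of_real (F_kernel r t) * cnj (mode n t)) (t - c) \<partial>circle) * cnj (mode n c)"
      by (rule integral_mult_left_zero)
    also have "(\<integral>t. (\<lambda>t. complex_of_real (F_kernel r t) * cnj (mode n t)) (t - c) \<partial>circle) = F_coeff r n"
      by (subst circle_shift(2)) (auto simp only: F_kernel_periodic mode_periodic F_kernel_fourier(2)[OF r], measurable)
    finally show ?thesis .
  qed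
  have "(\<integral>x. F_kernel_mixed r (x - y) * cnj (character k x) \<partial>torus)
     = (\<integral>x. (\<Prod>j\<in>UNIV. complex_of_real (F_kernel r (x $ j - y $ j)) * cnj (mode (k $ j) (x $ j))) \<partial>torus)"
    by (simp add: F_kernel_mixed_def character_eq_prod prod.distrib)
  also have "\<dots> = (\<Prod>j\<in>UNIV. F_coeff r (k $ j) * cnj (mode (k $ j) (y $ j)))"
    using integral_torus_prod(2)[of "\<lambda>j t. complex_of_real (F_kernel r (t - y $ j)) * cnj (mode (k $ j) t)", OF i3]
    by (simp only: v)
  also have "\<dots> = (\<Prod>j\<in>UNIV. F_coeff r (k $ j)) * cnj (character k y)"
    by (simp add: character_eq_prod prod.distrib)
  finally show "(\<integral>x. F_kernel_mixed r (x - y) * cnj (character k x) \<partial>torus)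
         = (\<Prod>j\<in>UNIV. F_coeff r (k $ j)) * cnj (character k y)" .
qed

lemma fourier_convolution:
  fixes \<phi> :: "'d::finite tfun"
  assumes r: "0 < r" "r < 1" and \<phi>: "integrable torus \<phi>"
  shows "integrable torus (convolution \<phi> (F_kernel_mixed r))"
    and "fourier (convolution \<phi> (F_kernel_mixed r)) k = fourier \<phi> k * (\<Prod>j\<in>UNIV. F_coeff r (k $ j))"
proof -
  interpret P: pair_sigma_finite "torus :: (real^'d) measure" "torus :: (real^'d) measure" by unfold_locales
  have [measurable]: "\<phi> \<in> borel_measurable borel" using borel_measurable_integrable[OF \<phi>] by simp
  let ?h = "\<lambda>y x. \<phi> y * F_kernel_mixed r (x - y)"
  note K = F_kernel_mixed_shift[OF r]
  have int: "integrable (torus \<Otimes>\<^sub>M torus) (\<lambda>(y, x). ?h y x)"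
  proof (rule P.Fubini_integrable)
    show "(\<lambda>(y, x). ?h y x) \<in> borel_measurable (torus \<Otimes>\<^sub>M torus)" by measurable
    have "(\<integral>x. cmod (?h y x) \<partial>torus) = cmod (\<phi> y) * (\<integral>t. \<bar>F_kernel r t\<bar> \<partial>circle) ^ CARD('d)" for y
      by (simp add: norm_mult K(2))
    then show "integrable torus (\<lambda>y. \<integral>x. norm (case (y, x) of (y, x) \<Rightarrow> ?h y x) \<partial>torus)"
      using \<phi> by simp
    show "AE y in torus. integrable torus (\<lambda>x. case (y, x) of (y, x) \<Rightarrow> ?h y x)"
      by (auto intro!: AE_I2 integrable_mult_right K(1))
  qed
  show "integrable torus (convolution \<phi> (F_kernel_mixed r))"
    unfolding convolution_def[abs_def] using P.integrable_snd[OF int] by simp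
  have int': "integrable (torus \<Otimes>\<^sub>M torus) (\<lambda>(y, x). ?h y x * cnj (character k x))"
  proof (rule Bochner_Integration.integrable_bound[OF int])
    show "(\<lambda>(y, x). ?h y x * cnj (character k x)) \<in> borel_measurable (torus \<Otimes>\<^sub>M torus)" by measurable
  qed (auto simp: norm_mult intro!: AE_I2)
  have "fourier (convolution \<phi> (F_kernel_mixed r)) k = (\<integral>x. (\<integral>y. ?h y x * cnj (character k x) \<partial>torus) \<partial>torus)"
    by (simp add: fourier_def convolution_def)
  also have "\<dots> = (\<integral>y. (\<integral>x. ?h y x * cnj (character k x) \<partial>torus) \<partial>torus)"
    by (rule P.Fubini_integral[OF int'])
  also have "\<dots> = (\<integral>y. \<phi> y * ((\<Prod>j\<in>UNIV. F_coeff r (k $ j)) * cnj (character k y)) \<partial>torus)"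
    by (simp only: mult.assoc integral_mult_right_zero K(3))
  also have "\<dots> = (\<integral>y. (\<phi> y * cnj (character k y)) * (\<Prod>j\<in>UNIV. F_coeff r (k $ j)) \<partial>torus)"
    by (simp only: ac_simps)
  also have "\<dots> = fourier \<phi> k * (\<Prod>j\<in>UNIV. F_coeff r (k $ j))"
    by (simp add: fourier_def)
  finally show "fourier (convolution \<phi> (F_kernel_mixed r)) k = fourier \<phi> k * (\<Prod>j\<in>UNIV. F_coeff r (k $ j))" .
qed

section \<open>The Hardy-Littlewood inequality\<close>

lemma le_one_plus_powr:
  fixes x q :: real
  assumes "0 \<le> x" "1 \<le> q"
  shows "x \<le> 1 + x powr q"
proof (cases "x \<le> 1")
  case False
  then have "x powr 1 \<le> x powr q" using assms by (intro powr_mono) auto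
  with False show ?thesis by simp
qed (simp add: add_increasing2)

lemma sum_geometric_int_le:
  fixes \<rho> :: real
  assumes "finite I" "0 < \<rho>" "\<rho> < 1" "\<And>i. i \<in> I \<Longrightarrow> m \<le> (i::int)"
  shows "(\<Sum>i\<in>I. \<rho> ^ nat (i - m)) \<le> 1 / (1 - \<rho>)"
proof -
  have "(\<Sum>i\<in>I. \<rho> ^ nat (i - m)) = (\<Sum>n\<in>(\<lambda>i. nat (i - m)) ` I. \<rho> ^ n)"
    by (subst sum.reindex) (use assms(4) in \<open>auto intro!: inj_onI simp: eq_nat_nat_iff\<close>)
  also have "\<dots> \<le> (\<Sum>n. \<rho> ^ n)"
    using assms by (intro sum_le_suminf) (auto intro!: summable_geometric)
  also have "\<dots> = 1 / (1 - \<rho>)" using assms by (intro suminf_geometric) auto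
  finally show ?thesis .
qed

lemma sum_dyadic_below:
  fixes s y :: real
  assumes I: "finite I" and s: "0 < s" and y: "0 < y" and le: "\<And>i. i \<in> I \<Longrightarrow> 2 powr (real_of_int i) \<le> y"
  shows "(\<Sum>i\<in>I. (2 powr (real_of_int i)) powr s) \<le> 1 / (1 - 2 powr (- s)) * y powr s"
proof -
  define m where "m = \<lfloor>log 2 y\<rfloor>"
  have m: "2 powr (real_of_int m) \<le> y"
    using y by (simp add: m_def le_log_iff[symmetric])
  have im: "i \<le> m" if "i \<in> I" for i
    using le[OF that] y by (simp add: m_def le_floor_iff le_log_iff)
  have "(\<Sum>i\<in>I. (2 powr (real_of_int i)) powr s) = (\<Sum>i\<in>I. (2 powr (real_of_int m)) powr s * (2 powr (- s)) ^ nat (m - i))"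
  proof (rule sum.cong)
    fix i assume "i \<in> I"
    then have "real (nat (m - i)) = real_of_int m - real_of_int i" using im by simp
    then show "(2 powr (real_of_int i)) powr s = (2 powr (real_of_int m)) powr s * (2 powr (- s)) ^ nat (m - i)"
      by (simp add: powr_powr powr_realpow[symmetric] powr_add[symmetric] algebra_simps)
  qed simp
  also have "\<dots> = (2 powr (real_of_int m)) powr s * (\<Sum>i\<in>uminus ` I. (2 powr (- s)) ^ nat (i - (- m)))"
    by (subst sum.reindex) (auto simp: sum_distrib_left)
  also have "\<dots> \<le> y powr s * (1 / (1 - 2 powr (- s)))"
    using m s I im powr_less_one[of 2 "-s"]
    by (intro mult_mono powr_mono2 sum_geometric_int_le) (auto intro!: sum_nonneg)
  finally show ?thesis by (simp add: mult.commute)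
qed

lemma sum_dyadic_above:
  fixes s y :: real
  assumes I: "finite I" and s: "0 < s" and y: "0 < y" and le: "\<And>i. i \<in> I \<Longrightarrow> y \<le> 2 powr (real_of_int i)"
  shows "(\<Sum>i\<in>I. (2 powr (real_of_int i)) powr (- s)) \<le> 1 / (1 - 2 powr (- s)) * y powr (- s)"
proof -
  have "(\<Sum>i\<in>I. (2 powr (real_of_int i)) powr (- s)) = (\<Sum>i\<in>uminus ` I. (2 powr (real_of_int i)) powr s)"
    by (subst sum.reindex) (auto simp: powr_powr)
  also have "\<dots> \<le> 1 / (1 - 2 powr (- s)) * (1 / y) powr s"
  proof (rule sum_dyadic_below)
    show "2 powr real_of_int i \<le> 1 / y" if "i \<in> uminus ` I" for i
    proof -
      from that have "y \<le> 2 powr (- real_of_int i)" using le[of "-i"] by auto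
      then show ?thesis using y by (simp add: powr_minus field_simps)
    qed
  qed (use I s y in auto)
  also have "(1 / y) powr s = y powr (- s)" using y by (simp add: powr_divide powr_minus_divide)
  finally show ?thesis .
qed

context bounded_orthonormal
begin

abbreviation coeff :: "('a \<Rightarrow> complex) \<Rightarrow> 'k \<Rightarrow> complex" where
  "coeff f k \<equiv> (\<integral>x. f x * cnj (e k x) \<partial>M)"

lemma norm_coeff_le: "integrable M f \<Longrightarrow> cmod (coeff f k) \<le> (\<integral>x. cmod (f x) \<partial>M)"
  by (rule order_trans[OF integral_norm_bound integral_mono[OF integrable_norm[OF integrable_times_e] integrable_norm]])
     (auto simp: norm_mult norm_e mult_left_le)

lemma integrable_of_powr:
  assumes [measurable]: "f \<in> borel_measurable M" and "1 \<le> q" "integrable M (\<lambda>x. cmod (f x) powr q)"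
  shows "integrable M f"
proof (rule Bochner_Integration.integrable_bound[of _ "\<lambda>x. 1 + cmod (f x) powr q"])
  have "cmod (f x) \<le> 1 + cmod (f x) powr q" for x using assms(2) by (intro le_one_plus_powr) auto
  then show "AE x in M. norm (f x) \<le> norm (1 + cmod (f x) powr q)" by (auto intro!: AE_I2)
qed (use assms in auto)

text \<open>The weak-type estimates at one level \<open>L\<close> of \<open>w |coeff f|\<close>.  The function is cut at height \<open>L\<close>.  Where
  the large part \<open>f1\<close> is responsible, \<open>|coeff f1| \<le> \<integral> |f1|\<close> forces the weight to be large, and the
  tail hypothesis on the weights applies; where the small part is responsible, Bessel's
  inequality does.\<close>

lemma paley_level:
  fixes w :: "'k \<Rightarrow> real"
  assumes w: "\<And>k. 1 \<le> w k"
    and tail: "\<And>u S. 0 < u \<Longrightarrow> finite S \<Longrightarrow> (\<And>k. k \<in> S \<Longrightarrow> u \<le> w k) \<Longrightarrow> (\<Sum>k\<in>S. w k powr (- 2)) \<le> A / u"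
    and [measurable]: "f \<in> borel_measurable M" and f: "integrable M f" and L: "0 < L" and q: "0 < q"
    and S: "finite S" and lev: "\<And>k. k \<in> S \<Longrightarrow> L \<le> w k * cmod (coeff f k)" "\<And>k. k \<in> S \<Longrightarrow> w k * cmod (coeff f k) \<le> 2 * L"
  shows "(\<Sum>k\<in>S. w k powr (- 2) * (w k * cmod (coeff f k)) powr q)
     \<le> 2 powr q * (2 * A * L powr (q - 1) * (\<integral>x. cmod (f x) * indicator {x. L < cmod (f x)} x \<partial>M)
         + 4 * L powr (q - 2) * (\<integral>x. (cmod (f x))\<^sup>2 * indicator {x. cmod (f x) \<le> L} x \<partial>M))"
proof -
  define f1 where "f1 x = f x * indicator {x. L < cmod (f x)} x" for x
  define f2 where "f2 x = f x * indicator {x. cmod (f x) \<le> L} x" for x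
  have n1: "cmod (f1 x) = cmod (f x) * indicator {x. L < cmod (f x)} x" for x by (simp add: f1_def indicator_def)
  have n2: "(cmod (f2 x))\<^sup>2 = (cmod (f x))\<^sup>2 * indicator {x. cmod (f x) \<le> L} x" for x by (simp add: f2_def indicator_def)
  have [measurable]: "f1 \<in> borel_measurable M" "f2 \<in> borel_measurable M"
    unfolding f1_def[abs_def] f2_def[abs_def] by measurable
  have i1: "integrable M f1" by (rule Bochner_Integration.integrable_bound[OF f]) (auto simp: f1_def indicator_def)
  have i2: "integrable M f2" by (rule Bochner_Integration.integrable_bound[OF f]) (auto simp: f2_def indicator_def)
  have i22: "integrable M (\<lambda>x. (cmod (f2 x))\<^sup>2)"
    by (rule integrable_const_bound[of _ "L\<^sup>2"]) (auto simp: f2_def indicator_def L less_imp_le intro!: power_mono)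
  have c12: "coeff f k = coeff f1 k + coeff f2 k" for k
  proof -
    have "f x * cnj (e k x) = f1 x * cnj (e k x) + f2 x * cnj (e k x)" for x by (simp add: f1_def f2_def indicator_def)
    then show ?thesis using integrable_times_e[OF i1, of k] integrable_times_e[OF i2, of k] by simp
  qed
  define a where "a = (\<integral>x. cmod (f1 x) \<partial>M)"
  have a0: "0 \<le> a" by (simp add: a_def)
  define S1 where "S1 = {k\<in>S. L / 2 \<le> w k * cmod (coeff f1 k)}"
  define S2 where "S2 = {k\<in>S. L / 2 \<le> w k * cmod (coeff f2 k)}"
  have S12: "S \<subseteq> S1 \<union> S2"
  proof
    fix k assume k: "k \<in> S"
    have "L \<le> w k * (cmod (coeff f1 k) + cmod (coeff f2 k))"
    proof (rule order_trans[OF lev(1)[OF k]])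
      show "w k * cmod (coeff f k) \<le> w k * (cmod (coeff f1 k) + cmod (coeff f2 k))"
        unfolding c12 using w[of k] by (intro mult_left_mono norm_triangle_ineq) auto
    qed
    then show "k \<in> S1 \<union> S2" using k by (auto simp: S1_def S2_def distrib_left)
  qed
  have fin: "finite S1" "finite S2" using S by (auto simp: S1_def S2_def)
  have b1: "(\<Sum>k\<in>S1. w k powr (- 2)) \<le> 2 * A * a / L"
  proof (cases "a = 0")
    case True
    have "S1 = {}"
      using norm_coeff_le[OF i1] True L by (auto simp: S1_def a_def)
    then show ?thesis using True by simp
  next
    case False
    then have "a > 0" using a0 by simp
    have "(\<Sum>k\<in>S1. w k powr (- 2)) \<le> A / (L / (2 * a))"
    proof (rule tail)
      fix k assume "k \<in> S1"
      then have "L / 2 \<le> w k * cmod (coeff f1 k)" by (simp add: S1_def)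
      also have "\<dots> \<le> w k * a" using norm_coeff_le[OF i1, of k] w[of k] by (intro mult_left_mono) (auto simp: a_def)
      finally show "L / (2 * a) \<le> w k" using \<open>a > 0\<close> by (simp add: field_simps)
    qed (use \<open>a > 0\<close> L fin in auto)
    then show ?thesis by (simp add: mult_ac)
  qed
  have b2: "(\<Sum>k\<in>S2. w k powr (- 2)) \<le> 4 / L\<^sup>2 * (\<integral>x. (cmod (f2 x))\<^sup>2 \<partial>M)"
  proof -
    have "(\<Sum>k\<in>S2. w k powr (- 2)) \<le> (\<Sum>k\<in>S2. 4 / L\<^sup>2 * (cmod (coeff f2 k))\<^sup>2)"
    proof (rule sum_mono)
      fix k assume "k \<in> S2"
      then have "L / 2 \<le> w k * cmod (coeff f2 k)" by (simp add: S2_def)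
      then have "(L / 2)\<^sup>2 \<le> (w k * cmod (coeff f2 k))\<^sup>2" using L by (intro power_mono) auto
      then show "w k powr (- 2) \<le> 4 / L\<^sup>2 * (cmod (coeff f2 k))\<^sup>2"
        using L w[of k] by (simp add: powr_minus powr_numeral field_simps)
    qed
    also have "\<dots> \<le> 4 / L\<^sup>2 * (\<integral>x. (cmod (f2 x))\<^sup>2 \<partial>M)"
      unfolding sum_distrib_left[symmetric] by (intro mult_left_mono bessel i22 fin) auto
    finally show ?thesis .
  qed
  have "(\<Sum>k\<in>S. w k powr (- 2) * (w k * cmod (coeff f k)) powr q) \<le> (\<Sum>k\<in>S. w k powr (- 2) * (2 * L) powr q)"
    using lev(2) order_trans[OF zero_le_one w] q
    by (intro sum_mono mult_left_mono powr_mono2) (auto intro!: mult_nonneg_nonneg)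
  also have "\<dots> = (2 * L) powr q * (\<Sum>k\<in>S. w k powr (- 2))" by (simp add: sum_distrib_left mult.commute)
  also have "\<dots> \<le> (2 * L) powr q * ((\<Sum>k\<in>S1. w k powr (- 2)) + (\<Sum>k\<in>S2. w k powr (- 2)))"
  proof (rule mult_left_mono)
    have "(\<Sum>k\<in>S. w k powr (- 2)) \<le> (\<Sum>k\<in>S1 \<union> S2. w k powr (- 2))"
      using S12 fin by (intro sum_mono2) auto
    also have "\<dots> \<le> (\<Sum>k\<in>S1. w k powr (- 2)) + (\<Sum>k\<in>S2. w k powr (- 2))"
      using fin by (subst sum.union_inter[symmetric]) (auto intro!: sum_nonneg)
    finally show "(\<Sum>k\<in>S. w k powr (- 2)) \<le> (\<Sum>k\<in>S1. w k powr (- 2)) + (\<Sum>k\<in>S2. w k powr (- 2))" .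
  qed simp
  also have "\<dots> \<le> (2 * L) powr q * (2 * A * a / L + 4 / L\<^sup>2 * (\<integral>x. (cmod (f2 x))\<^sup>2 \<partial>M))"
    by (intro mult_left_mono add_mono b1 b2) auto
  also have "\<dots> = 2 powr q * (2 * A * (L powr q / L) * a + 4 * (L powr q / L\<^sup>2) * (\<integral>x. (cmod (f2 x))\<^sup>2 \<partial>M))"
    by (simp add: powr_mult algebra_simps)
  also have "L powr q / L = L powr (q - 1)" using L by (simp add: powr_diff)
  also have "L powr q / L\<^sup>2 = L powr (q - 2)" using L by (simp add: powr_diff powr_numeral)
  finally show ?thesis unfolding a_def n1 n2 .
qed

text \<open>Marcinkiewicz interpolation between the weak type \<open>(1,1)\<close> and the strong type \<open>(2,2)\<close> of
  \<open>f \<mapsto> (w k * coeff f k)\<close> with respect to the weights \<open>w powr (-2)\<close>.  Summing the estimates over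
  the dyadic levels leaves two geometric series in each point, dominated by the levels nearest
  to \<open>|f x|\<close>.\<close>

lemma paley:
  fixes w :: "'k \<Rightarrow> real"
  assumes w: "\<And>k. 1 \<le> w k" and A: "0 \<le> A"
    and tail: "\<And>u S. 0 < u \<Longrightarrow> finite S \<Longrightarrow> (\<And>k. k \<in> S \<Longrightarrow> u \<le> w k) \<Longrightarrow> (\<Sum>k\<in>S. w k powr (- 2)) \<le> A / u"
    and [measurable]: "f \<in> borel_measurable M" and q: "1 < q" "q < 2" and fq: "integrable M (\<lambda>x. cmod (f x) powr q)"
    and S: "finite S"
  shows "(\<Sum>k\<in>S. w k powr (q - 2) * cmod (coeff f k) powr q)
     \<le> 2 powr q * (2 * A / (1 - 2 powr (1 - q)) + 4 / (1 - 2 powr (q - 2))) * (\<integral>x. cmod (f x) powr q \<partial>M)"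
proof -
  have f: "integrable M f" using q by (intro integrable_of_powr[OF _ _ fq]) auto
  define T where "T k = w k * cmod (coeff f k)" for k
  define S' where "S' = {k\<in>S. T k > 0}"
  define lev where "lev k = \<lfloor>log 2 (T k)\<rfloor>" for k
  define I where "I = lev ` S'"
  have fin: "finite S'" "finite I" using S by (auto simp: S'_def I_def)
  define B1 where "B1 L x = cmod (f x) * indicator {x. L < cmod (f x)} x" for L x
  define B2 where "B2 L x = (cmod (f x))\<^sup>2 * indicator {x. cmod (f x) \<le> L} x" for L x
  have iB1: "integrable M (B1 L)" for L
    unfolding B1_def[abs_def] by (rule Bochner_Integration.integrable_bound[OF f]) (auto simp: indicator_def)
  have iB2: "integrable M (B2 L)" for L
    unfolding B2_def[abs_def]
    by (rule integrable_const_bound[of _ "\<bar>L\<bar>\<^sup>2"]) (auto simp: indicator_def intro!: power_mono)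
  have eq: "w k powr (q - 2) * cmod (coeff f k) powr q = w k powr (- 2) * T k powr q" for k
    using w[of k] by (simp add: T_def powr_mult powr_add[symmetric] mult.assoc[symmetric])
  have "(\<Sum>k\<in>S. w k powr (q - 2) * cmod (coeff f k) powr q) = (\<Sum>k\<in>S'. w k powr (- 2) * T k powr q)"
    unfolding eq S'_def
  proof (rule sum.mono_neutral_right)
    show "\<forall>i\<in>S - {k \<in> S. 0 < T k}. w i powr (- 2) * T i powr q = 0"
    proof
      fix i assume "i \<in> S - {k \<in> S. 0 < T k}"
      moreover have "0 \<le> T i" using w[of i] by (simp add: T_def)
      ultimately have "T i = 0" by auto
      then show "w i powr (- 2) * T i powr q = 0" by simp
    qed
  qed (use S in auto)
  also have "\<dots> = (\<Sum>i\<in>I. \<Sum>k\<in>{k\<in>S'. lev k = i}. w k powr (- 2) * T k powr q)"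
    unfolding I_def by (rule sum.image_gen[OF fin(1)])
  also have "\<dots> \<le> (\<Sum>i\<in>I. 2 powr q * (2 * A * (2 powr real_of_int i) powr (q - 1) * (\<integral>x. B1 (2 powr real_of_int i) x \<partial>M)
         + 4 * (2 powr real_of_int i) powr (q - 2) * (\<integral>x. B2 (2 powr real_of_int i) x \<partial>M)))"
    unfolding T_def B1_def B2_def
  proof (rule sum_mono, rule paley_level[OF w tail])
    fix i k assume "k \<in> {k \<in> S'. lev k = i}"
    then have T: "T k > 0" and i: "i = \<lfloor>log 2 (T k)\<rfloor>" by (auto simp: S'_def lev_def)
    have "2 powr real_of_int i \<le> T k" using T by (simp add: i le_log_iff[symmetric])
    then show "2 powr real_of_int i \<le> w k * cmod (coeff f k)" by (simp add: T_def)
    have "log 2 (T k) < real_of_int i + 1" unfolding i by linarith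
    then have "T k < 2 powr (real_of_int i + 1)" using T by (simp add: log_less_iff)
    then show "w k * cmod (coeff f k) \<le> 2 * 2 powr real_of_int i" by (simp add: T_def powr_add)
  qed (use f q fin in auto)
  also have "\<dots> = 2 powr q * (\<integral>x. (\<Sum>i\<in>I. 2 * A * (2 powr real_of_int i) powr (q - 1) * B1 (2 powr real_of_int i) x
         + 4 * (2 powr real_of_int i) powr (q - 2) * B2 (2 powr real_of_int i) x) \<partial>M)"
    using iB1 iB2 by (simp add: sum_distrib_left)
  also have "\<dots> \<le> 2 powr q * (\<integral>x. (2 * A / (1 - 2 powr (1 - q)) + 4 / (1 - 2 powr (q - 2))) * cmod (f x) powr q \<partial>M)"
  proof (intro mult_left_mono integral_mono)
    fix x
    define y where "y = cmod (f x)"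
    have s1: "(\<Sum>i\<in>I. (2 powr real_of_int i) powr (q - 1) * B1 (2 powr real_of_int i) x) \<le> 1 / (1 - 2 powr (1 - q)) * y powr q"
    proof (cases "y > 0")
      case True
      have "(\<Sum>i\<in>I. (2 powr real_of_int i) powr (q - 1) * B1 (2 powr real_of_int i) x)
         = (\<Sum>i\<in>{i\<in>I. 2 powr real_of_int i < y}. (2 powr real_of_int i) powr (q - 1)) * y"
        unfolding sum_distrib_right
        by (rule sum.mono_neutral_cong_right) (use fin in \<open>auto simp: B1_def y_def\<close>)
      also have "\<dots> \<le> (1 / (1 - 2 powr (- (q - 1))) * y powr (q - 1)) * y"
        using True q fin by (intro mult_right_mono sum_dyadic_below) auto
      also have "\<dots> = 1 / (1 - 2 powr (1 - q)) * y powr q"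
        using True by (simp add: powr_diff)
      finally show ?thesis .
    next
      case False
      then have "y = 0" by (simp add: y_def)
      then show ?thesis by (simp add: B1_def y_def)
    qed
    have s2: "(\<Sum>i\<in>I. (2 powr real_of_int i) powr (q - 2) * B2 (2 powr real_of_int i) x) \<le> 1 / (1 - 2 powr (q - 2)) * y powr q"
    proof (cases "y > 0")
      case True
      have "(\<Sum>i\<in>I. (2 powr real_of_int i) powr (q - 2) * B2 (2 powr real_of_int i) x)
         = (\<Sum>i\<in>{i\<in>I. y \<le> 2 powr real_of_int i}. (2 powr real_of_int i) powr (- (2 - q))) * y\<^sup>2"
        unfolding sum_distrib_right
        by (rule sum.mono_neutral_cong_right) (use fin in \<open>auto simp: B2_def y_def\<close>)
      also have "\<dots> \<le> (1 / (1 - 2 powr (- (2 - q))) * y powr (- (2 - q))) * y\<^sup>2"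
        using True q fin by (intro mult_right_mono sum_dyadic_above) auto
      also have "\<dots> = 1 / (1 - 2 powr (q - 2)) * y powr q"
        using True by (simp add: powr_diff powr_numeral)
      finally show ?thesis .
    next
      case False
      then have "y = 0" by (simp add: y_def)
      then show ?thesis by (simp add: B2_def y_def)
    qed
    have "(\<Sum>i\<in>I. 2 * A * (2 powr real_of_int i) powr (q - 1) * B1 (2 powr real_of_int i) x
         + 4 * (2 powr real_of_int i) powr (q - 2) * B2 (2 powr real_of_int i) x)
      = 2 * A * (\<Sum>i\<in>I. (2 powr real_of_int i) powr (q - 1) * B1 (2 powr real_of_int i) x)
        + 4 * (\<Sum>i\<in>I. (2 powr real_of_int i) powr (q - 2) * B2 (2 powr real_of_int i) x)"
      by (simp add: sum.distrib sum_distrib_left mult.assoc)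
    also have "\<dots> \<le> 2 * A * (1 / (1 - 2 powr (1 - q)) * y powr q) + 4 * (1 / (1 - 2 powr (q - 2)) * y powr q)"
      using s1 s2 A by (intro add_mono mult_left_mono) auto
    also have "\<dots> = (2 * A / (1 - 2 powr (1 - q)) + 4 / (1 - 2 powr (q - 2))) * cmod (f x) powr q"
      by (simp add: y_def algebra_simps)
    finally show "(\<Sum>i\<in>I. 2 * A * (2 powr real_of_int i) powr (q - 1) * B1 (2 powr real_of_int i) x
         + 4 * (2 powr real_of_int i) powr (q - 2) * B2 (2 powr real_of_int i) x) \<le> \<dots>" .
  qed (use iB1 iB2 fq in auto)
  finally show ?thesis by simp
qed

end

definition wt :: "int \<Rightarrow> real" where
  "wt n = real_of_int (max 1 \<bar>n\<bar>)"

lemma wt_ge_1: "1 \<le> wt n" by (simp add: wt_def)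

lemma sum_inverse_squares_le:
  assumes "1 \<le> a" "finite N" "\<And>n. n \<in> N \<Longrightarrow> a \<le> n"
  shows "(\<Sum>n\<in>N. real n powr (- 2)) \<le> 2 / real a"
proof -
  define b where "b = Max (insert a N)"
  have ab: "a \<le> b" and Nb: "N \<subseteq> {a..b}" using assms by (auto simp: b_def)
  have t: "real n powr (- 2) \<le> 2 / real n - 2 / real (Suc n)" if "n \<ge> 1" for n
  proof -
    have "real n powr (- 2) = 1 / (real n * real n)" using that by (simp add: powr_minus powr_numeral power2_eq_square field_simps)
    also have "\<dots> \<le> 2 / (real n * real (Suc n))"
    proof -
      have "real n * real (Suc n) \<le> 2 * (real n * real n)"
        using that by (simp add: distrib_left)
      then show ?thesis using that by (simp add: divide_le_eq le_divide_eq pos_divide_le_eq)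
    qed
    also have "\<dots> = 2 / real n - 2 / real (Suc n)" using that by (simp add: field_simps)
    finally show ?thesis .
  qed
  have "(\<Sum>n\<in>N. real n powr (- 2)) \<le> (\<Sum>n\<in>{a..b}. real n powr (- 2))"
    by (rule sum_mono2) (use Nb in auto)
  also have "\<dots> \<le> (\<Sum>n\<in>{a..b}. 2 / real n - 2 / real (Suc n))"
    using assms(1) by (intro sum_mono t) auto
  also have "\<dots> = 2 / real a - 2 / real (Suc b)"
    using ab by (induction b rule: dec_induct) simp_all
  also have "\<dots> \<le> 2 / real a" by simp
  finally show ?thesis .
qed

lemma wt_tail:
  assumes u: "0 < u" and S: "finite S" and uS: "\<And>n. n \<in> S \<Longrightarrow> u \<le> wt n"
  shows "(\<Sum>n\<in>S. wt n powr (- 2)) \<le> 5 / u"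
proof -
  define a where "a = nat \<lceil>max 1 u\<rceil>"
  have a: "1 \<le> a" "u \<le> real a" unfolding a_def by linarith+
  have ge: "a \<le> nat \<bar>n\<bar>" if "n \<in> S" "n \<noteq> 0" for n
    using uS[OF that(1)] that(2) unfolding a_def wt_def by linarith
  have half: "(\<Sum>n\<in>T. wt n powr (- 2)) \<le> 2 / u" if T: "T \<subseteq> S" "0 \<notin> T" "inj_on (\<lambda>n. nat \<bar>n\<bar>) T" for T
  proof -
    have "(\<Sum>n\<in>T. wt n powr (- 2)) = (\<Sum>n\<in>(\<lambda>n. nat \<bar>n\<bar>) ` T. real n powr (- 2))"
    proof (subst sum.reindex[OF T(3)], rule sum.cong)
      fix n assume "n \<in> T"
      then have "n \<noteq> 0" using T by auto
      then have "wt n = real (nat \<bar>n\<bar>)" by (simp add: wt_def max_def)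
      then show "wt n powr (- 2) = ((\<lambda>n. real n powr (- 2)) \<circ> (\<lambda>n. nat \<bar>n\<bar>)) n" by simp
    qed simp
    also have "\<dots> \<le> 2 / real a"
      using T S finite_subset[OF T(1) S] ge by (intro sum_inverse_squares_le) (use a in auto)
    also have "\<dots> \<le> 2 / u" using a u by (intro divide_left_mono) auto
    finally show ?thesis .
  qed
  have "(\<Sum>n\<in>S. wt n powr (- 2)) = (\<Sum>n\<in>S \<inter> {0}. wt n powr (- 2)) + (\<Sum>n\<in>S - {0}. wt n powr (- 2))"
    by (rule sum.Int_Diff[OF S])
  also have "(\<Sum>n\<in>S - {0}. wt n powr (- 2)) = (\<Sum>n\<in>(S - {0}) \<inter> {0<..}. wt n powr (- 2)) + (\<Sum>n\<in>S - {0} - {0<..}. wt n powr (- 2))"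
    by (rule sum.Int_Diff) (use S in simp)
  also have "(\<Sum>n\<in>S \<inter> {0}. wt n powr (- 2)) \<le> 1 / u"
  proof (cases "0 \<in> S")
    case True
    then have "u \<le> 1" using uS[of 0] by (simp add: wt_def)
    then show ?thesis using True u by (simp add: wt_def)
  qed (use u in auto)
  also have "(\<Sum>n\<in>(S - {0}) \<inter> {0<..}. wt n powr (- 2)) \<le> 2 / u" by (rule half) (auto intro!: inj_onI)
  also have "(\<Sum>n\<in>S - {0} - {0<..}. wt n powr (- 2)) \<le> 2 / u" by (rule half) (auto intro!: inj_onI)
  finally show ?thesis by simp
qed

text \<open>For \<open>q = 2\<close> this is Bessel's inequality, for \<open>q < 2\<close> Paley's inequality with the weights
  \<open>max 1 |n|\<close>.  With an extended integral on the right the estimate applies to all sections of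
  a function of several variables, integrable or not.\<close>

lemma hardy_littlewood_circle:
  assumes q: "1 < q" "q \<le> 2"
  obtains C where "0 < C" and "\<And>f S. f \<in> borel_measurable borel \<Longrightarrow> finite S \<Longrightarrow>
     ennreal (\<Sum>n\<in>S. wt n powr (q - 2) * cmod (modes.coeff f n) powr q) \<le> ennreal C * (\<integral>\<^sup>+t. ennreal (cmod (f t) powr q) \<partial>circle)"
proof -
  have conv: "ennreal a \<le> ennreal C * (\<integral>\<^sup>+t. ennreal (cmod (f t) powr q) \<partial>circle)"
    if C: "C > 0" and f[measurable]: "f \<in> borel_measurable borel"
      and le: "integrable circle (\<lambda>t. cmod (f t) powr q) \<Longrightarrow> a \<le> C * (\<integral>t. cmod (f t) powr q \<partial>circle)" for f a C
  proof (cases "integrable circle (\<lambda>t. cmod (f t) powr q)")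
    case True
    then have "ennreal C * (\<integral>\<^sup>+t. ennreal (cmod (f t) powr q) \<partial>circle) = ennreal (C * (\<integral>t. cmod (f t) powr q \<partial>circle))"
      using C by (subst nn_integral_eq_integral) (auto simp: ennreal_mult)
    with le[OF True] show ?thesis using ennreal_leI by metis
  next
    case False
    then have "(\<integral>\<^sup>+t. ennreal (cmod (f t) powr q) \<partial>circle) = \<infinity>"
    proof (rule contrapos_np)
      assume "(\<integral>\<^sup>+t. ennreal (cmod (f t) powr q) \<partial>circle) \<noteq> \<infinity>"
      then show "integrable circle (\<lambda>t. cmod (f t) powr q)"
        by (intro integrableI_nonneg) (auto simp: less_top)
    qed
    then show ?thesis using C by (simp add: ennreal_mult_top)
  qed
  show thesis
  proof (cases "q = 2")
    case True
    show thesis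
    proof (rule that[of 1])
      fix f :: "real \<Rightarrow> complex" and S :: "int set" assume f[measurable]: "f \<in> borel_measurable borel" and S: "finite S"
      show "ennreal (\<Sum>n\<in>S. wt n powr (q - 2) * cmod (modes.coeff f n) powr q) \<le> ennreal 1 * (\<integral>\<^sup>+t. ennreal (cmod (f t) powr q) \<partial>circle)"
      proof (rule conv)
        have w: "wt n powr (q - 2) = 1" for n using wt_ge_1[of n] by (simp add: True)
        assume "integrable circle (\<lambda>t. cmod (f t) powr q)"
        then show "(\<Sum>n\<in>S. wt n powr (q - 2) * cmod (modes.coeff f n) powr q) \<le> 1 * (\<integral>t. cmod (f t) powr q \<partial>circle)"
          unfolding w using modes.bessel[of f S] S by (simp add: True)
      qed auto
    qed auto
  next
    case False
    define C where "C = 2 powr q * (2 * 5 / (1 - 2 powr (1 - q)) + 4 / (1 - 2 powr (q - 2)))"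
    have C: "C > 0" unfolding C_def using q False powr_less_one[of 2 "1-q"] powr_less_one[of 2 "q-2"]
      by (intro mult_pos_pos add_pos_pos divide_pos_pos) auto
    show thesis
    proof (rule that[of C])
      fix f :: "real \<Rightarrow> complex" and S :: "int set" assume f[measurable]: "f \<in> borel_measurable borel" and S: "finite S"
      show "ennreal (\<Sum>n\<in>S. wt n powr (q - 2) * cmod (modes.coeff f n) powr q) \<le> ennreal C * (\<integral>\<^sup>+t. ennreal (cmod (f t) powr q) \<partial>circle)"
      proof (rule conv[OF C f])
        assume i: "integrable circle (\<lambda>t. cmod (f t) powr q)"
        show "(\<Sum>n\<in>S. wt n powr (q - 2) * cmod (modes.coeff f n) powr q) \<le> C * (\<integral>t. cmod (f t) powr q \<partial>circle)"
          unfolding C_def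
          by (rule modes.paley[OF wt_ge_1 _ wt_tail _ _ _ i S]) (use q False in auto)
      qed
    qed (use C in auto)
  qed
qed

text \<open>The product weights are not of weak type \<open>(1,1)\<close> in several variables, so the inequality is
  iterated instead: after the transform in one coordinate, the inequality in the other coordinates
  is applied to each coefficient, a function of these coordinates, and Fubini's theorem allows the
  one-dimensional inequality to be used on the sections.\<close>

lemma hardy_littlewood_PiM:
  fixes S :: "'i \<Rightarrow> int set"
  assumes C: "0 < C"
    and one: "\<And>f S. f \<in> borel_measurable borel \<Longrightarrow> finite S \<Longrightarrow>
     ennreal (\<Sum>n\<in>S. wt n powr (q - 2) * cmod (modes.coeff f n) powr q) \<le> ennreal C * (\<integral>\<^sup>+t. ennreal (cmod (f t) powr q) \<partial>circle)"
    and q: "1 < q" and J: "finite J" and S: "\<And>j. finite (S j)"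
    and f: "f \<in> borel_measurable (\<Pi>\<^sub>M j\<in>J. circle)"
  shows "ennreal (\<Sum>k\<in>PiE J S. (\<Prod>j\<in>J. wt (k j)) powr (q - 2) *
            cmod (\<integral>x. f x * (\<Prod>j\<in>J. cnj (mode (k j) (x j))) \<partial>(\<Pi>\<^sub>M j\<in>J. circle)) powr q)
      \<le> ennreal (C ^ card J) * (\<integral>\<^sup>+x. ennreal (cmod (f x) powr q) \<partial>(\<Pi>\<^sub>M j\<in>J. circle))"
  using J f
proof (induction J arbitrary: f)
  case empty
  then show ?case by (simp add: PiM_empty lebesgue_integral_count_space_finite nn_integral_count_space_finite)
next
  case (insert j J)
  note [measurable] = insert.prems
  let ?I = "insert j J"
  let ?M = "\<Pi>\<^sub>M j\<in>J. circle" and ?N = "\<Pi>\<^sub>M j\<in>?I. circle"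
  interpret N: finite_product_prob_space "\<lambda>_. circle" ?I
    by unfold_locales (use insert.hyps in simp)
  show ?case
  proof (cases "(\<integral>\<^sup>+x. ennreal (cmod (f x) powr q) \<partial>?N) = \<infinity>")
    case True
    then show ?thesis using C by (simp add: ennreal_mult_top del: power_Suc)
  next
    case False
    then have fq: "integrable ?N (\<lambda>x. cmod (f x) powr q)"
      by (intro integrableI_nonneg) (auto simp: less_top)
    have fi: "integrable ?N f"
    proof (rule Bochner_Integration.integrable_bound[of _ "\<lambda>x. 1 + cmod (f x) powr q"])
      have "cmod (f x) \<le> 1 + cmod (f x) powr q" for x using q by (intro le_one_plus_powr) auto
      then show "AE x in ?N. norm (f x) \<le> norm (1 + cmod (f x) powr q)" by (auto intro!: AE_I2)
    qed (use fq in auto)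
    define \<Phi> where "\<Phi> n x = (\<integral>y. f (x(j := y)) * cnj (mode n y) \<partial>circle)" for n x
    have m1 [measurable]: "(\<lambda>(x, y). f (x(j := y))) \<in> borel_measurable (?M \<Otimes>\<^sub>M circle)"
      using measurable_compose[OF measurable_add_dim[where M="\<lambda>_. circle" and I=J and i=j] insert.prems]
      by (simp add: split_beta')
    have m\<Phi> [measurable]: "\<Phi> n \<in> borel_measurable ?M" for n
      unfolding \<Phi>_def[abs_def] by measurable
    have sec: "(\<lambda>y. f (x(j := y))) \<in> borel_measurable borel" if "x \<in> space ?M" for x
      using measurable_Pair2[OF m1 that] by (simp cong: measurable_cong_sets)
    have coeff: "(\<integral>x. f x * (\<Prod>i\<in>?I. cnj (mode ((k(j := n)) i) (x i))) \<partial>?N)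
       = (\<integral>x. \<Phi> n x * (\<Prod>i\<in>J. cnj (mode (k i) (x i))) \<partial>?M)" for n k
    proof -
      have int: "integrable ?N (\<lambda>x. f x * (\<Prod>i\<in>?I. cnj (mode ((k(j := n)) i) (x i))))"
      proof (rule integrable_times_bounded[OF fi, of _ 1])
        show "(\<lambda>x. \<Prod>i\<in>?I. cnj (mode ((k(j := n)) i) (x i))) \<in> borel_measurable ?N" by measurable
      qed (simp add: prod_norm[symmetric])
      have "(\<integral>x. f x * (\<Prod>i\<in>?I. cnj (mode ((k(j := n)) i) (x i))) \<partial>?N)
        = (\<integral>x. (\<integral>y. f (x(j := y)) * (\<Prod>i\<in>?I. cnj (mode ((k(j := n)) i) ((x(j := y)) i))) \<partial>circle) \<partial>?M)"
        by (rule circles.product_integral_insert[OF insert.hyps int])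
      also have "\<dots> = (\<integral>x. (\<integral>y. f (x(j := y)) * cnj (mode n y) * (\<Prod>i\<in>J. cnj (mode (k i) (x i))) \<partial>circle) \<partial>?M)"
      proof -
        have "(\<Prod>i\<in>?I. cnj (mode ((k(j := n)) i) ((x(j := y)) i))) = cnj (mode n y) * (\<Prod>i\<in>J. cnj (mode (k i) (x i)))" for x y
          using insert.hyps by (subst prod.insert) (auto intro!: prod.cong)
        then show ?thesis by (simp only: mult.assoc)
      qed
      also have "\<dots> = (\<integral>x. \<Phi> n x * (\<Prod>i\<in>J. cnj (mode (k i) (x i))) \<partial>?M)"
        by (simp add: \<Phi>_def)
      finally show ?thesis .
    qed
    have prodw: "(\<Prod>i\<in>?I. wt ((k(j := n)) i)) powr (q - 2) = wt n powr (q - 2) * (\<Prod>i\<in>J. wt (k i)) powr (q - 2)" for n k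
    proof -
      have "(\<Prod>i\<in>?I. wt ((k(j := n)) i)) = wt n * (\<Prod>i\<in>J. wt (k i))"
        using insert.hyps by (subst prod.insert) (auto intro!: prod.cong)
      then show ?thesis by (simp add: powr_mult)
    qed
    define G where "G n = (\<Sum>k\<in>PiE J S. (\<Prod>i\<in>J. wt (k i)) powr (q - 2) * cmod (\<integral>x. \<Phi> n x * (\<Prod>i\<in>J. cnj (mode (k i) (x i))) \<partial>?M) powr q)" for n
    have G0: "0 \<le> G n" for n by (auto simp: G_def intro!: sum_nonneg mult_nonneg_nonneg)
    have "(\<Sum>k\<in>PiE ?I S. (\<Prod>i\<in>?I. wt (k i)) powr (q - 2) * cmod (\<integral>x. f x * (\<Prod>i\<in>?I. cnj (mode (k i) (x i))) \<partial>?N) powr q)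
       = (\<Sum>(n, k)\<in>S j \<times> PiE J S. wt n powr (q - 2) * ((\<Prod>i\<in>J. wt (k i)) powr (q - 2) * cmod (\<integral>x. \<Phi> n x * (\<Prod>i\<in>J. cnj (mode (k i) (x i))) \<partial>?M) powr q))"
      unfolding PiE_insert_eq
      by (subst sum.reindex) (auto intro!: inj_combinator sum.cong simp: insert.hyps coeff prodw mult.assoc simp del: prod.insert fun_upd_apply)
    also have "\<dots> = (\<Sum>n\<in>S j. wt n powr (q - 2) * G n)"
      unfolding G_def sum_distrib_left by (rule sum.cartesian_product[symmetric])
    finally have "ennreal (\<Sum>k\<in>PiE ?I S. (\<Prod>i\<in>?I. wt (k i)) powr (q - 2) * cmod (\<integral>x. f x * (\<Prod>i\<in>?I. cnj (mode (k i) (x i))) \<partial>?N) powr q)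
      = (\<Sum>n\<in>S j. ennreal (wt n powr (q - 2)) * ennreal (G n))"
      using G0 by (simp add: ennreal_mult[symmetric] sum_ennreal)
    also have "\<dots> \<le> (\<Sum>n\<in>S j. ennreal (wt n powr (q - 2)) * (ennreal (C ^ card J) * (\<integral>\<^sup>+x. ennreal (cmod (\<Phi> n x) powr q) \<partial>?M)))"
      unfolding G_def by (intro sum_mono mult_left_mono insert.IH m\<Phi>) auto
    also have "\<dots> = ennreal (C ^ card J) * (\<integral>\<^sup>+x. (\<Sum>n\<in>S j. ennreal (wt n powr (q - 2)) * ennreal (cmod (\<Phi> n x) powr q)) \<partial>?M)"
      by (simp add: nn_integral_sum nn_integral_cmult sum_distrib_left mult.left_commute)
    also have "\<dots> \<le> ennreal (C ^ card J) * (\<integral>\<^sup>+x. ennreal C * (\<integral>\<^sup>+y. ennreal (cmod (f (x(j := y))) powr q) \<partial>circle) \<partial>?M)"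
    proof (intro mult_left_mono nn_integral_mono)
      fix x assume x: "x \<in> space ?M"
      have "(\<Sum>n\<in>S j. ennreal (wt n powr (q - 2)) * ennreal (cmod (\<Phi> n x) powr q)) = ennreal (\<Sum>n\<in>S j. wt n powr (q - 2) * cmod (\<Phi> n x) powr q)"
        by (simp add: ennreal_mult[symmetric] sum_ennreal)
      also have "\<dots> \<le> ennreal C * (\<integral>\<^sup>+y. ennreal (cmod (f (x(j := y))) powr q) \<partial>circle)"
        unfolding \<Phi>_def by (rule one[OF sec[OF x] S])
      finally show "(\<Sum>n\<in>S j. ennreal (wt n powr (q - 2)) * ennreal (cmod (\<Phi> n x) powr q)) \<le> \<dots>" .
    qed auto
    also have "\<dots> = ennreal (C ^ card ?I) * (\<integral>\<^sup>+x. (\<integral>\<^sup>+y. ennreal (cmod (f (x(j := y))) powr q) \<partial>circle) \<partial>?M)"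
    proof -
      have "(\<lambda>x. \<integral>\<^sup>+y. ennreal (cmod (f (x(j := y))) powr q) \<partial>circle) \<in> borel_measurable ?M"
        by measurable
      then show ?thesis using C insert.hyps
        by (subst nn_integral_cmult) (auto simp: mult.assoc[symmetric] ennreal_mult[symmetric] mult.commute)
    qed
    also have "(\<integral>\<^sup>+x. (\<integral>\<^sup>+y. ennreal (cmod (f (x(j := y))) powr q) \<partial>circle) \<partial>?M) = (\<integral>\<^sup>+x. ennreal (cmod (f x) powr q) \<partial>?N)"
      by (rule circles.product_nn_integral_insert[OF insert.hyps, symmetric]) measurable
    finally show ?thesis .
  qed
qed

definition Wt :: "int^'d::finite \<Rightarrow> real" where
  "Wt k = (\<Prod>j\<in>UNIV. wt (k $ j))"

text \<open>Every finite set of frequencies lies in a product of finite sets, and the terms are nonnegative.\<close>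

lemma hardy_littlewood:
  assumes q: "1 < q" "q \<le> 2"
  obtains C where "0 < C" and "\<And>(f :: 'd::finite tfun) K. f \<in> borel_measurable borel \<Longrightarrow>
      integrable torus (\<lambda>x. cmod (f x) powr q) \<Longrightarrow> finite K \<Longrightarrow>
     (\<Sum>k\<in>K. Wt k powr (q - 2) * cmod (fourier f k) powr q) \<le> C * (\<integral>x. cmod (f x) powr q \<partial>torus)"
proof -
  obtain C where C: "0 < C" and one: "\<And>f S. f \<in> borel_measurable borel \<Longrightarrow> finite S \<Longrightarrow>
     ennreal (\<Sum>n\<in>S. wt n powr (q - 2) * cmod (modes.coeff f n) powr q) \<le> ennreal C * (\<integral>\<^sup>+t. ennreal (cmod (f t) powr q) \<partial>circle)"
    using hardy_littlewood_circle[OF q] by blast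
  show thesis
  proof (rule that[of "C ^ CARD('d)"])
    fix f :: "'d tfun" and K :: "(int^'d) set"
    assume [measurable]: "f \<in> borel_measurable borel" and int: "integrable torus (\<lambda>x. cmod (f x) powr q)" and K: "finite K"
    define S where "S j = (\<lambda>k. k $ j) ` K" for j
    let ?P = "\<Pi>\<^sub>M j\<in>(UNIV::'d set). circle"
    have S: "finite (S j)" for j using K by (simp add: S_def)
    have KS: "K \<subseteq> vec_lambda ` PiE UNIV S"
    proof
      fix k assume "k \<in> K"
      then have "k = vec_lambda (\<lambda>j. k $ j)" "(\<lambda>j. k $ j) \<in> PiE UNIV S" by (auto simp: S_def)
      then show "k \<in> vec_lambda ` PiE UNIV S" by blast
    qed
    have four: "fourier f (vec_lambda k) = (\<integral>x. f (vec_lambda x) * (\<Prod>j\<in>UNIV. cnj (mode (k j) (x j))) \<partial>?P)" for k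
    proof -
      have "fourier f (vec_lambda k) = (\<integral>x. f x * cnj (character (vec_lambda k) x) \<partial>distr ?P borel vec_lambda)"
        unfolding fourier_def by (subst torus_eq_distr) simp
      also have "\<dots> = (\<integral>x. f (vec_lambda x) * cnj (character (vec_lambda k) (vec_lambda x)) \<partial>?P)"
        by (rule integral_distr) auto
      finally show ?thesis by (simp add: character_eq_prod)
    qed
    have f': "(\<lambda>x. f (vec_lambda x)) \<in> borel_measurable ?P" by measurable
    have "ennreal (\<Sum>k\<in>K. Wt k powr (q - 2) * cmod (fourier f k) powr q)
       \<le> ennreal (\<Sum>k\<in>vec_lambda ` PiE UNIV S. Wt k powr (q - 2) * cmod (fourier f k) powr q)"
      by (intro ennreal_leI sum_mono2 KS) (auto intro!: finite_imageI finite_PiE S)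
    also have "(\<Sum>k\<in>vec_lambda ` PiE UNIV S. Wt k powr (q - 2) * cmod (fourier f k) powr q)
      = (\<Sum>k\<in>PiE UNIV S. (\<Prod>j\<in>UNIV. wt (k j)) powr (q - 2) *
            cmod (\<integral>x. f (vec_lambda x) * (\<Prod>j\<in>UNIV. cnj (mode (k j) (x j))) \<partial>?P) powr q)"
      by (subst sum.reindex) (auto simp: inj_on_def four Wt_def vec_eq_iff)
    also have "ennreal \<dots> \<le> ennreal (C ^ CARD('d)) * (\<integral>\<^sup>+x. ennreal (cmod (f (vec_lambda x)) powr q) \<partial>?P)"
      by (rule hardy_littlewood_PiM[OF C one q(1) finite S f'])
    also have "(\<integral>\<^sup>+x. ennreal (cmod (f (vec_lambda x)) powr q) \<partial>?P) = (\<integral>\<^sup>+x. ennreal (cmod (f x) powr q) \<partial>torus)"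
      by (rule nn_integral_torus[symmetric]) measurable
    also have "\<dots> = ennreal (\<integral>x. cmod (f x) powr q \<partial>torus)"
      by (rule nn_integral_eq_integral[OF int]) simp
    finally show "(\<Sum>k\<in>K. Wt k powr (q - 2) * cmod (fourier f k) powr q) \<le> C ^ CARD('d) * (\<integral>x. cmod (f x) powr q \<partial>torus)"
      using C by (simp add: ennreal_mult[symmetric] ennreal_le_iff integral_nonneg)
  qed (use C in simp)
qed

section \<open>Fourier coefficients of functions in the class\<close>

text \<open>Young's inequality applied to \<open>t f\<close> and \<open>g / t\<close>, with the scaling \<open>t\<close> that balances both terms.\<close>

lemma integral_hoelder:
  fixes f g :: "'a \<Rightarrow> real"
  assumes pq: "1 < p" "1 < p'" "1/p + 1/p' = 1"
    and [measurable]: "f \<in> borel_measurable M" "g \<in> borel_measurable M"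
    and nn: "\<And>x. 0 \<le> f x" "\<And>x. 0 \<le> g x"
    and fi: "integrable M (\<lambda>x. f x powr p)" and gi: "integrable M (\<lambda>x. g x powr p')"
  shows "integrable M (\<lambda>x. f x * g x)"
    and "(\<integral>x. f x * g x \<partial>M) \<le> (\<integral>x. f x powr p \<partial>M) powr (1/p) * (\<integral>x. g x powr p' \<partial>M) powr (1/p')"
proof -
  have young: "f x * g x \<le> f x powr p / p + g x powr p' / p'" for x
    by (rule Youngs_inequality) (use pq nn in auto)
  show i: "integrable M (\<lambda>x. f x * g x)"
  proof (rule Bochner_Integration.integrable_bound[of _ "\<lambda>x. f x powr p / p + g x powr p' / p'"])
    show "AE x in M. norm (f x * g x) \<le> norm (f x powr p / p + g x powr p' / p')"
      using young nn pq by (auto intro!: AE_I2 simp: abs_mult)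
  qed (use fi gi in auto)
  define F where "F = (\<integral>x. f x powr p \<partial>M)"
  define G where "G = (\<integral>x. g x powr p' \<partial>M)"
  have FG: "0 \<le> F" "0 \<le> G" by (auto simp: F_def G_def)
  show "(\<integral>x. f x * g x \<partial>M) \<le> (\<integral>x. f x powr p \<partial>M) powr (1/p) * (\<integral>x. g x powr p' \<partial>M) powr (1/p')"
  proof (cases "F = 0 \<or> G = 0")
    case True
    then have "(AE x in M. f x powr p = 0) \<or> (AE x in M. g x powr p' = 0)"
      using fi gi by (auto simp: F_def G_def integral_nonneg_eq_0_iff_AE)
    then have "AE x in M. f x * g x = 0" by auto
    then have "(\<integral>x. f x * g x \<partial>M) = 0" by (rule integral_eq_zero_AE)
    then show ?thesis by simp
  next
    case False
    with FG have pos: "0 < F" "0 < G" by auto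
    \<comment> \<open>The scaling for which the two terms of Young's inequality agree.\<close>
    define t where "t = F powr (- 1 / (p * p')) * G powr (1 / (p * p'))"
    have t: "t > 0" using pos by (simp add: t_def)
    have e1: "1 - 1/p' = 1/p" "1 - 1/p = 1/p'" using pq by auto
    have tp: "t powr p * F = F powr (1/p) * G powr (1/p')"
    proof -
      have "t powr p = F powr (- 1 / p') * G powr (1 / p')" using pq by (simp add: t_def powr_mult powr_powr)
      then have "t powr p * F = F powr (- 1/p' + 1) * G powr (1/p')"
        using pos powr_add[of F "- 1/p'" 1] by simp
      also have "- 1/p' + 1 = 1/p" using e1 by simp
      finally show ?thesis .
    qed
    have tp': "t powr (- p') * G = F powr (1/p) * G powr (1/p')"
    proof -
      have "t powr (- p') = F powr (1 / p) * G powr (- 1 / p)" using pq by (simp add: t_def powr_mult powr_powr)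
      then have "t powr (- p') * G = F powr (1/p) * G powr (- 1/p + 1)"
        using pos powr_add[of G "- 1/p" 1] by simp
      also have "- 1/p + 1 = 1/p'" using e1 by simp
      finally show ?thesis .
    qed
    have "(\<integral>x. f x * g x \<partial>M) \<le> (\<integral>x. t powr p * f x powr p / p + t powr (- p') * g x powr p' / p' \<partial>M)"
    proof (rule integral_mono[OF i])
      fix x
      have "f x * g x = (t * f x) * (g x / t)" using t by simp
      also have "\<dots> \<le> (t * f x) powr p / p + (g x / t) powr p' / p'"
        by (rule Youngs_inequality) (use pq nn t in auto)
      also have "\<dots> = t powr p * f x powr p / p + t powr (- p') * g x powr p' / p'"
        using t by (simp add: powr_mult powr_divide powr_minus field_simps)
      finally show "f x * g x \<le> \<dots>" .
    qed (use fi gi in auto)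
    also have "\<dots> = (t powr p * F) / p + (t powr (- p') * G) / p'"
      using fi gi by (simp add: F_def G_def)
    also have "\<dots> = F powr (1/p) * G powr (1/p') * (1/p + 1/p')" unfolding tp tp' by (simp add: algebra_simps)
    also have "\<dots> = F powr (1/p) * G powr (1/p')" using pq by simp
    finally show ?thesis by (simp add: F_def G_def)
  qed
qed

lemma (in prob_space) integral_powr_mono:
  fixes f :: "'a \<Rightarrow> real"
  assumes a: "0 < a" "a \<le> b" and [measurable]: "f \<in> borel_measurable M" and nn: "\<And>x. 0 \<le> f x"
    and i: "integrable M (\<lambda>x. f x powr b)"
  shows "integrable M (\<lambda>x. f x powr a)"
    and "(\<integral>x. f x powr a \<partial>M) \<le> (\<integral>x. f x powr b \<partial>M) powr (a / b)"
proof -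
  have "integrable M (\<lambda>x. f x powr a) \<and> (\<integral>x. f x powr a \<partial>M) \<le> (\<integral>x. f x powr b \<partial>M) powr (a / b)"
  proof (cases "a = b")
    case True
    then show ?thesis using i a by simp
  next
    case False
    then have ab: "a < b" using a by simp
    have "1/(b/a) + 1/(b/(b-a)) = 1" using a ab by (simp add: field_simps)
    then have "integrable M (\<lambda>x. f x powr a * 1)"
      "(\<integral>x. f x powr a * 1 \<partial>M) \<le> (\<integral>x. (f x powr a) powr (b/a) \<partial>M) powr (1/(b/a)) * (\<integral>x. 1 powr (b/(b-a)) \<partial>M) powr (1/(b/(b-a)))"
      using a ab i integral_hoelder[of "b/a" "b/(b-a)" "\<lambda>x. f x powr a" M "\<lambda>x. 1"]
      by (simp_all add: powr_powr)
    then show ?thesis using a by (simp add: powr_powr prob_space)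
  qed
  then show "integrable M (\<lambda>x. f x powr a)" "(\<integral>x. f x powr a \<partial>M) \<le> (\<integral>x. f x powr b \<partial>M) powr (a / b)" by auto
qed

lemma vec_box_eq_image:
  "{k :: 'a^'d::finite. \<forall>j. k $ j \<in> A} = vec_lambda ` PiE UNIV (\<lambda>_. A)"
proof safe
  fix k :: "'a^'d" assume "\<forall>j. k $ j \<in> A"
  then have "k = vec_lambda (\<lambda>j. k $ j)" "(\<lambda>j. k $ j) \<in> PiE UNIV (\<lambda>_. A)" by auto
  then show "k \<in> vec_lambda ` PiE UNIV (\<lambda>_. A)" by blast
qed auto

lemma finite_vec_box: "finite A \<Longrightarrow> finite {k :: 'a^'d::finite. \<forall>j. k $ j \<in> A}"
  unfolding vec_box_eq_image by (intro finite_imageI finite_PiE) auto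

definition cube_freqs :: "nat \<Rightarrow> (int^'d::finite) set" where
  "cube_freqs n = {k. \<forall>j. \<bar>k $ j\<bar> < 2 ^ n}"

lemma finite_cube_freqs: "finite (cube_freqs n :: (int^'d::finite) set)"
proof (rule finite_subset)
  show "cube_freqs n \<subseteq> {k :: int^'d. \<forall>j. k $ j \<in> {- (2^n)..2^n}}"
  proof
    fix k :: "int^'d" assume "k \<in> cube_freqs n"
    then have "\<bar>k $ j\<bar> < 2 ^ n" for j by (simp add: cube_freqs_def)
    then have "- (2^n) \<le> k $ j \<and> k $ j \<le> 2^n" for j by (smt (verit))
    then show "k \<in> {k :: int^'d. \<forall>j. k $ j \<in> {- (2^n)..2^n}}" by simp
  qed
qed (rule finite_vec_box, simp)

lemma cube_freqs_mono: "m \<le> n \<Longrightarrow> cube_freqs m \<subseteq> cube_freqs n"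
  unfolding cube_freqs_def by (auto intro: less_le_trans power_increasing)

lemma cube_freqs_exhaust: "\<exists>N. k \<in> cube_freqs N"
proof
  have "\<bar>k $ j\<bar> < 2 ^ (nat (\<Sum>j\<in>UNIV. \<bar>k $ j\<bar>))" for j
  proof -
    have "\<bar>k $ j\<bar> \<le> (\<Sum>j\<in>UNIV. \<bar>k $ j\<bar>)" by (rule member_le_sum) auto
    also have "\<dots> = int (nat (\<Sum>j\<in>UNIV. \<bar>k $ j\<bar>))" by (simp add: sum_nonneg)
    also have "\<dots> < 2 ^ (nat (\<Sum>j\<in>UNIV. \<bar>k $ j\<bar>))" by (metis less_exp of_nat_less_iff of_nat_numeral of_nat_power)
    finally show ?thesis .
  qed
  then show "k \<in> cube_freqs (nat (\<Sum>j\<in>UNIV. \<bar>k $ j\<bar>))" by (simp add: cube_freqs_def)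
qed

lemma Wt_ge_1: "1 \<le> Wt k"
  unfolding Wt_def by (rule prod_ge_1) (simp add: wt_ge_1)

lemma Wt_outside_cube:
  assumes "k \<notin> cube_freqs n"
  shows "2 ^ n \<le> Wt k"
proof -
  from assms obtain j where j: "2 ^ n \<le> \<bar>k $ j\<bar>" by (auto simp: cube_freqs_def not_less)
  have "(2::real) ^ n \<le> wt (k $ j)"
  proof -
    have "real_of_int (2 ^ n) \<le> real_of_int \<bar>k $ j\<bar>" using j by (simp only: of_int_le_iff)
    also have "\<dots> \<le> wt (k $ j)" unfolding wt_def by simp
    finally show ?thesis by simp
  qed
  also have "\<dots> = (\<Prod>i\<in>{j}. wt (k $ i))" by simp
  also have "\<dots> \<le> Wt k"
    unfolding Wt_def by (rule prod_mono2) (auto simp: wt_ge_1 intro: order_trans[OF zero_le_one wt_ge_1])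
  finally show ?thesis .
qed

lemma sum_product_box:
  fixes g :: "int \<Rightarrow> real"
  assumes "finite A"
  shows "(\<Sum>k\<in>{k::int^'d::finite. \<forall>j. k $ j \<in> A}. \<Prod>j\<in>UNIV. g (k $ j)) = (\<Sum>n\<in>A. g n) ^ CARD('d)"
proof -
  have "(\<Sum>k\<in>{k::int^'d. \<forall>j. k $ j \<in> A}. \<Prod>j\<in>UNIV. g (k $ j)) = (\<Sum>k\<in>PiE (UNIV::'d set) (\<lambda>_. A). \<Prod>j\<in>UNIV. g (k j))"
    by (simp add: vec_box_eq_image sum.reindex inj_on_def vec_eq_iff fun_eq_iff)
  also have "\<dots> = (\<Prod>j\<in>(UNIV::'d set). \<Sum>n\<in>A. g n)"
    using assms by (subst prod_sum_PiE) auto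
  finally show ?thesis by simp
qed

lemma sum_inverse_wt_le: "(\<Sum>n\<in>{n. \<bar>n\<bar> < 2 ^ N}. 1 / wt n) \<le> 3 * real (N + 1)"
proof (induction N)
  case 0
  have "{n::int. \<bar>n\<bar> < 1} = {0}" by auto
  then show ?case by (simp add: wt_def)
next
  case (Suc N)
  have fin: "finite {n::int. \<bar>n\<bar> < 2 ^ N}" for N
    by (rule finite_subset[of _ "{- (2^N)..2^N}"]) auto
  have S: "{n::int. \<bar>n\<bar> < 2 ^ Suc N} = {n. \<bar>n\<bar> < 2 ^ N} \<union> ({2^N..<2^Suc N} \<union> {-(2^Suc N)<..-(2^N)})" by auto
  have "(\<Sum>n\<in>({2^N..<2^Suc N} \<union> {-(2^Suc N)<..-(2^N)}). 1 / wt n) \<le> (\<Sum>n\<in>({2^N..<2^Suc N} \<union> {-(2^Suc N)<..-((2::int)^N)}). 1 / 2^N)"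
  proof (rule sum_mono)
    fix n :: int assume "n \<in> {2^N..<2^Suc N} \<union> {-(2^Suc N)<..-(2^N)}"
    then have "2 ^ N \<le> \<bar>n\<bar>" by auto
    then have "real_of_int (2 ^ N) \<le> real_of_int \<bar>n\<bar>" by (simp only: of_int_le_iff)
    also have "\<dots> \<le> wt n" unfolding wt_def by simp
    finally have "2 ^ N \<le> wt n" by simp
    then show "1 / wt n \<le> 1 / 2 ^ N" using wt_ge_1[of n] by (intro divide_left_mono) auto
  qed
  also have "\<dots> \<le> 2"
  proof -
    have "card ({2^N..<2^Suc N} \<union> {-(2^Suc N)<..-((2::int)^N)}) \<le> 2 ^ N + 2 ^ N"
      by (rule order_trans[OF card_Un_le]) (simp add: nat_power_eq)
    then have "real (card ({2^N..<2^Suc N} \<union> {-(2^Suc N)<..-((2::int)^N)})) \<le> real (2 ^ N + 2 ^ N)"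
      by (simp only: of_nat_le_iff)
    then show ?thesis by (simp add: field_simps)
  qed
  finally have "(\<Sum>n\<in>({2^N..<2^Suc N} \<union> {-(2^Suc N)<..-(2^N)}). 1 / wt n) \<le> 2" .
  then show ?case using Suc unfolding S
    by (subst sum.union_disjoint) (auto simp: fin)
qed

lemma sum_inverse_Wt_le: "(\<Sum>k\<in>cube_freqs N. 1 / Wt (k :: int^'d::finite)) \<le> (3 * real (N + 1)) ^ CARD('d)"
proof -
  have fin: "finite {n::int. \<bar>n\<bar> < 2 ^ N}"
    by (rule finite_subset[of _ "{- (2^N)..2^N}"]) auto
  have "(\<Sum>k\<in>cube_freqs N. 1 / Wt (k :: int^'d)) = (\<Sum>k\<in>{k::int^'d. \<forall>j. k $ j \<in> {n. \<bar>n\<bar> < 2 ^ N}}. \<Prod>j\<in>UNIV. 1 / wt (k $ j))"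
    by (simp add: cube_freqs_def Wt_def prod_dividef)
  also have "\<dots> = (\<Sum>n\<in>{n. \<bar>n\<bar> < 2 ^ N}. 1 / wt n) ^ CARD('d)" by (rule sum_product_box[OF fin])
  also have "\<dots> \<le> (3 * real (N + 1)) ^ CARD('d)"
    by (intro power_mono sum_inverse_wt_le sum_nonneg) (auto intro: order_trans[OF zero_le_one wt_ge_1])
  finally show ?thesis .
qed

text \<open>With \<open>q'\<close> conjugate to \<open>q\<close>, the product \<open>W powr (-1/q) |\<phi>^|\<close> splits as
  \<open>(W powr ((q - 2)/q) |\<phi>^|) * W powr (-1/q')\<close>: the first factor is controlled in \<open>\<ell>_q\<close> by the
  Hardy-Littlewood inequality, and the sum of \<open>1 / W\<close> over the cube is at most of order
  \<open>N powr d\<close>.  For the square sums the same inequality is used with \<open>|\<phi>^|^2 \<le> 2 |\<phi>^| powr q\<close>, and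
  what remains is the power \<open>W powr (-(2/q + q - 2))\<close> with a negative exponent.\<close>

lemma W_class_fourier:
  assumes q: "1 < q" "q \<le> 2"
  obtains C where "0 < C" and "\<And>f :: 'd::finite tfun. f \<in> W_class (1/q) q \<Longrightarrow> integrable torus f"
    and "\<And>(f :: 'd tfun) N. f \<in> W_class (1/q) q \<Longrightarrow> (\<Sum>k\<in>cube_freqs N. cmod (fourier f k)) \<le> C * (real (N + 1)) powr (CARD('d) * (1 - 1/q))"
    and "\<And>(f :: 'd tfun) N K. f \<in> W_class (1/q) q \<Longrightarrow> finite K \<Longrightarrow> K \<inter> cube_freqs N = {} \<Longrightarrow>
       (\<Sum>k\<in>K. (cmod (fourier f k))\<^sup>2) \<le> C * (2 powr - (2/q + q - 2)) ^ N"
proof -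
  obtain C where C: "0 < C" and HL: "\<And>(f :: 'd::finite tfun) K. f \<in> borel_measurable borel \<Longrightarrow>
      integrable torus (\<lambda>x. cmod (f x) powr q) \<Longrightarrow> finite K \<Longrightarrow>
     (\<Sum>k\<in>K. Wt k powr (q - 2) * cmod (fourier f k) powr q) \<le> C * (\<integral>x. cmod (f x) powr q \<partial>torus)"
    using hardy_littlewood[OF q] by blast
  have r: "0 < 1/q" "1/q < 1" using q by auto
  have main: "integrable torus f \<and> (\<exists>\<phi> :: 'd tfun. (\<forall>k. cmod (fourier f k) = Wt k powr (- 1/q) * cmod (fourier \<phi> k)) \<and>
      (\<forall>k. cmod (fourier \<phi> k) \<le> 2) \<and> (\<forall>K. finite K \<longrightarrow> (\<Sum>k\<in>K. Wt k powr (q - 2) * cmod (fourier \<phi> k) powr q) \<le> C))"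
    if f: "f \<in> W_class (1/q) q" for f :: "'d tfun"
  proof -
    from f obtain \<phi> where fm [measurable]: "f \<in> borel_measurable borel" and \<phi>: "Lp_norm q \<phi> \<le> 1"
      and ae: "AE x in torus. f x = convolution \<phi> (F_kernel_mixed (1/q)) x"
      by (auto simp: W_class_def)
    have \<phi>L: "\<phi> \<in> Lp q" using \<phi> by (auto simp: Lp_norm_def top_unique split: if_splits)
    then have [measurable]: "\<phi> \<in> borel_measurable borel" and \<phi>q: "integrable torus (\<lambda>x. cmod (\<phi> x) powr q)"
      by (auto simp: Lp_def)
    have "(\<integral>x. cmod (\<phi> x) powr q \<partial>torus) powr (1/q) \<le> 1"
      using \<phi> \<phi>L by (simp add: Lp_norm_def)
    then have \<phi>1: "(\<integral>x. cmod (\<phi> x) powr q \<partial>torus) \<le> 1"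
      using gr_one_powr[of "\<integral>x. cmod (\<phi> x) powr q \<partial>torus" "1/q"] q by (meson not_le divide_pos_pos less_trans zero_less_one)
    have \<phi>i: "integrable torus \<phi>" using characters.integrable_of_powr[of \<phi> q] q \<phi>q by simp
    note conv = fourier_convolution[OF r \<phi>i]
    have fi: "integrable torus f"
      using conv(1) ae by (subst integrable_cong_AE[of _ _ "convolution \<phi> (F_kernel_mixed (1/q))"]) (auto dest: borel_measurable_integrable)
    have four: "fourier f k = fourier \<phi> k * (\<Prod>j\<in>UNIV. F_coeff (1/q) (k $ j))" for k
    proof -
      have "fourier f k = fourier (convolution \<phi> (F_kernel_mixed (1/q))) k"
        unfolding fourier_def
        by (rule integral_cong_AE) (use ae borel_measurable_integrable[OF conv(1)] in auto)
      then show ?thesis using conv(2) by simp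
    qed
    have "cmod (fourier f k) = Wt k powr (- 1/q) * cmod (fourier \<phi> k)" for k
    proof -
      have "cmod (\<Prod>j\<in>UNIV. F_coeff (1/q) (k $ j)) = (\<Prod>j\<in>UNIV. wt (k $ j) powr (- 1/q))"
        by (simp add: prod_norm[symmetric] norm_F_coeff wt_def)
      also have "\<dots> = Wt k powr (- 1/q)"
        unfolding Wt_def by (rule prod_powr_distrib[symmetric])
      finally show ?thesis unfolding four by (simp add: norm_mult)
    qed
    moreover have "cmod (fourier \<phi> k) \<le> 2" for k
    proof -
      have "cmod (fourier \<phi> k) \<le> (\<integral>x. cmod (\<phi> x) \<partial>torus)"
        unfolding fourier_def by (rule characters.norm_coeff_le[OF \<phi>i])
      also have "\<dots> \<le> (\<integral>x. 1 + cmod (\<phi> x) powr q \<partial>torus)"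
      proof (rule integral_mono)
        show "cmod (\<phi> x) \<le> 1 + cmod (\<phi> x) powr q" for x using q by (intro le_one_plus_powr) auto
      qed (use \<phi>i \<phi>q in auto)
      also have "\<dots> = 1 + (\<integral>x. cmod (\<phi> x) powr q \<partial>torus)" using \<phi>q torus.prob_space by simp
      also have "\<dots> \<le> 2" using \<phi>1 by simp
      finally show ?thesis .
    qed
    moreover have "(\<Sum>k\<in>K. Wt k powr (q - 2) * cmod (fourier \<phi> k) powr q) \<le> C" if "finite K" for K
    proof -
      have "(\<Sum>k\<in>K. Wt k powr (q - 2) * cmod (fourier \<phi> k) powr q) \<le> C * (\<integral>x. cmod (\<phi> x) powr q \<partial>torus)"
        by (rule HL) (use \<phi>q that in auto)
      also have "\<dots> \<le> C * 1" using C \<phi>1 by (intro mult_left_mono) auto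
      finally show ?thesis by simp
    qed
    ultimately show ?thesis using fi by blast
  qed
  define q' where "q' = q / (q - 1)"
  have q': "1 < q'" "1/q + 1/q' = 1" "1/q' = 1 - 1/q" using q by (auto simp: q'_def field_simps)
  define C' where "C' = max ((C + 1) * 3 powr (real CARD('d) * (1 - 1/q))) (2 * C)"
  show thesis
  proof (rule that[of C'])
    show "0 < C'" using C by (simp add: C'_def)
    show "integrable torus f" if "f \<in> W_class (1/q) q" for f :: "'d tfun" using main[OF that] by blast
    show "(\<Sum>k\<in>cube_freqs N. cmod (fourier f k)) \<le> C' * (real (N + 1)) powr (CARD('d) * (1 - 1/q))"
      if f: "f \<in> W_class (1/q) q" for f :: "'d tfun" and N
    proof -
      obtain \<phi> :: "'d tfun" where \<phi>: "\<And>k. cmod (fourier f k) = Wt k powr (- 1/q) * cmod (fourier \<phi> k)"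
         "\<And>K. finite K \<Longrightarrow> (\<Sum>k\<in>K. Wt k powr (q - 2) * cmod (fourier \<phi> k) powr q) \<le> C"
        using main[OF f] by blast
      define B where "B = (3 * real (N + 1)) ^ CARD('d)"
      have B: "B > 0" by (simp add: B_def)
      \<comment> \<open>The scaling that balances the two sums after Young's inequality.\<close>
      define t where "t = B powr (1 / (q * q'))"
      have t: "t > 0" using B by (simp add: t_def)
      have tq: "t powr q = B powr (1/q')" "t powr (- q') * B = B powr (1/q')"
      proof -
        show "t powr q = B powr (1/q')" using q by (simp add: t_def powr_powr)
        have "t powr (- q') * B = B powr (- 1/q + 1)" using q q' B powr_add[of B "- 1/q" 1] by (simp add: t_def powr_powr)
        also have "- 1/q + 1 = 1/q'" using q' by simp
        finally show "t powr (- q') * B = B powr (1/q')" .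
      qed
      have "(\<Sum>k\<in>cube_freqs N. cmod (fourier f k)) \<le> (\<Sum>k\<in>cube_freqs N. t powr q * (Wt k powr (q - 2) * cmod (fourier \<phi> k) powr q) + t powr (- q') * (1 / Wt k))"
      proof (rule sum_mono)
        fix k :: "int^'d"
        have W: "0 < Wt k" using Wt_ge_1[of k] by linarith
        define a where "a = t * (Wt k powr ((q - 2)/q) * cmod (fourier \<phi> k))"
        define b where "b = Wt k powr (- 1/q') / t"
        have "cmod (fourier f k) = a * b"
        proof -
          have "Wt k powr ((q - 2)/q) * Wt k powr (- 1/q') = Wt k powr (- 1/q)"
            using q unfolding powr_add[symmetric] by (intro arg_cong[of _ _ "\<lambda>e. Wt k powr e"]) (simp add: q'_def field_simps)
          then show ?thesis using t by (simp add: \<phi>(1) a_def b_def)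
        qed
        also have "\<dots> \<le> a powr q / q + b powr q' / q'"
          by (rule Youngs_inequality) (use q q' t in \<open>auto simp: a_def b_def\<close>)
        also have "\<dots> \<le> a powr q + b powr q'"
          using q q' divide_left_mono[of 1 q "a powr q"] divide_left_mono[of 1 q' "b powr q'"] by simp
        also have "a powr q = t powr q * (Wt k powr (q - 2) * cmod (fourier \<phi> k) powr q)"
          using q t by (simp add: a_def powr_mult powr_powr)
        also have "b powr q' = Wt k powr (- 1) / t powr q'"
          using q'(1) by (simp add: b_def powr_divide powr_powr)
        also have "\<dots> = t powr (- q') * (1 / Wt k)"
          using W by (simp add: powr_minus divide_inverse mult.commute)
        finally show "cmod (fourier f k) \<le> t powr q * (Wt k powr (q - 2) * cmod (fourier \<phi> k) powr q) + t powr (- q') * (1 / Wt k)" .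
      qed
      also have "\<dots> = t powr q * (\<Sum>k\<in>cube_freqs N. Wt k powr (q - 2) * cmod (fourier \<phi> k) powr q) + t powr (- q') * (\<Sum>k\<in>cube_freqs N. 1 / Wt (k::int^'d))"
        by (simp only: sum.distrib sum_distrib_left)
      also have "\<dots> \<le> t powr q * C + t powr (- q') * B"
        unfolding B_def by (intro add_mono mult_left_mono \<phi>(2) finite_cube_freqs sum_inverse_Wt_le) auto
      also have "\<dots> = (C + 1) * B powr (1/q')" unfolding tq by (simp add: algebra_simps)
      also have "B powr (1/q') = (3 * real (N + 1)) powr (real CARD('d) * (1 - 1/q))"
        unfolding B_def q' by (simp add: powr_realpow[symmetric] powr_powr)
      also have "\<dots> = 3 powr (real CARD('d) * (1 - 1/q)) * (real (N + 1)) powr (CARD('d) * (1 - 1/q))"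
        by (rule powr_mult)
      finally have "(\<Sum>k\<in>cube_freqs N. cmod (fourier f k)) \<le> ((C + 1) * 3 powr (real CARD('d) * (1 - 1/q))) * (real (N + 1)) powr (CARD('d) * (1 - 1/q))"
        by (simp add: mult.assoc)
      also have "\<dots> \<le> C' * (real (N + 1)) powr (CARD('d) * (1 - 1/q))"
        by (intro mult_right_mono) (auto simp: C'_def)
      finally show ?thesis .
    qed
    show "(\<Sum>k\<in>K. (cmod (fourier f k))\<^sup>2) \<le> C' * (2 powr - (2/q + q - 2)) ^ N"
      if f: "f \<in> W_class (1/q) q" and K: "finite K" "K \<inter> cube_freqs N = {}" for f :: "'d tfun" and N K
    proof -
      obtain \<phi> :: "'d tfun" where \<phi>: "\<And>k. cmod (fourier f k) = Wt k powr (- 1/q) * cmod (fourier \<phi> k)"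
         "\<And>k. cmod (fourier \<phi> k) \<le> 2"
         "\<And>K. finite K \<Longrightarrow> (\<Sum>k\<in>K. Wt k powr (q - 2) * cmod (fourier \<phi> k) powr q) \<le> C"
        using main[OF f] by blast
      have th: "2/q + q - 2 > 0"
      proof -
        have "2/q + q - 2 = ((q - 1)\<^sup>2 + 1) / q" using q by (simp add: field_simps power2_eq_square)
        then show ?thesis using q by (simp add: add_nonneg_pos)
      qed
      have "(\<Sum>k\<in>K. (cmod (fourier f k))\<^sup>2) \<le> (\<Sum>k\<in>K. 2 * (2 powr - (2/q + q - 2)) ^ N * (Wt k powr (q - 2) * cmod (fourier \<phi> k) powr q))"
      proof (rule sum_mono)
        fix k assume "k \<in> K"
        then have W: "2 ^ N \<le> Wt k" using K by (intro Wt_outside_cube) auto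
        then have W0: "0 < Wt k" using Wt_ge_1[of k] by linarith
        have a: "(cmod (fourier \<phi> k))\<^sup>2 \<le> 2 * cmod (fourier \<phi> k) powr q"
        proof (cases "cmod (fourier \<phi> k) = 0")
          case False
          then have "(cmod (fourier \<phi> k))\<^sup>2 = cmod (fourier \<phi> k) powr (2 - q) * cmod (fourier \<phi> k) powr q"
            by (simp add: powr_add[symmetric] powr_numeral)
          moreover have "cmod (fourier \<phi> k) powr (2 - q) \<le> 2"
          proof -
            have "cmod (fourier \<phi> k) powr (2 - q) \<le> 2 powr (2 - q)"
              using q \<phi>(2) by (intro powr_mono2) auto
            also have "\<dots> \<le> 2 powr 1" using q by (intro powr_mono) auto
            finally show ?thesis by simp
          qed
          ultimately show ?thesis by (simp add: mult_right_mono)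
        qed auto
        have b: "Wt k powr (- (2/q + q - 2)) \<le> (2 powr - (2/q + q - 2)) ^ N"
        proof -
          have "Wt k powr (- (2/q + q - 2)) \<le> (2 ^ N) powr (- (2/q + q - 2))"
            using W th by (intro powr_mono2') auto
          also have "\<dots> = (2 powr - (2/q + q - 2)) ^ N"
            by (simp add: powr_realpow[symmetric] powr_powr mult.commute)
          finally show ?thesis .
        qed
        have "(cmod (fourier f k))\<^sup>2 = Wt k powr (- 2/q) * (cmod (fourier \<phi> k))\<^sup>2"
          using W0 by (simp add: \<phi>(1) power_mult_distrib powr_power)
        also have "Wt k powr (- 2/q) = Wt k powr (- (2/q + q - 2)) * Wt k powr (q - 2)"
          unfolding powr_add[symmetric] by simp
        also have "Wt k powr (- (2/q + q - 2)) * Wt k powr (q - 2) * (cmod (fourier \<phi> k))\<^sup>2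
          \<le> (2 powr - (2/q + q - 2)) ^ N * Wt k powr (q - 2) * (2 * cmod (fourier \<phi> k) powr q)"
          by (intro mult_mono a b) auto
        finally show "(cmod (fourier f k))\<^sup>2 \<le> 2 * (2 powr - (2/q + q - 2)) ^ N * (Wt k powr (q - 2) * cmod (fourier \<phi> k) powr q)"
          by (simp only: mult_ac)
      qed
      also have "\<dots> = 2 * (2 powr - (2/q + q - 2)) ^ N * (\<Sum>k\<in>K. Wt k powr (q - 2) * cmod (fourier \<phi> k) powr q)"
        by (simp only: sum_distrib_left)
      also have "\<dots> \<le> 2 * (2 powr - (2/q + q - 2)) ^ N * C"
        by (intro mult_left_mono \<phi>(3) K) auto
      also have "\<dots> = (2 * C) * (2 powr - (2/q + q - 2)) ^ N" by simp
      also have "\<dots> \<le> C' * (2 powr - (2/q + q - 2)) ^ N"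
        by (intro mult_right_mono) (auto simp: C'_def)
      finally show ?thesis .
    qed
  qed
qed

section \<open>Approximation by cube partial sums\<close>

definition cube_sum :: "nat \<Rightarrow> 'd::finite tfun \<Rightarrow> 'd tfun" where
  "cube_sum n f x = (\<Sum>k\<in>cube_freqs n. fourier f k * character k x)"

lemma measurable_cube_sum [measurable]: "cube_sum n f \<in> borel_measurable borel"
  unfolding cube_sum_def[abs_def] by measurable

lemma fourier_cube_sum: "fourier (cube_sum n f) k = (if k \<in> cube_freqs n then fourier f k else 0)"
  unfolding cube_sum_def[abs_def] by (rule fourier_poly[OF finite_cube_freqs])

lemma powr_times_geometric_bounded:
  fixes \<kappa> \<rho> :: real
  assumes "0 < \<rho>" "\<rho> < 1"
  obtains B where "0 < B" and "\<And>N. (real (Suc N) + 1) powr \<kappa> * \<rho> ^ N \<le> B"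
proof -
  have "(\<lambda>N. (real (Suc N) + 1) powr \<kappa> * \<rho> ^ N) \<longlonglongrightarrow> 0"
    using assms by real_asymp
  then have "Bseq (\<lambda>N. (real (Suc N) + 1) powr \<kappa> * \<rho> ^ N)" by (intro convergent_imp_Bseq) (auto simp: convergent_def)
  then obtain B where "0 < B" "\<And>N. norm ((real (Suc N) + 1) powr \<kappa> * \<rho> ^ N) \<le> B" by (auto simp: Bseq_def)
  then show thesis using that[of B] by (metis abs_le_D1 real_norm_def)
qed

text \<open>\<open>|u| powr p \<le> (sup |u|) powr (p - 2) |u|^2\<close>.\<close>

lemma sup_L2_interpolation:
  fixes u :: "'d::finite tfun"
  assumes [measurable]: "u \<in> borel_measurable borel" and p: "2 \<le> p"
    and S: "\<And>x. cmod (u x) \<le> S"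
  shows "integrable torus (\<lambda>x. cmod (u x) powr p)"
    and "(\<integral>x. cmod (u x) powr p \<partial>torus) \<le> S powr (p - 2) * (\<integral>x. (cmod (u x))\<^sup>2 \<partial>torus)"
proof -
  have S0: "0 \<le> S" using S[of undefined] norm_ge_zero order_trans by blast
  have b: "cmod (u x) powr p \<le> S powr (p - 2) * (cmod (u x))\<^sup>2" for x
  proof (cases "u x = 0")
    case False
    then have "cmod (u x) powr p = cmod (u x) powr (p - 2) * (cmod (u x))\<^sup>2"
      by (simp add: powr_diff powr_numeral)
    then show ?thesis using S p by (auto intro!: mult_right_mono powr_mono2)
  qed auto
  show i: "integrable torus (\<lambda>x. cmod (u x) powr p)"
    by (rule torus.integrable_const_bound[of _ "S powr p"]) (use S p in \<open>auto intro!: powr_mono2\<close>)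
  have i2: "integrable torus (\<lambda>x. (cmod (u x))\<^sup>2)"
    by (rule torus.integrable_const_bound[of _ "S\<^sup>2"]) (use S in \<open>auto intro!: power_mono\<close>)
  have "(\<integral>x. cmod (u x) powr p \<partial>torus) \<le> (\<integral>x. S powr (p - 2) * (cmod (u x))\<^sup>2 \<partial>torus)"
    by (rule integral_mono) (use i i2 b in auto)
  then show "(\<integral>x. cmod (u x) powr p \<partial>torus) \<le> S powr (p - 2) * (\<integral>x. (cmod (u x))\<^sup>2 \<partial>torus)" by simp
qed

text \<open>The blocks \<open>D j\<close> are divided by geometrically decreasing weights \<open>l ^ j\<close> that decay so slowly that the
  sum \<open>E\<close> of the \<open>p\<close>-th powers is still integrable.  Where \<open>E\<close> is finite, \<open>|D j| \<le> E powr (1/p) * l ^ j\<close>,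
  so the series of blocks converges absolutely with sum at most \<open>E powr (1/p) / (1 - l)\<close>.  This
  bound also dominates the cube sums, and the uniqueness theorem identifies their limit
  with \<open>f\<close>.\<close>

lemma cube_sum_tail:
  fixes f :: "'d::finite tfun"
  assumes f: "integrable torus f" and p: "1 \<le> p" and \<rho>: "0 < \<rho>" "\<rho> < 1" and C: "0 \<le> C"
    and block: "\<And>N. integrable torus (\<lambda>x. cmod (cube_sum (Suc N) f x - cube_sum N f x) powr p)"
      "\<And>N. (\<integral>x. cmod (cube_sum (Suc N) f x - cube_sum N f x) powr p \<partial>torus) \<le> C * \<rho> ^ N"
  shows "integrable torus (\<lambda>x. cmod (f x - cube_sum n f x) powr p)"
    and "(\<integral>x. cmod (f x - cube_sum n f x) powr p \<partial>torus)
          \<le> C / ((1 - \<rho> powr (1 / (2 * p))) powr p * (1 - \<rho> powr (1/2))) * \<rho> ^ n"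
proof -
  have [measurable]: "f \<in> borel_measurable borel" using borel_measurable_integrable[OF f] by simp
  \<comment> \<open>With this choice \<open>l powr p = sqrt \<rho>\<close>, so that half of the decay remains for the sum of the integrals.\<close>
  define l where "l = \<rho> powr (1 / (2 * p))"
  have l: "0 < l" "l < 1" using \<rho> p powr_less_mono2[of "1/(2*p)" \<rho> 1] by (auto simp: l_def)
  define s where "s = \<rho> powr (1/2)"
  have s: "0 < s" "s < 1" "s * s = \<rho>" using \<rho> powr_less_mono2[of "1/2" \<rho> 1] by (auto simp: s_def powr_add[symmetric])
  have lp: "l powr p = s" using p \<rho> by (simp add: l_def s_def powr_powr)
  define D where "D j x = cube_sum (n + Suc j) f x - cube_sum (n + j) f x" for j x
  have [measurable]: "D j \<in> borel_measurable borel" for j unfolding D_def[abs_def] by measurable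
  define E where "E x = (\<Sum>j. ennreal ((cmod (D j x) / l ^ j) powr p))" for x
  have [measurable]: "E \<in> borel_measurable borel" unfolding E_def[abs_def] by measurable
  have tm: "(\<integral>\<^sup>+x. ennreal ((cmod (D j x) / l ^ j) powr p) \<partial>torus) \<le> ennreal (C * \<rho> ^ n * s ^ j)" for j
  proof -
    have e: "(cmod (D j x) / l ^ j) powr p = (1 / s ^ j) * cmod (D j x) powr p" for x
      using l by (simp add: powr_divide powr_realpow[symmetric] powr_powr lp[symmetric] mult.commute)
    have "(\<integral>\<^sup>+x. ennreal ((cmod (D j x) / l ^ j) powr p) \<partial>torus) = ennreal (\<integral>x. (1 / s ^ j) * cmod (D j x) powr p \<partial>torus)"
      unfolding e by (rule nn_integral_eq_integral) (use block(1)[of "n + j"] s in \<open>auto simp: D_def\<close>)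
    also have "(\<integral>x. (1 / s ^ j) * cmod (D j x) powr p \<partial>torus) \<le> (1 / s ^ j) * (C * \<rho> ^ (n + j))"
      using block(2)[of "n + j"] s by (simp add: D_def divide_right_mono)
    also have "\<dots> = C * \<rho> ^ n * s ^ j"
      using s by (simp add: power_add s(3)[symmetric] power_mult_distrib)
    finally show ?thesis by (simp add: ennreal_leI)
  qed
  have sums: "(\<lambda>j. C * \<rho> ^ n * s ^ j) sums (C * \<rho> ^ n / (1 - s))"
    using sums_mult[OF geometric_sums[of s], of "C * \<rho> ^ n"] s by simp
  have "(\<integral>\<^sup>+x. E x \<partial>torus) = (\<Sum>j. \<integral>\<^sup>+x. ennreal ((cmod (D j x) / l ^ j) powr p) \<partial>torus)"
    unfolding E_def by (rule nn_integral_suminf) measurable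
  also have "\<dots> \<le> (\<Sum>j. ennreal (C * \<rho> ^ n * s ^ j))" by (intro suminf_le tm) auto
  also have "\<dots> = ennreal (C * \<rho> ^ n / (1 - s))"
    using sums C \<rho> s by (subst suminf_ennreal2) (auto simp: sums_iff)
  finally have nnE: "(\<integral>\<^sup>+x. E x \<partial>torus) \<le> ennreal (C * \<rho> ^ n / (1 - s))" .
  then have finE: "AE x in torus. E x \<noteq> \<infinity>"
    by (intro nn_integral_PInf_AE) (auto simp: less_top[symmetric] top_unique)
  define R where "R x = enn2real (E x)" for x
  have [measurable]: "R \<in> borel_measurable borel" unfolding R_def[abs_def] by measurable
  have RE: "AE x in torus. ennreal (R x) = E x" using finE by eventually_elim (simp add: R_def less_top)
  have nnR: "(\<integral>\<^sup>+x. ennreal (R x) \<partial>torus) \<le> ennreal (C * \<rho> ^ n / (1 - s))"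
    using nnE by (subst nn_integral_cong_AE[OF RE])
  have R0: "0 \<le> R x" for x by (simp add: R_def)
  have Ri: "integrable torus R"
    by (rule integrableI_nonneg) (use R0 nnR in \<open>auto simp: less_top[symmetric] top_unique\<close>)
  have Rint: "(\<integral>x. R x \<partial>torus) \<le> C * \<rho> ^ n / (1 - s)"
    using nnR nn_integral_eq_integral[OF Ri] R0 C \<rho> s by (simp add: ennreal_le_iff)
  define H where "H x = R x powr (1/p) / (1 - l)" for x
  have Dle: "AE x in torus. \<forall>j. cmod (D j x) \<le> R x powr (1/p) * l ^ j"
    using RE
  proof eventually_elim
    case (elim x)
    show ?case
    proof
      fix j
      have "ennreal ((cmod (D j x) / l ^ j) powr p) \<le> E x"
        unfolding E_def by (rule sum_le_suminf[of _ "{j}", simplified]) auto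
      then have "(cmod (D j x) / l ^ j) powr p \<le> R x" unfolding elim[symmetric] using R0 by (simp add: ennreal_le_iff)
      then have "((cmod (D j x) / l ^ j) powr p) powr (1/p) \<le> R x powr (1/p)"
        using p by (intro powr_mono2) auto
      then have "cmod (D j x) / l ^ j \<le> R x powr (1/p)" using p l by (simp add: powr_powr)
      then show "cmod (D j x) \<le> R x powr (1/p) * l ^ j" using l by (simp add: field_simps)
    qed
  qed
  have telescope: "cube_sum (n + m) f x = cube_sum n f x + (\<Sum>j<m. D j x)" for m x
    by (induction m) (auto simp: D_def)
  have part: "AE x in torus. (\<forall>m. cmod (cube_sum (n + m) f x - cube_sum n f x) \<le> H x) \<and> convergent (\<lambda>m. cube_sum (n + m) f x)"
    using Dle
  proof eventually_elim
    case (elim x)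
    have gs: "(\<lambda>j. R x powr (1/p) * l ^ j) sums H x"
      using sums_mult[OF geometric_sums[of l], of "R x powr (1/p)"] l by (simp add: H_def)
    have sm: "summable (\<lambda>j. D j x)"
      by (rule summable_comparison_test'[of "\<lambda>j. R x powr (1/p) * l ^ j"]) (use gs elim in \<open>auto simp: sums_iff\<close>)
    have "cmod (cube_sum (n + m) f x - cube_sum n f x) \<le> H x" for m
    proof -
      have "cmod (\<Sum>j<m. D j x) \<le> (\<Sum>j<m. R x powr (1/p) * l ^ j)"
        using elim by (intro sum_norm_le) auto
      also have "\<dots> \<le> (\<Sum>j. R x powr (1/p) * l ^ j)"
        using gs l by (intro sum_le_suminf) (auto simp: sums_iff)
      also have "\<dots> = H x" using gs by (simp add: sums_iff)
      finally show ?thesis by (simp add: telescope)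
    qed
    moreover have "convergent (\<lambda>m. cube_sum (n + m) f x)"
      unfolding telescope using summable_LIMSEQ[OF sm] by (intro convergentI[OF tendsto_add[OF tendsto_const]])
    ultimately show ?case by blast
  qed
  define L where "L x = lim (\<lambda>m. cube_sum (n + m) f x)" for x
  have [measurable]: "L \<in> borel_measurable borel" unfolding L_def[abs_def] by measurable
  have Lt: "AE x in torus. (\<lambda>m. cube_sum (n + m) f x) \<longlonglongrightarrow> L x"
    using part by eventually_elim (simp add: L_def convergent_LIMSEQ_iff)
  have Hi: "integrable torus H"
  proof (rule Bochner_Integration.integrable_bound[of _ "\<lambda>x. (1 + R x) / (1 - l)"])
    have "R x powr (1/p) \<le> 1 + R x" for x
    proof (cases "R x \<le> 1")
      case True
      then have "R x powr (1/p) \<le> 1 powr (1/p)" using R0 p by (intro powr_mono2) auto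
      then show ?thesis using R0[of x] by simp
    next
      case False
      then have "R x powr (1/p) \<le> R x powr 1" using p by (intro powr_mono) auto
      then show ?thesis using False by simp
    qed
    then show "AE x in torus. norm (H x) \<le> norm ((1 + R x) / (1 - l))"
      using l R0 by (auto simp: H_def intro!: divide_right_mono)
    show "H \<in> borel_measurable torus" unfolding H_def[abs_def] by measurable
  qed (use Ri in auto)
  define w where "w x = H x + cmod (cube_sum n f x)" for x
  have wi: "integrable torus w"
    unfolding w_def cube_sum_def using Hi characters.integrable_poly by (intro Bochner_Integration.integrable_add integrable_norm)
  have dom: "AE x in torus. norm (cube_sum (n + m) f x) \<le> w x" for m
    using part
  proof eventually_elim
    case (elim x)
    then have "cmod (cube_sum (n + m) f x - cube_sum n f x) \<le> H x" by blast
    then show ?case using norm_triangle_sub[of "cube_sum (n + m) f x" "cube_sum n f x"] by (simp add: w_def)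
  qed
  have Li: "integrable torus L"
    by (rule integrable_dominated_convergence[OF _ _ wi Lt dom]) auto
  have "AE x in torus. f x = L x"
  proof (rule fourier_unique[OF f Li])
    fix k
    have "(\<lambda>m. fourier (cube_sum (n + m) f) k) \<longlonglongrightarrow> fourier L k"
      unfolding fourier_def
    proof (rule integral_dominated_convergence[OF _ _ wi])
      show "AE x in torus. (\<lambda>m. cube_sum (n + m) f x * cnj (character k x)) \<longlonglongrightarrow> L x * cnj (character k x)"
        using Lt by eventually_elim (intro tendsto_intros)
      show "AE x in torus. norm (cube_sum (n + m) f x * cnj (character k x)) \<le> w x" for m
        using dom[of m] by (simp add: norm_mult)
    qed auto
    moreover obtain N where "k \<in> cube_freqs N" using cube_freqs_exhaust by blast
    then have "fourier (cube_sum (n + m) f) k = fourier f k" if "m \<ge> N" for m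
      using cube_freqs_mono[of N "n + m"] that by (auto simp: fourier_cube_sum)
    then have "(\<lambda>m. fourier (cube_sum (n + m) f) k) \<longlonglongrightarrow> fourier f k"
      by (intro tendsto_eventually) (auto simp: eventually_sequentially)
    ultimately show "fourier f k = fourier L k" using LIMSEQ_unique by blast
  qed
  then have le: "AE x in torus. cmod (f x - cube_sum n f x) powr p \<le> R x / (1 - l) powr p"
    using Lt part
  proof eventually_elim
    case (elim x)
    have "(\<lambda>m. cmod (cube_sum (n + m) f x - cube_sum n f x)) \<longlonglongrightarrow> cmod (L x - cube_sum n f x)"
      using elim by (intro tendsto_intros) auto
    then have "cmod (L x - cube_sum n f x) \<le> H x"
      by (rule LIMSEQ_le_const2) (use elim in auto)
    then have "cmod (f x - cube_sum n f x) powr p \<le> H x powr p"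
      using elim p by (intro powr_mono2) auto
    also have "\<dots> = R x / (1 - l) powr p" using p l R0 by (simp add: H_def powr_divide powr_powr)
    finally show ?case .
  qed
  show i: "integrable torus (\<lambda>x. cmod (f x - cube_sum n f x) powr p)"
    by (rule Bochner_Integration.integrable_bound[of _ "\<lambda>x. R x / (1 - l) powr p"])
       (use Ri R0 le in auto)
  have "(\<integral>x. cmod (f x - cube_sum n f x) powr p \<partial>torus) \<le> (\<integral>x. R x / (1 - l) powr p \<partial>torus)"
    by (rule integral_mono_AE) (use i Ri le in auto)
  also have "\<dots> \<le> (C * \<rho> ^ n / (1 - s)) / (1 - l) powr p"
    using divide_right_mono[OF Rint, of "(1 - l) powr p"] by simp
  also have "\<dots> = C / ((1 - \<rho> powr (1 / (2 * p))) powr p * (1 - \<rho> powr (1/2))) * \<rho> ^ n"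
    by (simp add: l_def s_def mult.commute)
  finally show "(\<integral>x. cmod (f x - cube_sum n f x) powr p \<partial>torus)
          \<le> C / ((1 - \<rho> powr (1 / (2 * p))) powr p * (1 - \<rho> powr (1/2))) * \<rho> ^ n" .
qed

lemma cube_sum_approximation:
  assumes q: "1 < q" "q \<le> 2" and p: "2 < p"
  obtains C \<rho> where "0 < C" "0 < \<rho>" "\<rho> < 1"
    and "\<And>(f :: 'd::finite tfun) N. f \<in> W_class (1/q) q \<Longrightarrow> integrable torus (\<lambda>x. cmod (f x - cube_sum N f x) powr p)"
    and "\<And>(f :: 'd tfun) N. f \<in> W_class (1/q) q \<Longrightarrow> (\<integral>x. cmod (f x - cube_sum N f x) powr p \<partial>torus) \<le> C * \<rho> ^ N"
    and "\<And>(f :: 'd tfun) N. f \<in> W_class (1/q) q \<Longrightarrow> (\<Sum>k\<in>cube_freqs N. cmod (fourier f k)) \<le> C * (real (N + 1)) powr (CARD('d) * (1 - 1/q))"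
proof -
  obtain C where C: "0 < C" and Wi: "\<And>f :: 'd::finite tfun. f \<in> W_class (1/q) q \<Longrightarrow> integrable torus f"
    and A: "\<And>(f :: 'd tfun) N. f \<in> W_class (1/q) q \<Longrightarrow> (\<Sum>k\<in>cube_freqs N. cmod (fourier f k)) \<le> C * (real (N + 1)) powr (CARD('d) * (1 - 1/q))"
    and L2: "\<And>(f :: 'd tfun) N K. f \<in> W_class (1/q) q \<Longrightarrow> finite K \<Longrightarrow> K \<inter> cube_freqs N = {} \<Longrightarrow>
       (\<Sum>k\<in>K. (cmod (fourier f k))\<^sup>2) \<le> C * (2 powr - (2/q + q - 2)) ^ N"
    using W_class_fourier[OF q] by blast
  define \<theta> where "\<theta> = 2/q + q - 2"
  have "\<theta> = ((q - 1)\<^sup>2 + 1) / q" using q by (simp add: \<theta>_def field_simps power2_eq_square)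
  then have \<theta>: "\<theta> > 0" using q by (simp add: add_nonneg_pos)
  define \<rho> where "\<rho> = 2 powr (- \<theta> / 2)"
  have \<rho>: "0 < \<rho>" "\<rho> < 1" using \<theta> powr_less_one[of 2 "- \<theta>/2"] by (auto simp: \<rho>_def)
  have \<rho>2: "2 powr - (2/q + q - 2) = \<rho> * \<rho>" by (simp add: \<rho>_def \<theta>_def powr_add[symmetric])
  define \<kappa> where "\<kappa> = CARD('d) * (1 - 1/q) * (p - 2)"
  obtain B where B: "0 < B" "\<And>N. (real (Suc N) + 1) powr \<kappa> * \<rho> ^ N \<le> B"
    using powr_times_geometric_bounded[OF \<rho>] by blast
  define C1 where "C1 = C powr (p - 2) * C * B"
  have C1: "C1 \<ge> 0" using C B by (simp add: C1_def)
  have blocks: "integrable torus (\<lambda>x. cmod (cube_sum (Suc N) f x - cube_sum N f x) powr p) \<and>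
      (\<integral>x. cmod (cube_sum (Suc N) f x - cube_sum N f x) powr p \<partial>torus) \<le> C1 * \<rho> ^ N" if f: "f \<in> W_class (1/q) q" for f :: "'d tfun" and N
  proof -
    let ?u = "\<lambda>x. cube_sum (Suc N) f x - cube_sum N f x"
    let ?K = "cube_freqs (Suc N) - cube_freqs N :: (int^'d) set"
    define S where "S = C * (real (Suc N) + 1) powr (CARD('d) * (1 - 1/q))"
    have u: "?u x = (\<Sum>k\<in>?K. fourier f k * character k x)" for x
      unfolding cube_sum_def using cube_freqs_mono[of N "Suc N"] finite_cube_freqs by (subst sum_diff) auto
    have sup: "cmod (?u x) \<le> S" for x
    proof -
      have "cmod (?u x) \<le> (\<Sum>k\<in>?K. cmod (fourier f k))" unfolding u by (rule characters.bounded_poly)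
      also have "\<dots> \<le> (\<Sum>k\<in>cube_freqs (Suc N). cmod (fourier f k))" by (rule sum_mono2) (auto simp: finite_cube_freqs)
      also have "\<dots> \<le> S" using A[OF f, of "Suc N"] by (simp add: S_def)
      finally show ?thesis .
    qed
    have "(\<integral>x. (cmod (?u x))\<^sup>2 \<partial>torus) = (\<Sum>k\<in>?K. (cmod (fourier f k))\<^sup>2)"
      unfolding u by (rule characters.parseval_poly) (simp add: finite_cube_freqs)
    also have "\<dots> \<le> C * (\<rho> * \<rho>) ^ N"
      unfolding \<rho>2[symmetric] by (rule L2[OF f]) (auto simp: finite_cube_freqs)
    finally have l2: "(\<integral>x. (cmod (?u x))\<^sup>2 \<partial>torus) \<le> C * (\<rho> * \<rho>) ^ N" .
    have m: "?u \<in> borel_measurable borel" by measurable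
    note I = sup_L2_interpolation[OF m _ sup, of p]
    have "(\<integral>x. cmod (?u x) powr p \<partial>torus) \<le> S powr (p - 2) * (C * (\<rho> * \<rho>) ^ N)"
      using I(2) p l2 by (meson less_imp_le mult_left_mono order_trans powr_ge_zero)
    also have "S powr (p - 2) = C powr (p - 2) * (real (Suc N) + 1) powr \<kappa>"
      by (simp add: S_def powr_mult powr_powr \<kappa>_def)
    also have "C powr (p - 2) * (real (Suc N) + 1) powr \<kappa> * (C * (\<rho> * \<rho>) ^ N)
       = C powr (p - 2) * C * ((real (Suc N) + 1) powr \<kappa> * \<rho> ^ N) * \<rho> ^ N"
      by (simp only: power_mult_distrib mult_ac)
    also have "\<dots> \<le> C powr (p - 2) * C * B * \<rho> ^ N"
      using C \<rho> by (intro mult_right_mono mult_left_mono B(2)) auto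
    finally show ?thesis using I(1) p by (simp add: C1_def)
  qed
  define C2 where "C2 = max C (C1 / ((1 - \<rho> powr (1 / (2 * p))) powr p * (1 - \<rho> powr (1/2))))"
  show thesis
  proof (rule that[of C2 \<rho>])
    show "0 < C2" using C by (simp add: C2_def)
    fix f :: "'d tfun" and N assume f: "f \<in> W_class (1/q) q"
    have pp: "1 \<le> p" using p by simp
    have b1: "integrable torus (\<lambda>x. cmod (cube_sum (Suc N) f x - cube_sum N f x) powr p)" for N using blocks[OF f] by blast
    have b2: "(\<integral>x. cmod (cube_sum (Suc N) f x - cube_sum N f x) powr p \<partial>torus) \<le> C1 * \<rho> ^ N" for N using blocks[OF f] by blast
    note T = cube_sum_tail[OF Wi[OF f] pp \<rho> C1 b1 b2, of N]
    show "integrable torus (\<lambda>x. cmod (f x - cube_sum N f x) powr p)" by (rule T(1))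
    show "(\<integral>x. cmod (f x - cube_sum N f x) powr p \<partial>torus) \<le> C2 * \<rho> ^ N"
      by (rule order_trans[OF T(2)], unfold C2_def, rule mult_right_mono) (use \<rho> in auto)
    show "(\<Sum>k\<in>cube_freqs N. cmod (fourier f k)) \<le> C2 * (real (N + 1)) powr (CARD('d) * (1 - 1/q))"
      by (rule order_trans[OF A[OF f]]) (auto simp: C2_def intro!: mult_right_mono)
  qed (use \<rho> in auto)
qed

section \<open>Smoothness of the norm\<close>

text \<open>Taylor expansion of second order of \<open>u \<mapsto> |a + u b| powr t\<close>.  The term \<open>\<epsilon>\<close> keeps the base away from
  zero, where the formula for the second derivative contains a negative power if \<open>t < 4\<close>.\<close>

lemma norm_add_powr_smoothed:
  fixes a b :: complex and t \<epsilon> :: real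
  assumes t: "2 < t" and \<epsilon>: "0 < \<epsilon>"
  shows "((cmod (a + b))\<^sup>2 + \<epsilon>) powr (t/2) \<le> ((cmod a)\<^sup>2 + \<epsilon>) powr (t/2)
     + t * ((cmod a)\<^sup>2 + \<epsilon>) powr (t/2 - 1) * Re (cnj a * b)
     + t * (t - 1) / 2 * ((cmod a + cmod b)\<^sup>2 + \<epsilon>) powr (t/2 - 1) * (cmod b)\<^sup>2"
proof -
  define c where "c = Re (cnj a * b)"
  define B where "B = (cmod b)\<^sup>2"
  define P where "P u = (cmod (a + of_real u * b))\<^sup>2 + \<epsilon>" for u
  have P_eq: "P u = (cmod a)\<^sup>2 + 2 * u * c + u\<^sup>2 * B + \<epsilon>" for u
    unfolding P_def c_def B_def cmod_power2 by (simp add: power2_eq_square algebra_simps)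
  have Ppos: "P u > 0" for u using \<epsilon> by (simp add: P_def add_nonneg_pos)
  have dP: "(P has_real_derivative 2 * (c + u * B)) (at u)" for u
    unfolding P_eq[abs_def] by (auto intro!: derivative_eq_intros simp: power2_eq_square)
  have dpow: "((\<lambda>u. P u powr s) has_real_derivative s * P u powr (s - 1) * (2 * (c + u * B))) (at u)" for s u
    using has_real_derivative_powr'[OF dP DERIV_const Ppos, of s u]
    by (rule DERIV_cong) (use Ppos[of u] in \<open>simp add: powr_diff field_simps\<close>)
  define \<phi>1 where "\<phi>1 u = t * P u powr (t/2 - 1) * (c + u * B)" for u
  define \<phi>2 where "\<phi>2 u = t * ((t/2 - 1) * P u powr (t/2 - 1 - 1) * (2 * (c + u * B)) * (c + u * B) + P u powr (t/2 - 1) * B)" for u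
  have d0: "((\<lambda>u. P u powr (t/2)) has_real_derivative \<phi>1 u) (at u)" for u
    by (rule DERIV_cong[OF dpow[of "t/2" u]]) (simp add: \<phi>1_def)
  have d1: "(\<phi>1 has_real_derivative \<phi>2 u) (at u)" for u
  proof -
    have "((\<lambda>u. t * (P u powr (t/2 - 1) * (c + u * B))) has_real_derivative
       t * ((t/2 - 1) * P u powr (t/2 - 1 - 1) * (2 * (c + u * B)) * (c + u * B) + B * P u powr (t/2 - 1))) (at u)"
      by (intro DERIV_cmult DERIV_mult dpow) (auto intro!: derivative_eq_intros)
    then show ?thesis unfolding \<phi>1_def[abs_def] \<phi>2_def by (simp add: mult.assoc mult.commute[of B])
  qed
  define diff where "diff m = (if m = 0 then \<lambda>u. P u powr (t/2) else if m = Suc 0 then \<phi>1 else \<phi>2)" for m :: nat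
  have "\<exists>\<theta>::real. 0 < \<theta> \<and> \<theta> < 1 \<and> P 1 powr (t/2) = (\<Sum>m<2. diff m 0 / fact m * 1 ^ m) + diff 2 \<theta> / fact 2 * 1 ^ 2"
    by (rule Maclaurin) (auto simp: diff_def d0 d1 less_2_cases_iff)
  then obtain \<theta> where \<theta>: "0 < \<theta>" "\<theta> < 1" and e: "P 1 powr (t/2) = P 0 powr (t/2) + \<phi>1 0 + \<phi>2 \<theta> / 2"
    by (auto simp: diff_def numeral_2_eq_2)
  have cs: "(c + \<theta> * B)\<^sup>2 \<le> P \<theta> * B"
  proof -
    have "c + \<theta> * B = Re (cnj (a + of_real \<theta> * b) * b)"
      unfolding c_def B_def cmod_power2 by (simp add: power2_eq_square algebra_simps)
    then have "\<bar>c + \<theta> * B\<bar> \<le> cmod (a + of_real \<theta> * b) * cmod b"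
      using abs_Re_le_cmod[of "cnj (a + of_real \<theta> * b) * b"] by (simp only: norm_mult complex_mod_cnj)
    then have "(c + \<theta> * B)\<^sup>2 \<le> (cmod (a + of_real \<theta> * b) * cmod b)\<^sup>2"
      by (metis abs_ge_zero power2_abs power_mono)
    also have "\<dots> \<le> P \<theta> * B" using \<epsilon> by (simp add: power_mult_distrib P_def B_def mult_right_mono)
    finally show ?thesis .
  qed
  have B0: "0 \<le> B" by (simp add: B_def)
  have Q: "P \<theta> powr (t/2 - 1) \<le> ((cmod a + cmod b)\<^sup>2 + \<epsilon>) powr (t/2 - 1)"
  proof (rule powr_mono2)
    have "cmod (a + of_real \<theta> * b) \<le> cmod a + \<theta> * cmod b"
      using \<theta> norm_triangle_ineq[of a "of_real \<theta> * b"] by (simp add: norm_mult)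
    also have "\<dots> \<le> cmod a + cmod b" using \<theta> by (simp add: mult_left_le_one_le)
    finally show "P \<theta> \<le> (cmod a + cmod b)\<^sup>2 + \<epsilon>" unfolding P_def by (intro add_right_mono power_mono) auto
  qed (use t Ppos[of \<theta>] in auto)
  have "\<phi>2 \<theta> = t * ((t - 2) * P \<theta> powr (t/2 - 1 - 1) * (c + \<theta> * B)\<^sup>2 + P \<theta> powr (t/2 - 1) * B)"
    by (simp add: \<phi>2_def power2_eq_square field_simps)
  also have "\<dots> \<le> t * ((t - 2) * P \<theta> powr (t/2 - 1 - 1) * (P \<theta> * B) + P \<theta> powr (t/2 - 1) * B)"
    using t cs by (intro mult_left_mono add_right_mono) auto
  also have "\<dots> = t * (t - 1) * P \<theta> powr (t/2 - 1) * B"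
  proof -
    have "P \<theta> powr (t/2 - 1 - 1) * (P \<theta> * B) = P \<theta> powr (t/2 - 1) * B"
      using Ppos[of \<theta>] powr_diff[of "P \<theta>" "t/2 - 1" 1] by simp
    then show ?thesis by (simp only: mult.assoc) (simp add: algebra_simps)
  qed
  also have "\<dots> \<le> t * (t - 1) * ((cmod a + cmod b)\<^sup>2 + \<epsilon>) powr (t/2 - 1) * B"
    using t B0 Q by (intro mult_right_mono mult_left_mono) auto
  finally have "P 1 powr (t/2) \<le> P 0 powr (t/2) + \<phi>1 0 + t * (t - 1) * ((cmod a + cmod b)\<^sup>2 + \<epsilon>) powr (t/2 - 1) * B / 2"
    using e by simp
  then show ?thesis by (simp add: P_def \<phi>1_def c_def B_def)
qed

lemma square_powr:
  fixes x s :: real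
  assumes "0 \<le> x"
  shows "(x\<^sup>2) powr s = x powr (2 * s)"
proof -
  have "x\<^sup>2 = x powr 2" using assms by simp
  then show ?thesis by (simp only: powr_powr)
qed

lemma norm_add_powr:
  fixes a b :: complex and t :: real
  assumes t: "2 \<le> t"
  shows "cmod (a + b) powr t \<le> cmod a powr t + t * (cmod a powr (t - 2) * Re (cnj a * b))
     + t * (t - 1) / 2 * ((cmod a + cmod b) powr (t - 2) * (cmod b)\<^sup>2)"
proof (cases "t = 2")
  case True
  have "(cmod (a + b))\<^sup>2 = (cmod a)\<^sup>2 + 2 * Re (cnj a * b) + (cmod b)\<^sup>2"
    unfolding cmod_power2 by (simp add: power2_eq_square algebra_simps)
  then show ?thesis using True
    by (cases "a = 0"; cases "b = 0") (auto simp: add_nonneg_eq_0_iff)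
next
  case False
  with t have t2: "2 < t" by simp
  have h: "(x\<^sup>2) powr (t/2) = x powr t" "(x\<^sup>2) powr (t/2 - 1) = x powr (t - 2)" if "0 \<le> x" for x :: real
    by (simp_all only: square_powr[OF that]) (simp_all add: right_diff_distrib)
  define l where "l e = ((cmod (a + b))\<^sup>2 + e) powr (t/2)" for e
  define r where "r e = ((cmod a)\<^sup>2 + e) powr (t/2) + t * ((cmod a)\<^sup>2 + e) powr (t/2 - 1) * Re (cnj a * b)
     + t * (t - 1) / 2 * ((cmod a + cmod b)\<^sup>2 + e) powr (t/2 - 1) * (cmod b)\<^sup>2" for e
  let ?e = "\<lambda>n. inverse (real (Suc n))"
  have lim: "(\<lambda>n. (y + ?e n) powr s) \<longlonglongrightarrow> (y + 0) powr s" if "y \<ge> 0" "s > 0" for y s :: real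
    using that by (intro tendsto_powr' tendsto_add tendsto_const LIMSEQ_inverse_real_of_nat) auto
  have "l 0 \<le> r 0"
  proof (rule LIMSEQ_le)
    show "(\<lambda>n. l (?e n)) \<longlonglongrightarrow> l 0" unfolding l_def by (rule lim) (use t2 in auto)
    show "(\<lambda>n. r (?e n)) \<longlonglongrightarrow> r 0" unfolding r_def by (intro tendsto_add tendsto_mult tendsto_const lim) (use t2 in auto)
    show "\<exists>N. \<forall>n\<ge>N. l (?e n) \<le> r (?e n)"
      unfolding l_def r_def using norm_add_powr_smoothed[OF t2] by auto
  qed
  then show ?thesis by (simp add: l_def r_def h mult.assoc)
qed

text \<open>Minkowski's inequality with a constant function, from the convexity of the power at the
  weights \<open>\<alpha> / (\<alpha> + \<beta>)\<close> and \<open>\<beta> / (\<alpha> + \<beta>)\<close>.\<close>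

lemma (in prob_space) integral_add_const_powr_le:
  fixes f :: "'a \<Rightarrow> real"
  assumes t: "1 \<le> t" and ab: "0 < \<alpha>" "0 < \<beta>" and [measurable]: "f \<in> borel_measurable M" and nn: "\<And>x. 0 \<le> f x"
    and fi: "integrable M (\<lambda>x. f x powr t)" and fa: "(\<integral>x. f x powr t \<partial>M) \<le> \<alpha> powr t"
  shows "integrable M (\<lambda>x. (f x + \<beta>) powr t)" and "(\<integral>x. (f x + \<beta>) powr t \<partial>M) \<le> (\<alpha> + \<beta>) powr t"
proof -
  define l where "l = \<alpha> / (\<alpha> + \<beta>)"
  have l: "0 \<le> l" "l \<le> 1" "1 - l = \<beta> / (\<alpha> + \<beta>)" using ab by (auto simp: l_def field_simps)
  have pt: "(f x + \<beta>) powr t \<le> (\<alpha> + \<beta>) powr t * (l * (f x powr t / \<alpha> powr t) + (1 - l))" for x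
  proof -
    have "((1 - l) *\<^sub>R 1 + l *\<^sub>R (f x / \<alpha>)) powr t \<le> (1 - l) * 1 powr t + l * (f x / \<alpha>) powr t"
    proof (cases "f x = 0")
      case True
      have "(1 - l) powr t \<le> (1 - l) powr 1" using l t by (intro powr_mono') auto
      moreover have "(1 - l) powr 1 = 1 - l" using l(2) by simp
      ultimately show ?thesis using True by simp
    next
      case False
      with nn[of x] have "0 < f x" by simp
      then show ?thesis by (intro convex_onD[OF powr_convex[OF t]]) (use l ab in auto)
    qed
    also have "(1 - l) *\<^sub>R 1 + l *\<^sub>R (f x / \<alpha>) = (f x + \<beta>) / (\<alpha> + \<beta>)"
    proof -
      have "l * (f x / \<alpha>) = f x / (\<alpha> + \<beta>)" using ab by (simp add: l_def)
      then show ?thesis by (simp add: l(3) add_divide_distrib)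
    qed
    finally have "(f x + \<beta>) powr t / (\<alpha> + \<beta>) powr t \<le> l * (f x powr t / \<alpha> powr t) + (1 - l)"
      using nn[of x] ab by (simp add: powr_divide)
    then show ?thesis using ab by (simp add: divide_le_eq mult.commute)
  qed
  have ri: "integrable M (\<lambda>x. (\<alpha> + \<beta>) powr t * (l * (f x powr t / \<alpha> powr t) + (1 - l)))"
    using fi by simp
  show i: "integrable M (\<lambda>x. (f x + \<beta>) powr t)"
  proof (rule Bochner_Integration.integrable_bound[OF ri])
    show "AE x in M. norm ((f x + \<beta>) powr t) \<le> norm ((\<alpha> + \<beta>) powr t * (l * (f x powr t / \<alpha> powr t) + (1 - l)))"
      using pt by (auto intro!: AE_I2 order_trans[OF _ abs_ge_self])
  qed simp
  have "(\<integral>x. (f x + \<beta>) powr t \<partial>M) \<le> (\<integral>x. (\<alpha> + \<beta>) powr t * (l * (f x powr t / \<alpha> powr t) + (1 - l)) \<partial>M)"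
    by (rule integral_mono[OF i ri pt])
  also have "\<dots> = (\<alpha> + \<beta>) powr t * (l * ((\<integral>x. f x powr t \<partial>M) / \<alpha> powr t) + (1 - l))"
    using fi prob_space by simp
  also have "\<dots> \<le> (\<alpha> + \<beta>) powr t * (l * 1 + (1 - l))"
    using fa ab l by (intro mult_left_mono add_right_mono) (auto simp: divide_le_eq)
  finally show "(\<integral>x. (f x + \<beta>) powr t \<partial>M) \<le> (\<alpha> + \<beta>) powr t" by simp
qed

lemma powr_one_plus_le:
  fixes y s :: real
  assumes "0 < s" "s \<le> 1" "0 \<le> y"
  shows "(1 + y) powr s \<le> 1 + s * y"
  using Youngs_inequality_0[of s "1 - s" "1 + y" 1] assms by (simp add: algebra_simps)

text \<open>The linear term of the expansion of \<open>|R + b| powr t\<close> is discarded by hypothesis.  As \<open>\<beta> \<le> \<alpha> / t\<close>,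
  the factor \<open>(\<alpha> + \<beta>) powr (t - 2)\<close> of the quadratic term exceeds \<open>\<alpha> powr (t - 2)\<close> at most by the
  factor \<open>e\<close>, and so the quadratic term is of relative size \<open>t^2 (\<beta>/\<alpha>)^2\<close>; taking the root of order
  \<open>t/2\<close> replaces one factor \<open>t\<close> by a constant.\<close>

lemma (in prob_space) smoothness_step:
  fixes R b :: "'a \<Rightarrow> complex"
  assumes t: "2 \<le> t" and [measurable]: "R \<in> borel_measurable M" "b \<in> borel_measurable M"
    and bd: "AE x in M. cmod (R x) \<le> B" and \<beta>: "AE x in M. cmod (b x) \<le> \<beta>" "0 < \<beta>"
    and \<alpha>: "t * \<beta> \<le> \<alpha>" and I: "(\<integral>x. cmod (R x) powr t \<partial>M) \<le> \<alpha> powr t"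
    and lin: "(\<integral>x. cmod (R x) powr (t - 2) * Re (cnj (R x) * b x) \<partial>M) \<le> 0"
  shows "(\<integral>x. cmod (R x + b x) powr t \<partial>M) \<le> (\<alpha>\<^sup>2 + 3 * t * \<beta>\<^sup>2) powr (t / 2)"
proof -
  have a0: "0 < \<alpha>" using \<alpha> \<beta> t by (meson less_le_trans mult_pos_pos zero_less_numeral)
  have bint: "integrable M g" if [measurable]: "g \<in> borel_measurable M" and "AE x in M. \<bar>g x\<bar> \<le> K" for g :: "'a \<Rightarrow> real" and K
    by (rule integrable_const_bound[of _ K]) (use that in auto)
  have Ri: "integrable M (\<lambda>x. cmod (R x) powr t)"
    by (rule bint[of _ "B powr t"], simp, use bd in eventually_elim) (use t in \<open>auto intro!: powr_mono2\<close>)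
  note mk = integral_add_const_powr_le[of t \<alpha> \<beta> "\<lambda>x. cmod (R x)"]
  have mk1: "integrable M (\<lambda>x. (cmod (R x) + \<beta>) powr t)" "(\<integral>x. (cmod (R x) + \<beta>) powr t \<partial>M) \<le> (\<alpha> + \<beta>) powr t"
    using mk t a0 \<beta> Ri I by auto
  have mk2: "integrable M (\<lambda>x. (cmod (R x) + \<beta>) powr (t - 2))"
      "(\<integral>x. (cmod (R x) + \<beta>) powr (t - 2) \<partial>M) \<le> (\<alpha> + \<beta>) powr (t - 2)"
  proof -
    have "integrable M (\<lambda>x. (cmod (R x) + \<beta>) powr (t - 2)) \<and> (\<integral>x. (cmod (R x) + \<beta>) powr (t - 2) \<partial>M) \<le> (\<alpha> + \<beta>) powr (t - 2)"
    proof (cases "t = 2")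
      case True
      have "cmod (R x) + \<beta> \<noteq> 0" "\<alpha> + \<beta> \<noteq> 0" for x using \<beta>(2) a0 by (auto simp: add_nonneg_eq_0_iff)
      then show ?thesis using True by (simp add: prob_space)
    next
      case False
      then have t2: "0 < t - 2" "t - 2 \<le> t" using t by auto
      note pm = integral_powr_mono[OF t2, of "\<lambda>x. cmod (R x) + \<beta>"]
      have "integrable M (\<lambda>x. (cmod (R x) + \<beta>) powr (t - 2))" using pm(1) mk1 \<beta> by (simp add: add_nonneg_pos less_imp_le)
      moreover have "(\<integral>x. (cmod (R x) + \<beta>) powr (t - 2) \<partial>M) \<le> (\<integral>x. (cmod (R x) + \<beta>) powr t \<partial>M) powr ((t - 2) / t)"
        using pm(2) mk1 \<beta> by (simp add: add_nonneg_pos less_imp_le)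
      moreover have "\<dots> \<le> ((\<alpha> + \<beta>) powr t) powr ((t - 2) / t)"
        using mk1 t2 t by (intro powr_mono2) auto
      moreover have "((\<alpha> + \<beta>) powr t) powr ((t - 2) / t) = (\<alpha> + \<beta>) powr (t - 2)" using t by (simp add: powr_powr)
      ultimately show ?thesis by linarith
    qed
    then show "integrable M (\<lambda>x. (cmod (R x) + \<beta>) powr (t - 2))"
      "(\<integral>x. (cmod (R x) + \<beta>) powr (t - 2) \<partial>M) \<le> (\<alpha> + \<beta>) powr (t - 2)" by auto
  qed
  have li: "integrable M (\<lambda>x. cmod (R x) powr (t - 2) * Re (cnj (R x) * b x))"
  proof (rule bint[of _ "B powr (t - 2) * (B * \<beta>)"])
    show "AE x in M. \<bar>cmod (R x) powr (t - 2) * Re (cnj (R x) * b x)\<bar> \<le> B powr (t - 2) * (B * \<beta>)"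
      using bd \<beta>(1)
    proof eventually_elim
      case (elim x)
      have B0: "0 \<le> B" using elim norm_ge_zero[of "R x"] by linarith
      have "\<bar>Re (cnj (R x) * b x)\<bar> \<le> cmod (R x) * cmod (b x)"
        using abs_Re_le_cmod[of "cnj (R x) * b x"] by (simp only: norm_mult complex_mod_cnj)
      also have "\<dots> \<le> B * \<beta>" using elim B0 by (intro mult_mono) auto
      finally show ?case unfolding abs_mult using elim t B0
        by (intro mult_mono) (use \<beta>(2) B0 in \<open>auto intro!: powr_mono2\<close>)
    qed
  qed measurable
  have pt: "AE x in M. cmod (R x + b x) powr t \<le> cmod (R x) powr t + t * (cmod (R x) powr (t - 2) * Re (cnj (R x) * b x))
     + t * (t - 1) / 2 * \<beta>\<^sup>2 * (cmod (R x) + \<beta>) powr (t - 2)"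
    using \<beta>(1)
  proof eventually_elim
    case (elim x)
    have "(cmod (R x) + cmod (b x)) powr (t - 2) * (cmod (b x))\<^sup>2 \<le> (cmod (R x) + \<beta>) powr (t - 2) * \<beta>\<^sup>2"
      using elim t by (intro mult_mono powr_mono2 power_mono) auto
    then have "t * (t - 1) / 2 * ((cmod (R x) + cmod (b x)) powr (t - 2) * (cmod (b x))\<^sup>2) \<le> t * (t - 1) / 2 * ((cmod (R x) + \<beta>) powr (t - 2) * \<beta>\<^sup>2)"
      using t by (intro mult_left_mono) auto
    then show ?case using norm_add_powr[OF t, of "R x" "b x"] by (simp add: mult_ac)
  qed
  have Bi: "integrable M (\<lambda>x. cmod (R x + b x) powr t)"
    by (rule bint[of _ "(B + \<beta>) powr t"], simp, use bd \<beta>(1) in eventually_elim)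
       (use t in \<open>auto intro!: powr_mono2 order_trans[OF norm_triangle_ineq]\<close>)
  have "(\<integral>x. cmod (R x + b x) powr t \<partial>M) \<le> (\<integral>x. cmod (R x) powr t + t * (cmod (R x) powr (t - 2) * Re (cnj (R x) * b x))
     + t * (t - 1) / 2 * \<beta>\<^sup>2 * (cmod (R x) + \<beta>) powr (t - 2) \<partial>M)"
    by (rule integral_mono_AE[OF Bi _ pt]) (intro Bochner_Integration.integrable_add integrable_mult_right Ri li mk2)
  also have "\<dots> = (\<integral>x. cmod (R x) powr t \<partial>M) + t * (\<integral>x. cmod (R x) powr (t - 2) * Re (cnj (R x) * b x) \<partial>M)
     + t * (t - 1) / 2 * \<beta>\<^sup>2 * (\<integral>x. (cmod (R x) + \<beta>) powr (t - 2) \<partial>M)"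
    by (simp only: Bochner_Integration.integral_add Bochner_Integration.integrable_add integrable_mult_right integral_mult_right_zero Ri li mk2)
  also have "\<dots> \<le> \<alpha> powr t + 0 + t * (t - 1) / 2 * \<beta>\<^sup>2 * (\<alpha> + \<beta>) powr (t - 2)"
    using t lin I mk2 by (intro add_mono mult_left_mono) (auto intro: mult_nonneg_nonpos)
  also have "(\<alpha> + \<beta>) powr (t - 2) \<le> 3 * \<alpha> powr (t - 2)"
  proof -
    have "\<beta> \<le> \<alpha> / t" using \<alpha> t by (simp add: field_simps)
    then have "\<alpha> + \<beta> \<le> \<alpha> * (1 + 1/t)" by (simp add: algebra_simps)
    then have "(\<alpha> + \<beta>) powr (t - 2) \<le> (\<alpha> * (1 + 1/t)) powr (t - 2)" using a0 \<beta> t by (intro powr_mono2) auto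
    also have "\<dots> = \<alpha> powr (t - 2) * (1 + 1/t) powr (t - 2)" by (rule powr_mult)
    also have "\<dots> \<le> \<alpha> powr (t - 2) * 3"
    proof (rule mult_left_mono)
      have "(1 + 1/t) powr (t - 2) \<le> exp (1/t) powr (t - 2)" using t by (intro powr_mono2) auto
      also have "\<dots> = exp ((t - 2) / t)" by (simp add: powr_def)
      also have "\<dots> \<le> exp 1" using t by simp
      also have "\<dots> \<le> 3" by (rule exp_le)
      finally show "(1 + 1/t) powr (t - 2) \<le> 3" .
    qed simp
    finally show ?thesis by (simp add: mult.commute)
  qed
  finally have "(\<integral>x. cmod (R x + b x) powr t \<partial>M) \<le> \<alpha> powr t + t * (t - 1) / 2 * \<beta>\<^sup>2 * (3 * \<alpha> powr (t - 2))"
    using t by (simp add: mult_left_mono)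
  also have "\<dots> = \<alpha> powr t * (1 + 3/2 * t * (t - 1) * (\<beta>\<^sup>2 / \<alpha>\<^sup>2))"
    using a0 by (simp add: powr_diff powr_numeral field_simps)
  also have "\<dots> \<le> \<alpha> powr t * (1 + 3/2 * t * t * (\<beta>\<^sup>2 / \<alpha>\<^sup>2))"
    using t by (intro mult_left_mono add_left_mono mult_right_mono) auto
  also have "\<dots> \<le> \<alpha> powr t * (1 + 3 * t * (\<beta>\<^sup>2 / \<alpha>\<^sup>2)) powr (t/2)"
  proof (rule mult_left_mono)
    let ?z = "\<beta>\<^sup>2 / \<alpha>\<^sup>2"
    have e: "(2/t) * (3/2 * t * t * ?z) = 3 * t * ?z" using t by simp
    have "((1 + 3/2 * t * t * ?z) powr (2/t)) powr (t/2) \<le> (1 + (2/t) * (3/2 * t * t * ?z)) powr (t/2)"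
      using t by (intro powr_mono2 powr_one_plus_le) auto
    moreover have "((1 + 3/2 * t * t * ?z) powr (2/t)) powr (t/2) = 1 + 3/2 * t * t * ?z"
      using t unfolding powr_powr by (simp add: add_nonneg_nonneg)
    ultimately show "1 + 3/2 * t * t * ?z \<le> (1 + 3 * t * ?z) powr (t/2)" unfolding e by simp
  qed simp
  also have "\<dots> = (\<alpha>\<^sup>2 * (1 + 3 * t * (\<beta>\<^sup>2 / \<alpha>\<^sup>2))) powr (t/2)"
  proof -
    have "\<alpha> powr t = (\<alpha>\<^sup>2) powr (t/2)" using a0 by (simp add: square_powr)
    then show ?thesis by (simp add: powr_mult)
  qed
  also have "\<alpha>\<^sup>2 * (1 + 3 * t * (\<beta>\<^sup>2 / \<alpha>\<^sup>2)) = \<alpha>\<^sup>2 + 3 * t * \<beta>\<^sup>2" using a0 by (simp add: field_simps)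
  finally show ?thesis .
qed

section \<open>The incremental greedy algorithm\<close>

lemma character_periodic: "character k (x + axis j (2 * pi)) = character k x"
proof -
  have "(\<Sum>i\<in>UNIV. of_int (k $ i) * (x + axis j (2 * pi)) $ i) = (\<Sum>i\<in>UNIV. of_int (k $ i) * x $ i + (if i = j then of_int (k $ j) * (2 * pi) else 0))"
    by (intro sum.cong) (auto simp: axis_def distrib_left)
  then have "character k (x + axis j (2 * pi)) = character k x * cis (2 * pi * of_int (k $ j))"
    by (simp add: character_def sum.distrib cis_mult mult.commute add.commute)
  then show ?thesis using cis_multiple_2pi[of "of_int (k $ j)"] by simp
qed

lemma m_term_properties:
  assumes "h \<in> m_term m"
  shows "h \<in> borel_measurable borel" and "periodic h"
  using assms by (auto simp: m_term_def periodic_def character_periodic)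

lemma collect_frequencies:
  fixes k :: "nat \<Rightarrow> int^'d::finite" and c :: "nat \<Rightarrow> complex"
  shows "(\<Sum>j<m. c j * character (k j) x)
    = (\<Sum>l\<in>k ` {..<m}. (\<Sum>j\<in>{j\<in>{..<m}. k j = l}. c j) * character l x)"
proof -
  have "(\<Sum>j<m. c j * character (k j) x) = (\<Sum>l\<in>k ` {..<m}. \<Sum>j\<in>{j\<in>{..<m}. k j = l}. c j * character (k j) x)"
    by (rule sum.image_gen) simp
  then show ?thesis by (simp add: sum_distrib_right)
qed

lemma A_norm_trig_sum:
  fixes k :: "nat \<Rightarrow> int^'d::finite" and c :: "nat \<Rightarrow> complex"
  shows "A_norm (\<lambda>x. \<Sum>j<m. c j * character (k j) x) \<le> (\<Sum>j<m. cmod (c j))"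
proof -
  define S where "S = k ` {..<m}"
  define a where "a l = (\<Sum>j\<in>{j\<in>{..<m}. k j = l}. c j)" for l
  have f: "fourier (\<lambda>x. \<Sum>j<m. c j * character (k j) x) l = (if l \<in> S then a l else 0)" for l
    unfolding collect_frequencies S_def a_def by (rule fourier_poly) simp
  have "A_norm (\<lambda>x. \<Sum>j<m. c j * character (k j) x) = (\<Sum>\<^sub>\<infinity>l\<in>S. cmod (a l))"
    unfolding A_norm_def f by (rule infsum_cong_neutral) auto
  also have "\<dots> = (\<Sum>l\<in>S. cmod (a l))" by (simp add: S_def)
  also have "\<dots> \<le> (\<Sum>l\<in>S. \<Sum>j\<in>{j\<in>{..<m}. k j = l}. cmod (c j))"
    unfolding a_def by (intro sum_mono norm_sum)
  also have "\<dots> = (\<Sum>j<m. cmod (c j))" unfolding S_def by (rule sum.image_gen[symmetric]) simp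
  finally show ?thesis .
qed

lemma Lp_imp_integrable: "f \<in> Lp 1 \<Longrightarrow> integrable torus f"
  by (rule integrable_norm_cancel) (auto simp: Lp_def)

lemma A_norm_nonneg: "0 \<le> A_norm f"
  unfolding A_norm_def by (rule infsum_nonneg) simp

lemma filterlim_cube_freqs: "filterlim (cube_freqs :: nat \<Rightarrow> (int^'d::finite) set) (finite_subsets_at_top UNIV) sequentially"
  unfolding filterlim_finite_subsets_at_top
proof (intro allI impI)
  fix X :: "(int^'d) set" assume X: "finite X \<and> X \<subseteq> UNIV"
  have "\<exists>N. X \<subseteq> cube_freqs N"
    using X[THEN conjunct1]
  proof induction
    case (insert k X)
    then obtain N where "X \<subseteq> cube_freqs N" by blast
    moreover obtain N' where "k \<in> cube_freqs N'" using cube_freqs_exhaust by blast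
    ultimately have "insert k X \<subseteq> cube_freqs (max N N')"
      using cube_freqs_mono[of N "max N N'"] cube_freqs_mono[of N' "max N N'"] by auto
    then show ?case by blast
  qed auto
  then obtain N where N: "X \<subseteq> cube_freqs N" by blast
  have "finite (cube_freqs n :: (int^'d) set) \<and> X \<subseteq> cube_freqs n \<and> cube_freqs n \<subseteq> UNIV" if "n \<ge> N" for n
    using N cube_freqs_mono[OF that] finite_cube_freqs by blast
  then show "\<forall>\<^sub>F n in sequentially. finite (cube_freqs n :: (int^'d) set) \<and> X \<subseteq> cube_freqs n \<and> cube_freqs n \<subseteq> UNIV"
    by (auto simp: eventually_sequentially)
qed

text \<open>The Fourier series converges absolutely, and its sum has the same Fourier coefficients as \<open>g\<close>.\<close>

lemma Wiener_pointwise: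
  fixes g :: "'d::finite tfun"
  assumes g: "g \<in> Wiener"
  shows "\<And>N x. cmod (cube_sum N g x) \<le> A_norm g"
    and "AE x in torus. (\<lambda>N. cube_sum N g x) \<longlonglongrightarrow> g x"
    and "AE x in torus. cmod (g x) \<le> A_norm g"
proof -
  have sm: "(\<lambda>k. cmod (fourier g k)) summable_on UNIV" and gi: "integrable torus g"
    using g by (auto simp: Wiener_def intro: Lp_imp_integrable)
  show bd: "cmod (cube_sum N g x) \<le> A_norm g" for N x
  proof -
    have "cmod (cube_sum N g x) \<le> (\<Sum>k\<in>cube_freqs N. cmod (fourier g k))"
      unfolding cube_sum_def by (rule characters.bounded_poly)
    also have "\<dots> \<le> A_norm g"
      unfolding A_norm_def by (rule finite_sum_le_infsum[OF sm]) (auto simp: finite_cube_freqs)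
    finally show ?thesis .
  qed
  define L where "L x = (\<Sum>\<^sub>\<infinity>k\<in>UNIV. fourier g k * character k x)" for x
  have conv: "(\<lambda>N. cube_sum N g x) \<longlonglongrightarrow> L x" for x
  proof -
    have "(\<lambda>k. fourier g k * character k x) summable_on UNIV"
      by (rule abs_summable_summable) (use sm in \<open>simp add: norm_mult\<close>)
    then have "((\<lambda>k. fourier g k * character k x) has_sum L x) UNIV"
      unfolding L_def by (rule has_sum_infsum)
    then have "(sum (\<lambda>k. fourier g k * character k x) \<longlongrightarrow> L x) (finite_subsets_at_top UNIV)"
      by (simp add: has_sum_def)
    from filterlim_compose[OF this filterlim_cube_freqs] show ?thesis
      by (simp add: cube_sum_def)
  qed
  have mL [measurable]: "L \<in> borel_measurable borel"
    by (rule borel_measurable_LIMSEQ_metric[OF _ conv]) measurable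
  have bL: "cmod (L x) \<le> A_norm g" for x
    by (rule LIMSEQ_le_const2[OF tendsto_norm[OF conv]]) (use bd in auto)
  have Li: "integrable torus L" by (rule torus.integrable_const_bound[of _ "A_norm g"]) (use bL in auto)
  have "AE x in torus. g x = L x"
  proof (rule fourier_unique[OF gi Li])
    fix k
    have "(\<lambda>N. fourier (cube_sum N g) k) \<longlonglongrightarrow> fourier L k"
      unfolding fourier_def
    proof (rule integral_dominated_convergence[where w="\<lambda>_. A_norm g"])
      show "AE x in torus. (\<lambda>N. cube_sum N g x * cnj (character k x)) \<longlonglongrightarrow> L x * cnj (character k x)"
        using conv by (auto intro!: AE_I2 tendsto_intros)
      show "AE x in torus. norm (cube_sum N g x * cnj (character k x)) \<le> A_norm g" for N
        using bd by (simp add: norm_mult)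
    qed auto
    moreover obtain N where "k \<in> cube_freqs N" using cube_freqs_exhaust by blast
    then have "fourier (cube_sum n g) k = fourier g k" if "n \<ge> N" for n
      using cube_freqs_mono[OF that] by (auto simp: fourier_cube_sum)
    then have "(\<lambda>N. fourier (cube_sum N g) k) \<longlonglongrightarrow> fourier g k"
      by (intro tendsto_eventually) (auto simp: eventually_sequentially)
    ultimately show "fourier g k = fourier L k" using LIMSEQ_unique by blast
  qed
  then show "AE x in torus. (\<lambda>N. cube_sum N g x) \<longlonglongrightarrow> g x" "AE x in torus. cmod (g x) \<le> A_norm g"
    by (eventually_elim, use conv bL in simp)+
qed

text \<open>A function of Wiener norm \<open>A\<close> lies in the closed convex hull of the functions \<open>c * character k\<close>
  with \<open>|c| = A\<close>, so a functional is at most \<open>A\<close> times its largest value on a character.\<close>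

lemma Wiener_duality:
  fixes g \<psi> :: "'d::finite tfun"
  assumes g: "g \<in> Wiener" and \<psi>: "integrable torus \<psi>" and c: "\<And>k. cmod (fourier \<psi> k) \<le> c"
  shows "cmod (\<integral>x. g x * cnj (\<psi> x) \<partial>torus) \<le> A_norm g * c"
proof -
  note W = Wiener_pointwise[OF g]
  have [measurable]: "g \<in> borel_measurable borel" "\<psi> \<in> borel_measurable borel"
    using g borel_measurable_integrable[OF \<psi>] by (auto simp: Wiener_def Lp_def)
  have sm: "(\<lambda>k. cmod (fourier g k)) summable_on UNIV" using g by (auto simp: Wiener_def)
  have c0: "0 \<le> c" using c[of 0] norm_ge_zero order_trans by blast
  have "(\<lambda>N. \<integral>x. cube_sum N g x * cnj (\<psi> x) \<partial>torus) \<longlonglongrightarrow> (\<integral>x. g x * cnj (\<psi> x) \<partial>torus)"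
  proof (rule integral_dominated_convergence[where w="\<lambda>x. A_norm g * cmod (\<psi> x)"])
    show "AE x in torus. (\<lambda>N. cube_sum N g x * cnj (\<psi> x)) \<longlonglongrightarrow> g x * cnj (\<psi> x)"
      using W(2) by eventually_elim (intro tendsto_intros)
    show "AE x in torus. norm (cube_sum N g x * cnj (\<psi> x)) \<le> A_norm g * cmod (\<psi> x)" for N
      using W(1) by (auto simp: norm_mult intro!: mult_right_mono)
  qed (use \<psi> in auto)
  then have lim: "(\<lambda>N. cmod (\<integral>x. cube_sum N g x * cnj (\<psi> x) \<partial>torus)) \<longlonglongrightarrow> cmod (\<integral>x. g x * cnj (\<psi> x) \<partial>torus)"
    by (rule tendsto_norm)
  have "cmod (\<integral>x. cube_sum N g x * cnj (\<psi> x) \<partial>torus) \<le> A_norm g * c" for N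
  proof -
    have "(\<integral>x. cube_sum N g x * cnj (\<psi> x) \<partial>torus) = cnj (\<integral>x. \<psi> x * cnj (cube_sum N g x) \<partial>torus)"
    proof -
      have "(\<integral>x. cube_sum N g x * cnj (\<psi> x) \<partial>torus) = (\<integral>x. cnj (\<psi> x * cnj (cube_sum N g x)) \<partial>torus)"
        by (simp add: mult.commute)
      also have "\<dots> = cnj (\<integral>x. \<psi> x * cnj (cube_sum N g x) \<partial>torus)" by (rule Bochner_Integration.integral_cnj)
      finally show ?thesis .
    qed
    also have "(\<integral>x. \<psi> x * cnj (cube_sum N g x) \<partial>torus) = (\<Sum>k\<in>cube_freqs N. cnj (fourier g k) * fourier \<psi> k)"
      unfolding cube_sum_def by (subst characters.integral_times_cnj_poly[OF \<psi>]) (simp add: fourier_def)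
    finally have "cmod (\<integral>x. cube_sum N g x * cnj (\<psi> x) \<partial>torus) = cmod (\<Sum>k\<in>cube_freqs N. cnj (fourier g k) * fourier \<psi> k)"
      by (simp only: complex_mod_cnj)
    also have "\<dots> \<le> (\<Sum>k\<in>cube_freqs N. cmod (fourier g k) * c)"
      using c by (intro sum_norm_le) (auto simp: norm_mult intro!: mult_left_mono)
    also have "\<dots> = (\<Sum>k\<in>cube_freqs N. cmod (fourier g k)) * c" by (simp add: sum_distrib_right)
    also have "\<dots> \<le> A_norm g * c"
      unfolding A_norm_def by (intro mult_right_mono finite_sum_le_infsum[OF sm] c0) (auto simp: finite_cube_freqs)
    finally show ?thesis .
  qed
  with lim show ?thesis by (intro LIMSEQ_le_const2) auto
qed

text \<open>By Bessel's inequality only finitely many coefficients reach a given positive size.\<close>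

lemma fourier_arg_max_exists:
  fixes \<psi> :: "'d::finite tfun"
  assumes [measurable]: "\<psi> \<in> borel_measurable borel" and b: "AE x in torus. cmod (\<psi> x) \<le> B"
  shows "\<exists>k. is_arg_max (\<lambda>k. cmod (fourier \<psi> k)) (\<lambda>_. True) k"
proof (cases "\<forall>k. fourier \<psi> k = 0")
  case True
  then show ?thesis by (auto simp: is_arg_max_def)
next
  case False
  then obtain k0 where k0: "fourier \<psi> k0 \<noteq> 0" by blast
  define \<delta> where "\<delta> = cmod (fourier \<psi> k0)"
  have \<delta>: "\<delta> > 0" using k0 by (simp add: \<delta>_def)
  define S where "S = {k. \<delta> \<le> cmod (fourier \<psi> k)}"
  have i2: "integrable torus (\<lambda>x. (cmod (\<psi> x))\<^sup>2)"
    by (rule torus.integrable_const_bound[of _ "B\<^sup>2"], use b in eventually_elim) (auto intro!: power_mono)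
  define I where "I = (\<integral>x. (cmod (\<psi> x))\<^sup>2 \<partial>torus)"
  have card: "real (card T) \<le> I / \<delta>\<^sup>2" if T: "finite T" "T \<subseteq> S" for T
  proof -
    have "real (card T) * \<delta>\<^sup>2 = (\<Sum>k\<in>T. \<delta>\<^sup>2)" by simp
    also have "\<dots> \<le> (\<Sum>k\<in>T. (cmod (fourier \<psi> k))\<^sup>2)"
      using T \<delta> by (intro sum_mono power_mono) (auto simp: S_def)
    also have "\<dots> \<le> I"
      unfolding fourier_def I_def by (rule characters.bessel) (use i2 T in auto)
    finally show ?thesis using \<delta> by (simp add: field_simps)
  qed
  have fin: "finite S"
  proof (rule ccontr)
    assume "infinite S"
    then obtain T where T: "T \<subseteq> S" "finite T" "card T = Suc (nat \<lceil>I / \<delta>\<^sup>2\<rceil>)"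
      by (meson infinite_arbitrarily_large)
    from card[OF T(2,1)] T(3) have "real (Suc (nat \<lceil>I / \<delta>\<^sup>2\<rceil>)) \<le> I / \<delta>\<^sup>2" by simp
    then show False by linarith
  qed
  have "k0 \<in> S" by (simp add: S_def \<delta>_def)
  then obtain k where k: "k \<in> S" "\<And>l. l \<in> S \<Longrightarrow> cmod (fourier \<psi> l) \<le> cmod (fourier \<psi> k)"
    using fin obtains_MAX[of S "\<lambda>k. cmod (fourier \<psi> k)"] by (metis Max_ge empty_iff finite_imageI image_eqI)
  have "cmod (fourier \<psi> l) \<le> cmod (fourier \<psi> k)" for l
  proof (cases "l \<in> S")
    case False
    then have "cmod (fourier \<psi> l) < \<delta>" by (simp add: S_def)
    also have "\<delta> \<le> cmod (fourier \<psi> k)" using k(1) by (simp add: S_def)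
    finally show ?thesis by simp
  qed (rule k(2))
  then show ?thesis by (auto simp: is_arg_max_def not_less)
qed

text \<open>Each step forms a convex combination of the current approximant with a multiple of a character
  of Wiener norm at most \<open>A_norm g\<close>.\<close>

lemma greedy_output_form:
  assumes "greedy_output t g m h"
  shows "\<exists>k c. h = (\<lambda>x. \<Sum>j<m. c j * character (k j) x) \<and> (\<Sum>j<m. cmod (c j)) \<le> A_norm g"
  using assms
proof induction
  case start
  then show ?case by (auto simp: A_norm_nonneg)
next
  case (step m h \<psi> k)
  then obtain kk c where h: "h = (\<lambda>x. \<Sum>j<m. c j * character (kk j) x)" and c: "(\<Sum>j<m. cmod (c j)) \<le> A_norm g" by blast
  define k' where "k' = kk(m := k)"
  define c' where "c' j = (if j < m then (1 - 1 / of_nat (Suc m)) * c j else of_real (A_norm g) / of_nat (Suc m) * sgn (fourier \<psi> k))" for j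
  have "(1 - 1 / of_nat (Suc m)) * h x + of_real (A_norm g) / of_nat (Suc m) * sgn (fourier \<psi> k) * character k x = (\<Sum>j<Suc m. c' j * character (k' j) x)" for x
    by (simp add: h c'_def k'_def sum_distrib_left mult.assoc)
  moreover have "(\<Sum>j<Suc m. cmod (c' j)) \<le> A_norm g"
  proof -
    have e: "cmod (1 - 1 / of_nat (Suc m)) = 1 - 1 / real (Suc m)"
    proof -
      have "(1 - 1 / of_nat (Suc m) :: complex) = of_real (1 - 1 / real (Suc m))" by simp
      then show ?thesis by (simp only: norm_of_real) (simp add: field_simps)
    qed
    have "(\<Sum>j<Suc m. cmod (c' j)) = (1 - 1 / real (Suc m)) * (\<Sum>j<m. cmod (c j)) + A_norm g / real (Suc m) * cmod (sgn (fourier \<psi> k))"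
      by (simp add: c'_def norm_mult norm_divide e A_norm_nonneg sum_distrib_left del: of_nat_Suc)
    also have "\<dots> \<le> (1 - 1 / real (Suc m)) * A_norm g + A_norm g / real (Suc m) * 1"
      using c A_norm_nonneg[of g] by (intro add_mono mult_left_mono) (auto simp: norm_sgn field_simps)
    also have "\<dots> = A_norm g" by (simp add: algebra_simps)
    finally show ?thesis .
  qed
  ultimately show ?case by blast
qed

lemma greedy_output_bounds:
  assumes out: "greedy_output t g m h"
  shows "h \<in> m_term m" "A_norm h \<le> A_norm g" "cmod (h x) \<le> A_norm g"
proof -
  obtain k c where h: "h = (\<lambda>x. \<Sum>j<m. c j * character (k j) x)" "(\<Sum>j<m. cmod (c j)) \<le> A_norm g"
    using greedy_output_form[OF out] by blast
  show "h \<in> m_term m" unfolding m_term_def h(1) by blast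
  show "A_norm h \<le> A_norm g" unfolding h(1) using A_norm_trig_sum h(2) by (rule order_trans)
  have "cmod (h x) \<le> (\<Sum>j<m. cmod (c j))" unfolding h(1) by (rule sum_norm_le) (simp add: norm_mult)
  then show "cmod (h x) \<le> A_norm g" using h(2) by simp
qed

lemma measurable_norming [measurable]:
  "f \<in> borel_measurable borel \<Longrightarrow> norming t f \<in> borel_measurable borel"
  unfolding norming_def[abs_def] by measurable

lemma norm_norming_le:
  assumes "2 \<le> t" "cmod (f x) \<le> B"
  shows "cmod (norming t f x) \<le> B powr (t - 2) * B"
proof -
  have "0 \<le> B" using assms(2) norm_ge_zero order_trans by blast
  then show ?thesis using assms by (auto simp: norming_def norm_mult intro!: mult_mono powr_mono2)
qed

lemma greedy_output_exists:
  fixes g :: "'d::finite tfun"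
  assumes g: "g \<in> Wiener" and t: "2 \<le> t"
  shows "\<exists>h. greedy_output t g m h"
proof (induction m)
  case 0
  then show ?case using greedy_output.start by blast
next
  case (Suc m)
  then obtain h where h: "greedy_output t g m h" by blast
  have [measurable]: "g \<in> borel_measurable borel" "h \<in> borel_measurable borel"
    using g m_term_properties(1)[OF greedy_output_bounds(1)[OF h]] by (auto simp: Wiener_def Lp_def)
  have b: "AE x in torus. cmod (norming t (\<lambda>x. g x - h x) x) \<le> (2 * A_norm g) powr (t - 2) * (2 * A_norm g)"
    using Wiener_pointwise(3)[OF g]
  proof eventually_elim
    case (elim x)
    have "cmod (g x - h x) \<le> 2 * A_norm g"
      using norm_triangle_ineq4[of "g x" "h x"] elim greedy_output_bounds(3)[OF h, of x] by linarith
    then show ?case by (rule norm_norming_le[OF t])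
  qed
  obtain k where "is_arg_max (\<lambda>k. cmod (fourier (norming t (\<lambda>x. g x - h x)) k)) (\<lambda>_. True) k"
    using fourier_arg_max_exists[OF _ b] by auto
  from greedy_output.step[OF h refl this] show ?case by blast
qed

text \<open>As long as \<open>m \<le> 3 t\<close>, the trivial bound \<open>2 A\<close> on the residual suffices.  Beyond that the new
  residual is \<open>R + b\<close>, with \<open>R\<close> the old residual multiplied by \<open>1 - 1/m\<close> and \<open>|b| \<le> 2 A / m\<close>, and the
  induction hypothesis reproduces itself: \<open>12 t A^2 (m - 1) / m^2 + 3 t (2 A / m)^2 = 12 t A^2 / m\<close>.
  The linear term is nonpositive because, by duality, the norming functional takes no larger value
  on \<open>g\<close> than on the chosen multiple of a character.\<close>

lemma greedy_output_error:
  fixes g :: "'d::finite tfun"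
  assumes g: "g \<in> Wiener" and t: "2 \<le> t" and out: "greedy_output t g m h"
  shows "(\<integral>x. cmod (g x - h x) powr t \<partial>torus) \<le> (12 * t * (A_norm g)\<^sup>2 / real (max m 1)) powr (t / 2)"
proof -
  define A where "A = A_norm g"
  have A0: "0 \<le> A" by (simp add: A_def A_norm_nonneg)
  have gm [measurable]: "g \<in> borel_measurable borel" using g by (auto simp: Wiener_def Lp_def)
  have gA: "AE x in torus. cmod (g x) \<le> A" unfolding A_def by (rule Wiener_pointwise(3)[OF g])
  have coarse: "(\<integral>x. cmod (g x - h x) powr t \<partial>torus) \<le> (B\<^sup>2) powr (t / 2)"
    if hm: "h \<in> borel_measurable borel" and hb: "AE x in torus. cmod (g x - h x) \<le> B" and B: "0 \<le> B" for h B
  proof -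
    note [measurable] = hm
    have le: "AE x in torus. cmod (g x - h x) powr t \<le> B powr t"
      using hb by eventually_elim (use t in \<open>auto intro!: powr_mono2\<close>)
    have "(\<integral>x. cmod (g x - h x) powr t \<partial>torus) \<le> (\<integral>x. B powr t \<partial>(torus :: (real^'d) measure))"
      by (rule integral_mono_AE[OF _ _ le], rule torus.integrable_const_bound[of _ "B powr t"]) (use le in auto)
    also have "\<dots> = B powr t" by (simp add: torus.prob_space[simplified])
    finally show ?thesis using B by (simp add: square_powr)
  qed
  show ?thesis
    using out unfolding A_def[symmetric]
  proof induction
    case start
    have "(\<integral>x. cmod (g x - 0) powr t \<partial>torus) \<le> (A\<^sup>2) powr (t / 2)"
      by (rule coarse) (use gA A0 in auto)
    also have "\<dots> \<le> (12 * t * A\<^sup>2 / real (max 0 1)) powr (t / 2)"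
    proof (rule powr_mono2)
      have "1 * A\<^sup>2 \<le> (12 * t) * A\<^sup>2" using t by (intro mult_right_mono) auto
      then show "A\<^sup>2 \<le> 12 * t * A\<^sup>2 / real (max 0 1)" by simp
    qed (use t in auto)
    finally show ?case by simp
  next
    case (step m h \<psi> k)
    let ?M = "real (Suc m)"
    let ?h' = "\<lambda>x. (1 - 1 / of_nat (Suc m)) * h x + of_real (A_norm g) / of_nat (Suc m) * sgn (fourier \<psi> k) * character k x"
    have out': "greedy_output t g (Suc m) ?h'" by (rule greedy_output.step) (use step in auto)
    note hb = greedy_output_bounds[OF step.hyps(1)] and hb' = greedy_output_bounds[OF out']
    have [measurable]: "h \<in> borel_measurable borel" "?h' \<in> borel_measurable borel"
      using m_term_properties(1)[OF hb(1)] m_term_properties(1)[OF hb'(1)] by auto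
    have maxM: "real (max (Suc m) 1) = ?M" by simp
    show ?case
    proof (cases "?M \<le> 3 * t \<or> A = 0")
      case True
      have "(\<integral>x. cmod (g x - ?h' x) powr t \<partial>torus) \<le> ((2 * A)\<^sup>2) powr (t / 2)"
      proof (rule coarse)
        show "AE x in torus. cmod (g x - ?h' x) \<le> 2 * A"
          using gA
        proof eventually_elim
          case (elim x)
          then show ?case using norm_triangle_ineq4[of "g x" "?h' x"] hb'(3)[of x] unfolding A_def by linarith
        qed
      qed (use A0 in auto)
      also have "\<dots> \<le> (12 * t * A\<^sup>2 / ?M) powr (t / 2)"
      proof (rule powr_mono2)
        show "(2 * A)\<^sup>2 \<le> 12 * t * A\<^sup>2 / ?M"
        proof (cases "A = 0")
          case False
          then have "4 * ?M * A\<^sup>2 \<le> 12 * t * A\<^sup>2" using True by (intro mult_right_mono) auto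
          then show ?thesis by (simp add: field_simps del: of_nat_Suc)
        qed simp
      qed (use t in auto)
      finally show ?thesis by (simp only: maxM)
    next
      case False
      then have M: "3 * t < ?M" and A: "0 < A" using A0 by auto
      have m: "1 \<le> m" using M t by (cases m) auto
      have tm: "t \<le> 3 * real m" using M t by simp
      define c where "c = real m / ?M"
      have c0: "0 < c" using m by (simp add: c_def)
      have cr: "1 - 1 / ?M = c" by (simp add: c_def field_simps)
      have cc: "(1 - 1 / of_nat (Suc m) :: complex) = of_real c"
        unfolding cr[symmetric] by (simp only: of_real_diff of_real_divide of_real_1 of_real_of_nat_eq)
      define R where "R x = of_real c * (g x - h x)" for x
      define b where "b x = of_real (1 / ?M) * (g x - of_real A * sgn (fourier \<psi> k) * character k x)" for x
      define \<beta> where "\<beta> = 2 * A / ?M"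
      \<comment> \<open>The bound that the induction hypothesis gives for the norm of \<open>R\<close>.\<close>
      define \<alpha> where "\<alpha> = sqrt (12 * t * A\<^sup>2 * real m) / ?M"
      have \<beta>: "0 < \<beta>" using A by (simp add: \<beta>_def)
      have \<alpha>0: "0 \<le> \<alpha>" using t by (simp add: \<alpha>_def)
      have \<alpha>2: "\<alpha>\<^sup>2 = 12 * t * A\<^sup>2 * real m / ?M\<^sup>2" using t by (simp add: \<alpha>_def power_divide)
      have [measurable]: "R \<in> borel_measurable borel" "b \<in> borel_measurable borel"
        unfolding R_def[abs_def] b_def[abs_def] by measurable
      have split: "g x - ?h' x = R x + b x" for x
      proof -
        have c1: "complex_of_real c = 1 - complex_of_real (1 / ?M)"
          unfolding cr[symmetric] by (simp only: of_real_diff of_real_1)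
        have h': "?h' x = (1 - complex_of_real (1 / ?M)) * h x + of_real (1 / ?M) * (of_real A * sgn (fourier \<psi> k) * character k x)"
          unfolding cc c1 by (simp add: A_def del: of_nat_Suc)
        have ring: "u - ((1 - w) * v + w * z) = (1 - w) * (u - v) + w * (u - z)" for u v w z :: complex
          by (simp add: algebra_simps)
        show ?thesis unfolding h' R_def b_def c1 by (rule ring)
      qed
      have Rb: "AE x in torus. cmod (g x - h x) \<le> 2 * A"
        using gA
      proof eventually_elim
        case (elim x)
        then show ?case using norm_triangle_ineq4[of "g x" "h x"] hb(3)[of x] unfolding A_def by linarith
      qed
      have \<psi>b: "AE x in torus. cmod (\<psi> x) \<le> (2 * A) powr (t - 2) * (2 * A)"
        using Rb unfolding step.hyps(2) by eventually_elim (rule norm_norming_le[OF t])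
      have [measurable]: "\<psi> \<in> borel_measurable borel" unfolding step.hyps(2) by measurable
      have \<psi>i: "integrable torus \<psi>" by (rule torus.integrable_const_bound[OF \<psi>b]) simp
      have gi: "integrable torus g" by (rule torus.integrable_const_bound[OF gA]) simp
      have kmax: "cmod (fourier \<psi> l) \<le> cmod (fourier \<psi> k)" for l
        using step.hyps(3) by (auto simp: is_arg_max_def not_less)
      have igp: "integrable torus (\<lambda>x. g x * cnj (\<psi> x))"
      proof (rule torus.integrable_const_bound[of _ "A * ((2 * A) powr (t - 2) * (2 * A))"])
        show "AE x in torus. norm (g x * cnj (\<psi> x)) \<le> A * ((2 * A) powr (t - 2) * (2 * A))"
          using gA \<psi>b by eventually_elim (use A0 in \<open>auto simp: norm_mult intro!: mult_mono\<close>)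
      qed simp
      have ik: "integrable torus (\<lambda>x. character k x * cnj (\<psi> x))"
        using integrable_cnj[OF characters.integrable_times_e[OF \<psi>i, of k]] by (simp add: mult.commute)
      have intk: "(\<integral>x. character k x * cnj (\<psi> x) \<partial>torus) = cnj (fourier \<psi> k)"
        unfolding fourier_def Bochner_Integration.integral_cnj[symmetric] by (simp add: mult.commute)
      have lin0: "Re (\<integral>x. (g x - of_real A * sgn (fourier \<psi> k) * character k x) * cnj (\<psi> x) \<partial>torus) \<le> 0"
      proof -
        have "(\<integral>x. (g x - of_real A * sgn (fourier \<psi> k) * character k x) * cnj (\<psi> x) \<partial>torus)
           = (\<integral>x. g x * cnj (\<psi> x) \<partial>torus) - of_real A * sgn (fourier \<psi> k) * (\<integral>x. character k x * cnj (\<psi> x) \<partial>torus)"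
          using igp ik by (simp add: left_diff_distrib mult.assoc)
        also have "of_real A * sgn (fourier \<psi> k) * (\<integral>x. character k x * cnj (\<psi> x) \<partial>torus) = of_real (A * cmod (fourier \<psi> k))"
        proof -
          have "sgn z * cnj z = of_real (cmod z)" for z :: complex
            by (cases "z = 0") (simp_all add: sgn_eq complex_norm_square[symmetric] power2_eq_square)
          then show ?thesis unfolding intk by (simp add: mult.assoc)
        qed
        finally have "Re (\<integral>x. (g x - of_real A * sgn (fourier \<psi> k) * character k x) * cnj (\<psi> x) \<partial>torus)
           = Re (\<integral>x. g x * cnj (\<psi> x) \<partial>torus) - A * cmod (fourier \<psi> k)" by simp
        also have "Re (\<integral>x. g x * cnj (\<psi> x) \<partial>torus) \<le> A * cmod (fourier \<psi> k)"
          using complex_Re_le_cmod[of "\<integral>x. g x * cnj (\<psi> x) \<partial>torus"] Wiener_duality[OF g \<psi>i kmax] unfolding A_def by linarith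
        finally show ?thesis by simp
      qed
      have lin: "(\<integral>x. cmod (R x) powr (t - 2) * Re (cnj (R x) * b x) \<partial>torus) \<le> 0"
      proof -
        have e: "cmod (R x) powr (t - 2) * Re (cnj (R x) * b x)
          = (c powr (t - 2) * c / ?M) * Re ((g x - of_real A * sgn (fourier \<psi> k) * character k x) * cnj (\<psi> x))" for x
        proof -
          have 1: "cmod (R x) powr (t - 2) = c powr (t - 2) * cmod (g x - h x) powr (t - 2)"
            using c0 by (simp add: R_def norm_mult powr_mult)
          have 2: "cnj (R x) * b x = of_real (c / ?M) * (cnj (g x - h x) * (g x - of_real A * sgn (fourier \<psi> k) * character k x))"
            by (simp add: R_def b_def del: of_nat_Suc complex_cnj_diff)
          have 3: "cnj (\<psi> x) = of_real (cmod (g x - h x) powr (t - 2)) * cnj (g x - h x)"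
            by (simp add: step.hyps(2) norming_def del: complex_cnj_diff)
          define z where "z = cnj (g x - h x) * (g x - of_real A * sgn (fourier \<psi> k) * character k x)"
          have 4: "(g x - of_real A * sgn (fourier \<psi> k) * character k x) * cnj (\<psi> x) = of_real (cmod (g x - h x) powr (t - 2)) * z"
            unfolding 3 z_def by (simp only: mult_ac)
          show ?thesis unfolding 4 unfolding 1 2 z_def[symmetric] by simp
        qed
        have ii: "integrable torus (\<lambda>x. (g x - of_real A * sgn (fourier \<psi> k) * character k x) * cnj (\<psi> x))"
          using igp ik by (simp add: left_diff_distrib mult.assoc)
        have "(\<integral>x. cmod (R x) powr (t - 2) * Re (cnj (R x) * b x) \<partial>torus)
          = (c powr (t - 2) * c / ?M) * Re (\<integral>x. (g x - of_real A * sgn (fourier \<psi> k) * character k x) * cnj (\<psi> x) \<partial>torus)"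
          unfolding e integral_mult_right_zero integral_Re[OF ii] ..
        also have "\<dots> \<le> 0" using lin0 c0 by (intro mult_nonneg_nonpos) auto
        finally show ?thesis .
      qed
      have "(\<integral>x. cmod (R x + b x) powr t \<partial>torus) \<le> (\<alpha>\<^sup>2 + 3 * t * \<beta>\<^sup>2) powr (t / 2)"
      proof (rule torus.smoothness_step[OF t _ _ _ _ \<beta> _ _ lin])
        show "AE x in torus. cmod (R x) \<le> c * (2 * A)"
          using Rb by eventually_elim (use c0 in \<open>simp add: R_def norm_mult\<close>)
        show "AE x in torus. cmod (b x) \<le> \<beta>"
          using gA
        proof eventually_elim
          case (elim x)
          have "cmod (of_real A * sgn (fourier \<psi> k) * character k x) \<le> A"
            using A0 by (simp add: norm_mult norm_sgn)
          then have "cmod (g x - of_real A * sgn (fourier \<psi> k) * character k x) \<le> 2 * A"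
            using norm_triangle_ineq4[of "g x" "of_real A * sgn (fourier \<psi> k) * character k x"] elim by linarith
          then show ?case by (simp add: b_def \<beta>_def norm_mult norm_divide divide_right_mono del: of_nat_Suc)
        qed
        show "t * \<beta> \<le> \<alpha>"
        proof (rule power2_le_imp_le[OF _ \<alpha>0])
          have "(t * \<beta>)\<^sup>2 = t * (4 * t * A\<^sup>2) / ?M\<^sup>2" by (simp add: \<beta>_def power_divide power_mult_distrib power2_eq_square)
          also have "\<dots> \<le> (3 * real m) * (4 * t * A\<^sup>2) / ?M\<^sup>2" using tm t by (intro divide_right_mono mult_right_mono) auto
          also have "\<dots> = \<alpha>\<^sup>2" unfolding \<alpha>2 by (simp del: of_nat_Suc)
          finally show "(t * \<beta>)\<^sup>2 \<le> \<alpha>\<^sup>2" .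
        qed
        have "(\<integral>x. cmod (R x) powr t \<partial>torus) = c powr t * (\<integral>x. cmod (g x - h x) powr t \<partial>torus)"
          using c0 by (simp add: R_def norm_mult powr_mult)
        also have "\<dots> \<le> c powr t * (12 * t * A\<^sup>2 / real m) powr (t / 2)"
          using step.IH m by (intro mult_left_mono) (auto simp: max_def)
        also have "\<dots> = (c\<^sup>2 * (12 * t * A\<^sup>2 / real m)) powr (t / 2)"
        proof -
          have "c powr t = (c\<^sup>2) powr (t / 2)" using c0 by (simp add: square_powr)
          then show ?thesis by (simp only: powr_mult)
        qed
        also have "c\<^sup>2 * (12 * t * A\<^sup>2 / real m) = \<alpha>\<^sup>2"
          unfolding \<alpha>2 c_def using m by (simp add: power_divide power2_eq_square del: of_nat_Suc)
        also have "(\<alpha>\<^sup>2) powr (t / 2) = \<alpha> powr t" using \<alpha>0 by (simp add: square_powr)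
        finally show "(\<integral>x. cmod (R x) powr t \<partial>torus) \<le> \<alpha> powr t" .
      qed simp_all
      also have "\<alpha>\<^sup>2 + 3 * t * \<beta>\<^sup>2 = 12 * t * A\<^sup>2 / ?M"
      proof -
        have "\<alpha>\<^sup>2 + 3 * t * \<beta>\<^sup>2 = (12 * t * A\<^sup>2 * (real m + 1)) / ?M\<^sup>2"
          unfolding \<alpha>2 \<beta>_def by (simp add: power_divide add_divide_distrib[symmetric] algebra_simps del: of_nat_Suc)
        also have "real m + 1 = ?M" by simp
        finally show ?thesis by (simp add: power2_eq_square del: of_nat_Suc)
      qed
      finally show ?thesis unfolding split maxM .
    qed
  qed
qed

lemma periodic_diff: "periodic f \<Longrightarrow> periodic g \<Longrightarrow> periodic (\<lambda>x. f x - g x)"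
  by (simp add: periodic_def)

text \<open>The constant \<open>4\<close> is a convenient upper bound for \<open>sqrt 12\<close>.\<close>

theorem incremental_greedy_exists:
  obtains G :: "real \<Rightarrow> nat \<Rightarrow> 'd::finite tfun \<Rightarrow> 'd tfun"
  where "incremental_greedy G" "greedy_type_methods 4 1 G"
proof -
  define G :: "real \<Rightarrow> nat \<Rightarrow> 'd tfun \<Rightarrow> 'd tfun" where "G t m g = (SOME h. greedy_output t g m h)" for t m g
  have G: "greedy_output t g m (G t m g)" if "2 \<le> t" "g \<in> Wiener" for t m g
    unfolding G_def by (rule someI_ex[OF greedy_output_exists[OF that(2,1)]])
  show thesis
  proof (rule that[of G])
    show "incremental_greedy G" unfolding incremental_greedy_def using G by blast
    show "greedy_type_methods 4 1 G"
      unfolding greedy_type_methods_def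
    proof (intro allI impI ballI conjI)
      fix t :: real and m and g :: "'d tfun" assume t: "2 \<le> t" and g: "g \<in> Wiener"
      let ?h = "G t m g"
      note out = G[OF t g, of m]
      note hb = greedy_output_bounds[OF out]
      show "?h \<in> m_term m" by (rule hb(1))
      show "A_norm ?h \<le> 1 * A_norm g" using hb(2) by simp
      have [measurable]: "g \<in> borel_measurable borel" "?h \<in> borel_measurable borel"
        using g m_term_properties(1)[OF hb(1)] by (auto simp: Wiener_def Lp_def)
      have "integrable torus (\<lambda>x. cmod (g x - ?h x) powr t)"
      proof (rule torus.integrable_const_bound[of _ "(2 * A_norm g) powr t"])
        show "AE x in torus. norm (cmod (g x - ?h x) powr t) \<le> (2 * A_norm g) powr t"
          using Wiener_pointwise(3)[OF g]
        proof eventually_elim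
          case (elim x)
          then have "cmod (g x - ?h x) \<le> 2 * A_norm g"
            using norm_triangle_ineq4[of "g x" "?h x"] hb(3)[of x] by linarith
          then show ?case using t by (auto intro!: powr_mono2)
        qed
      qed simp
      then have Lp: "(\<lambda>x. g x - ?h x) \<in> Lp t"
        using g m_term_properties(2)[OF hb(1)] by (auto simp: Lp_def Wiener_def intro!: periodic_diff)
      have "(\<integral>x. cmod (g x - ?h x) powr t \<partial>torus) powr (1/t) \<le> ((12 * t * (A_norm g)\<^sup>2 / real (max m 1)) powr (t / 2)) powr (1/t)"
        using greedy_output_error[OF g t out] t by (intro powr_mono2) auto
      also have "\<dots> = (12 * t * (A_norm g)\<^sup>2 / real (max m 1)) powr (1/2)" using t by (simp add: powr_powr)
      also have "\<dots> \<le> (16 * t * (A_norm g)\<^sup>2 / real (max m 1)) powr (1/2)"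
        using t by (intro powr_mono2 divide_right_mono mult_right_mono) auto
      also have "\<dots> = 4 * real (max m 1) powr (- 1/2) * t powr (1/2) * A_norm g"
        using A_norm_nonneg[of g] t
        by (simp add: powr_half_sqrt powr_minus_divide real_sqrt_mult real_sqrt_divide)
      finally show "Lp_norm t (\<lambda>x. g x - ?h x) \<le> ennreal (4 * real (max m 1) powr (- 1/2) * t powr (1/2) * A_norm g)"
        using Lp by (simp add: Lp_norm_def ennreal_leI)
    qed
  qed
qed

section \<open>An extremal function\<close>

text \<open>\<open>min (1 / D) N \<le> 2 / (D + 1 / N)\<close>, and the right-hand side has an elementary primitive once the
  chord is replaced by its linear lower bounds at both ends of the period.\<close>

lemma integral_min_chord:
  fixes N :: real
  assumes N: "1 \<le> N"
  shows "(\<integral>x. min (1 / chord x) N \<partial>circle) \<le> ln (4 * N + 1)"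
proof -
  define g where "g x = 2 / (2 / pi * x + 1 / N)" for x :: real
  define G where "G x = pi * ln (2 / pi * x + 1 / N) - pi * ln (2 / pi * (2 * pi - x) + 1 / N)" for x
  have pos: "0 < 2 / pi * x + 1 / N" if "0 \<le> x" for x using that N by (intro add_nonneg_pos) auto
  have G: "has_bochner_integral lborel (\<lambda>x. (g x + g (2 * pi - x)) * indicator {0..2*pi} x) (G (2 * pi) - G 0)"
  proof (rule has_bochner_integral_FTC_Icc_real)
    fix x :: real assume x: "0 \<le> x" "x \<le> 2 * pi"
    have p: "0 < 2 / pi * x + 1 / N" "0 < 2 / pi * (2 * pi - x) + 1 / N" using x by (auto intro!: pos simp del: times_divide_eq_left)
    have "(G has_real_derivative pi * (2 / pi / (2 / pi * x + 1 / N)) - pi * (- (2 / pi) / (2 / pi * (2 * pi - x) + 1 / N))) (at x)"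
      unfolding G_def[abs_def] using p
      by (intro DERIV_diff DERIV_cmult) (auto intro!: derivative_eq_intros)
    moreover have "pi * (2 / pi / (2 / pi * x + 1 / N)) - pi * (- (2 / pi) / (2 / pi * (2 * pi - x) + 1 / N)) = g x + g (2 * pi - x)"
      by (simp add: g_def)
    ultimately show "(G has_real_derivative g x + g (2 * pi - x)) (at x)" by simp
    show "isCont (\<lambda>x. g x + g (2 * pi - x)) x"
      unfolding g_def using p by (intro continuous_intros) auto
  qed auto
  have e: "G (2 * pi) - G 0 = 2 * pi * ln (4 * N + 1)"
  proof -
    have 1: "ln (4 + 1 / N) = ln (4 * N + 1) - ln N"
    proof -
      have "4 + 1 / N = (4 * N + 1) / N" using N by (simp add: field_simps)
      then show ?thesis using N by (simp add: ln_div)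
    qed
    have 2: "ln (1 / N) = - ln N" using N by (simp add: ln_div)
    have "G (2 * pi) - G 0 = 2 * (pi * ln (4 + 1 / N)) - 2 * (pi * ln (1 / N))" by (simp add: G_def)
    then show ?thesis unfolding 1 2 by (simp add: algebra_simps)
  qed
  have le: "min (1 / chord x) N \<le> g x + g (2 * pi - x)" if x: "x \<in> {0..2*pi}" for x
  proof -
    have m: "min (1 / D) N \<le> 2 / (D + 1 / N)" if D: "0 \<le> D" for D
    proof (cases "D \<ge> 1 / N")
      case True
      then have D0: "0 < D" using N by (auto intro: less_le_trans[of 0 "1/N"])
      have "min (1 / D) N \<le> 2 / (2 * D)" by simp
      also have "\<dots> \<le> 2 / (D + 1 / N)" using True D0 N by (intro divide_left_mono mult_pos_pos add_pos_pos) auto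
      finally show ?thesis .
    next
      case False
      have "min (1 / D) N \<le> 2 / (2 / N)" by simp
      also have "\<dots> \<le> 2 / (D + 1 / N)" using False D N by (intro divide_left_mono mult_pos_pos add_nonneg_pos) auto
      finally show ?thesis .
    qed
    have gnn: "0 \<le> g y" if "0 \<le> y" for y using pos[OF that] by (simp add: g_def)
    have cc: "min (1 / chord x) N \<le> 2 / (chord x + 1 / N)" by (rule m[OF chord_nonneg])
    have mono: "2 / (chord x + 1 / N) \<le> g y" if "0 \<le> y" "2 / pi * y \<le> chord x" for y
      unfolding g_def using that pos[OF that(1)] N chord_nonneg[of x]
      by (intro divide_left_mono add_right_mono mult_pos_pos add_nonneg_pos) auto
    show ?thesis
    proof (cases "x \<le> pi")
      case True
      then show ?thesis using cc mono[of x] chord_ge(1)[of x] x gnn[of "2 * pi - x"] by auto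
    next
      case False
      then show ?thesis using cc mono[of "2 * pi - x"] chord_ge(2)[of x] x gnn[of x] by auto
    qed
  qed
  have bnn: "0 \<le> min (1 / chord x) N" for x using N chord_nonneg[of x] by simp
  have "integrable circle (\<lambda>x. min (1 / chord x) N)"
    by (rule circle.integrable_const_bound[of _ N]) (use bnn in auto)
  then have i: "integrable lborel (\<lambda>x. indicator {0..2*pi} x *\<^sub>R min (1 / chord x) N)"
    by (subst (asm) integral_circle(2)) (auto simp: set_integrable_def)
  have "(\<integral>x. min (1 / chord x) N \<partial>circle) = 1 / (2 * pi) * (\<integral>x. indicator {0..2*pi} x *\<^sub>R min (1 / chord x) N \<partial>lborel)"
    by (subst integral_circle(1)) (auto simp: set_lebesgue_integral_def)
  also have "\<dots> \<le> 1 / (2 * pi) * (\<integral>x. (g x + g (2 * pi - x)) * indicator {0..2*pi} x \<partial>lborel)"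
  proof (rule mult_left_mono[OF integral_mono])
    show "integrable lborel (\<lambda>x. (g x + g (2 * pi - x)) * indicator {0..2*pi} x)" using G by (rule integrable.intros)
    show "indicator {0..2*pi} x *\<^sub>R min (1 / chord x) N \<le> (g x + g (2 * pi - x)) * indicator {0..2*pi} x" for x
      using le[of x] by (simp add: indicator_def)
  qed (use i in auto)
  also have "(\<integral>x. (g x + g (2 * pi - x)) * indicator {0..2*pi} x \<partial>lborel) = 2 * pi * ln (4 * N + 1)"
    using has_bochner_integral_integral_eq[OF G] e by simp
  finally show ?thesis by simp
qed

text \<open>The sum is bounded by \<open>q b powr (1/q)\<close> everywhere, and by a multiple of \<open>chord x powr (- 1/q)\<close>
  where the chord is positive.  Its \<open>q\<close>-th power is therefore at most a multiple of \<open>min (1 / chord x) b\<close>,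
  whose integral is logarithmic.\<close>

lemma power_block_norm:
  fixes q :: real
  assumes q: "1 < q"
  obtains C where "0 < C" and "\<And>a b. 1 \<le> a \<Longrightarrow> a \<le> b \<Longrightarrow>
     (\<integral>x. cmod (\<Sum>k=a..b. of_real (real k powr (- (1 - 1/q))) * cis (real k * x)) powr q \<partial>circle) \<le> C * ln (4 * real b + 1)"
proof -
  define r where "r = 1 - 1/q"
  have r: "0 < r" "r < 1" using q by (auto simp: r_def)
  define c where "c = 2 * (3 / (1 - r) + 2)"
  have c: "0 < c" using r by (simp add: c_def add_pos_pos)
  define C where "C = max (c powr q) (q powr q)"
  have C: "0 < C" using c by (simp add: C_def less_max_iff_disj)
  show thesis
  proof (rule that[OF C])
    fix a b :: nat assume ab: "1 \<le> a" "a \<le> b"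
    define S where "S x = (\<Sum>k=a..b. of_real (real k powr (- r)) * cis (real k * x) :: complex)" for x
    have [measurable]: "S \<in> borel_measurable borel"
      unfolding S_def[abs_def] by (intro borel_measurable_continuous_onI continuous_intros)
    have triv: "cmod (S x) \<le> q * real b powr (1/q)" for x
    proof -
      have "cmod (S x) \<le> (\<Sum>k=a..b. real k powr (- r))" unfolding S_def by (rule sum_norm_le) (simp add: norm_mult)
      also have "\<dots> \<le> (\<Sum>k=1..b. real k powr (- r))" by (rule sum_mono2) (use ab in auto)
      also have "\<dots> \<le> real b powr (1 - r) / (1 - r)" by (rule sum_powr_le[OF r])
      finally show ?thesis by (simp add: r_def mult.commute)
    qed
    have nontriv: "cmod (S x) \<le> c * chord x powr (- (1/q))" if x: "chord x > 0" for x
    proof -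
      let ?s = "\<lambda>k. of_real (real k powr (- r)) * cis (real k * x) :: complex"
      have "(\<Sum>k=1..b. ?s k) = (\<Sum>k=1..a-1. ?s k) + S x"
        using sum.ub_add_nat[of 1 "a - 1" ?s "b - (a - 1)"] ab by (simp add: S_def)
      then have "S x = (\<Sum>k=1..b. ?s k) - (\<Sum>k=1..a-1. ?s k)" by simp
      then have "cmod (S x) \<le> cmod (\<Sum>k=1..b. ?s k) + cmod (\<Sum>k=1..a-1. ?s k)" by (simp only: norm_triangle_ineq4)
      also have "\<dots> \<le> (3 / (1 - r) + 2) * chord x powr (r - 1) + (3 / (1 - r) + 2) * chord x powr (r - 1)"
        by (intro add_mono trig_sum_bound[OF r x])
      also have "r - 1 = - (1/q)" by (simp add: r_def)
      finally show ?thesis unfolding c_def mult.assoc by linarith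
    qed
    have pt: "cmod (S x) powr q \<le> C * min (1 / chord x) (real b)" if x: "chord x > 0" for x
    proof -
      have "cmod (S x) powr q \<le> (q * real b powr (1/q)) powr q" using triv q by (intro powr_mono2) auto
      also have "\<dots> = q powr q * real b" using q by (simp add: powr_mult powr_powr)
      also have "\<dots> \<le> C * real b" by (intro mult_right_mono) (auto simp: C_def)
      finally have 1: "cmod (S x) powr q \<le> C * real b" .
      have "cmod (S x) powr q \<le> (c * chord x powr (- (1/q))) powr q" using nontriv[OF x] q by (intro powr_mono2) auto
      also have "\<dots> = c powr q * (1 / chord x)" unfolding powr_mult powr_powr using q x by (simp add: powr_minus_divide)
      also have "\<dots> \<le> C * (1 / chord x)" using x by (intro mult_right_mono) (auto simp: C_def)
      finally have 2: "cmod (S x) powr q \<le> C * (1 / chord x)" .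
      show ?thesis using 1 2 by (simp add: min_def)
    qed
    have bnn: "0 \<le> min (1 / chord x) (real b)" for x using chord_nonneg[of x] by simp
    have "(\<integral>x. cmod (S x) powr q \<partial>circle) \<le> (\<integral>x. C * min (1 / chord x) (real b) \<partial>circle)"
    proof (rule integral_mono_AE)
      show "integrable circle (\<lambda>x. cmod (S x) powr q)"
        by (rule circle.integrable_const_bound[of _ "(q * real b powr (1/q)) powr q"]) (use triv q in \<open>auto intro!: powr_mono2\<close>)
      show "integrable circle (\<lambda>x. C * min (1 / chord x) (real b))"
        by (intro integrable_mult_right, rule circle.integrable_const_bound[of _ "real b"]) (use bnn in auto)
      show "AE x in circle. cmod (S x) powr q \<le> C * min (1 / chord x) (real b)"
        using AE_chord_pos by eventually_elim (rule pt)
    qed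
    also have "\<dots> \<le> C * ln (4 * real b + 1)"
      using integral_min_chord[of "real b"] ab C by (simp add: mult_left_mono)
    finally show "(\<integral>x. cmod (\<Sum>k=a..b. of_real (real k powr (- (1 - 1/q))) * cis (real k * x)) powr q \<partial>circle) \<le> C * ln (4 * real b + 1)"
      by (simp add: S_def r_def)
  qed
qed

definition box_freqs :: "nat \<Rightarrow> nat \<Rightarrow> (int^'d::finite) set" where
  "box_freqs a b = {k. \<forall>j. k $ j \<in> {int a..int b}}"

lemma finite_box_freqs: "finite (box_freqs a b :: (int^'d::finite) set)"
  unfolding box_freqs_def by (rule finite_vec_box) simp

text \<open>Polynomials whose coefficients on a box are products factor over the coordinates.\<close>

lemma prod_box_expand:
  fixes g :: "int \<Rightarrow> complex"
  shows "(\<Sum>k\<in>box_freqs a b. (\<Prod>j\<in>UNIV. g (k $ j)) * character k (x :: real^'d::finite)) = (\<Prod>j\<in>UNIV. \<Sum>n=int a..int b. g n * mode n (x $ j))"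
proof -
  have "(\<Prod>j\<in>UNIV. \<Sum>n=int a..int b. g n * mode n (x $ j)) = (\<Sum>k\<in>PiE UNIV (\<lambda>_. {int a..int b}). \<Prod>j\<in>UNIV. g (k j) * mode (k j) (x $ j))"
    by (rule prod_sum_PiE) auto
  also have "\<dots> = (\<Sum>k\<in>box_freqs a b. \<Prod>j\<in>UNIV. g (k $ j) * mode (k $ j) (x $ j))"
    by (rule sum.reindex_bij_witness[of _ "\<lambda>k. ($) k" "vec_lambda"]) (auto simp: box_freqs_def)
  finally show ?thesis by (simp add: prod.distrib character_eq_prod)
qed

text \<open>The convolution factor \<open>\<phi>\<close> has coefficients of modulus proportional to \<open>W powr (-(1 - 1/q))\<close>, the borderline of
  the Hardy-Littlewood inequality, with phases that cancel those of the kernel.  It is a product,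
  so its norm is the \<open>d\<close>-th power of a one-dimensional one.\<close>

lemma extremal_function:
  fixes q :: real
  assumes q: "1 < q" "q \<le> 2"
  obtains C where "0 < C" and "\<And>a b. 1 \<le> a \<Longrightarrow> a \<le> b \<Longrightarrow>
     (\<lambda>x. \<Sum>k\<in>box_freqs a b. of_real ((C * ln (4 * real b + 1)) powr (- real CARD('d) / q) / Wt k) * character k x) \<in> (W_class (1/q) q :: 'd::finite tfun set)"
proof -
  obtain C where C: "0 < C" and block: "\<And>a b. 1 \<le> a \<Longrightarrow> a \<le> b \<Longrightarrow>
     (\<integral>x. cmod (\<Sum>k=a..b. of_real (real k powr (- (1 - 1/q))) * cis (real k * x)) powr q \<partial>circle) \<le> C * ln (4 * real b + 1)"
    using power_block_norm[OF q(1)] by blast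
  have r: "0 < 1/q" "1/q < 1" using q by auto
  show thesis
  proof (rule that[OF C])
    fix a b :: nat assume ab: "1 \<le> a" "a \<le> b"
    define lg where "lg = C * ln (4 * real b + 1)"
    have lg: "0 < lg" using C ab by (simp add: lg_def)
    define s where "s = lg powr (- 1/q)"
    have s: "0 < s" using lg by (simp add: s_def)
    \<comment> \<open>The factor \<open>cis\<close> cancels the phase of the kernel coefficients at positive frequencies.\<close>
    define g where "g n = of_real (s * wt n powr (- (1 - 1/q))) * cis (1/q * pi/2)" for n :: int
    define \<phi>1 where "\<phi>1 t = (\<Sum>n=int a..int b. g n * mode n t)" for t
    define \<phi> :: "'d tfun" where "\<phi> x = (\<Sum>k\<in>box_freqs a b. (\<Prod>j\<in>UNIV. g (k $ j)) * character k x)" for x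
    define f :: "'d tfun" where "f x = (\<Sum>k\<in>box_freqs a b. of_real (lg powr (- real CARD('d) / q) / Wt k) * character k x)" for x
    have m\<phi> [measurable]: "\<phi> \<in> borel_measurable borel" unfolding \<phi>_def[abs_def] by measurable
    have mf [measurable]: "f \<in> borel_measurable borel" unfolding f_def[abs_def] by measurable
    have m1 [measurable]: "\<phi>1 \<in> borel_measurable borel" unfolding \<phi>1_def[abs_def] by measurable
    have per\<phi>: "periodic \<phi>" "periodic f" by (simp_all add: periodic_def \<phi>_def f_def character_periodic)
    have \<phi>prod: "\<phi> x = (\<Prod>j\<in>UNIV. \<phi>1 (x $ j))" for x
      unfolding \<phi>_def \<phi>1_def by (rule prod_box_expand)
    have \<phi>1_norm: "cmod (\<phi>1 t) = s * cmod (\<Sum>k=a..b. of_real (real k powr (- (1 - 1/q))) * cis (real k * t))" for t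
    proof -
      have "\<phi>1 t = (\<Sum>k=a..b. g (int k) * mode (int k) t)"
        unfolding \<phi>1_def by (rule sum.reindex_bij_witness[of _ int nat]) auto
      also have "\<dots> = (\<Sum>k=a..b. of_real s * cis (1/q * pi/2) * (of_real (real k powr (- (1 - 1/q))) * cis (real k * t)))"
      proof (rule sum.cong)
        fix k assume "k \<in> {a..b}"
        then have "wt (int k) = real k" using ab by (simp add: wt_def max_def)
        then show "g (int k) * mode (int k) t = of_real s * cis (1/q * pi/2) * (of_real (real k powr (- (1 - 1/q))) * cis (real k * t))"
          by (simp add: g_def mult_ac)
      qed simp
      also have "\<dots> = of_real s * cis (1/q * pi/2) * (\<Sum>k=a..b. of_real (real k powr (- (1 - 1/q))) * cis (real k * t))"
        by (rule sum_distrib_left[symmetric])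
      finally show ?thesis using s by (simp add: norm_mult)
    qed
    have int1: "integrable circle (\<lambda>t. cmod (\<phi>1 t) powr q)"
    proof (rule circle.integrable_const_bound[of _ "(\<Sum>n=int a..int b. cmod (g n)) powr q"])
      show "AE t in circle. norm (cmod (\<phi>1 t) powr q) \<le> (\<Sum>n=int a..int b. cmod (g n)) powr q"
        unfolding \<phi>1_def using q by (auto intro!: AE_I2 powr_mono2 modes.bounded_poly)
    qed simp
    have I1: "(\<integral>t. cmod (\<phi>1 t) powr q \<partial>circle) \<le> 1"
    proof -
      have "(\<integral>t. cmod (\<phi>1 t) powr q \<partial>circle) = s powr q * (\<integral>x. cmod (\<Sum>k=a..b. of_real (real k powr (- (1 - 1/q))) * cis (real k * x)) powr q \<partial>circle)"
        unfolding \<phi>1_norm powr_mult by simp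
      also have "\<dots> \<le> s powr q * lg" unfolding lg_def by (intro mult_left_mono block ab) auto
      also have "\<dots> = 1" using q lg powr_add[of lg "-1" 1] by (simp add: s_def powr_powr)
      finally show ?thesis .
    qed
    have cp: "complex_of_real (cmod (\<phi> x) powr q) = (\<Prod>j\<in>UNIV. complex_of_real (cmod (\<phi>1 (x $ j)) powr q))" for x
      unfolding \<phi>prod by (simp add: prod_norm[symmetric] prod_powr_distrib)
    have ii: "integrable circle (\<lambda>t. complex_of_real (cmod (\<phi>1 t) powr q))" using int1 by simp
    have i\<phi>: "integrable torus (\<lambda>x. cmod (\<phi> x) powr q)"
    proof -
      have "integrable torus (\<lambda>x. complex_of_real (cmod (\<phi> x) powr q))"
        unfolding cp by (rule integral_torus_prod(1)[OF ii])
      then show ?thesis by (simp only: complex_of_real_integrable_eq)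
    qed
    have "complex_of_real (\<integral>x. cmod (\<phi> x) powr q \<partial>torus) = complex_of_real ((\<integral>t. cmod (\<phi>1 t) powr q \<partial>circle) ^ CARD('d))"
      unfolding integral_complex_of_real[symmetric] cp
      by (subst integral_torus_prod(2)[OF ii]) (simp add: integral_complex_of_real)
    then have "(\<integral>x. cmod (\<phi> x) powr q \<partial>torus) = (\<integral>t. cmod (\<phi>1 t) powr q \<partial>circle) ^ CARD('d)"
      by (simp only: of_real_eq_iff)
    also have "\<dots> \<le> 1" using I1 by (intro power_le_one) auto
    finally have I: "(\<integral>x. cmod (\<phi> x) powr q \<partial>torus) \<le> 1" .
    have nq: "Lp_norm q \<phi> \<le> 1"
    proof -
      have "\<phi> \<in> Lp q" using i\<phi> per\<phi> by (simp add: Lp_def)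
      moreover have "(\<integral>x. cmod (\<phi> x) powr q \<partial>torus) powr (1/q) \<le> 1 powr (1/q)"
        using I q by (intro powr_mono2) auto
      ultimately show ?thesis by (simp add: Lp_norm_def)
    qed
    have \<phi>i: "integrable torus \<phi>" unfolding \<phi>_def by (rule characters.integrable_poly)
    have fi: "integrable torus f" unfolding f_def by (rule characters.integrable_poly)
    have "AE x in torus. f x = convolution \<phi> (F_kernel_mixed (1/q)) x"
    proof (rule fourier_unique[OF fi])
      show "integrable torus (convolution \<phi> (F_kernel_mixed (1/q)))" by (rule fourier_convolution(1)[OF r \<phi>i])
      fix k
      have "fourier (convolution \<phi> (F_kernel_mixed (1/q))) k = fourier \<phi> k * (\<Prod>j\<in>UNIV. F_coeff (1/q) (k $ j))"
        by (rule fourier_convolution(2)[OF r \<phi>i])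
      also have "\<dots> = (if k \<in> box_freqs a b then (\<Prod>j\<in>UNIV. g (k $ j) * F_coeff (1/q) (k $ j)) else 0)"
        unfolding \<phi>_def[abs_def] by (simp add: fourier_poly finite_box_freqs prod.distrib)
      also have "\<dots> = (if k \<in> box_freqs a b then of_real (lg powr (- real CARD('d) / q) / Wt k) else 0)"
      proof -
        have "(\<Prod>j\<in>UNIV. g (k $ j) * F_coeff (1/q) (k $ j)) = of_real (lg powr (- real CARD('d) / q) / Wt k)" if k: "k \<in> box_freqs a b"
        proof -
          have "g n * F_coeff (1/q) n = of_real (s / wt n)" if n: "n \<ge> 1" for n
          proof -
            have w: "wt n = real_of_int n" "wt n > 0" using n by (auto simp: wt_def max_def)
            have "cis (1/q * pi/2) * cis (- (1/q * pi/2)) = 1" by (simp add: cis_mult)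
            moreover have "F_coeff (1/q) n = of_real (wt n powr (- (1/q))) * cis (- (1/q * pi/2))"
              using n w by (simp add: F_coeff_def)
            ultimately have "g n * F_coeff (1/q) n = of_real (s * (wt n powr (- (1 - 1/q)) * wt n powr (- (1/q))))"
              by (simp add: g_def mult_ac)
            also have "wt n powr (- (1 - 1/q)) * wt n powr (- (1/q)) = 1 / wt n"
              unfolding powr_add[symmetric] using w by (simp add: powr_minus_divide)
            finally show ?thesis by simp
          qed
          then have "(\<Prod>j\<in>UNIV. g (k $ j) * F_coeff (1/q) (k $ j)) = (\<Prod>j\<in>UNIV. complex_of_real (s / wt (k $ j)))"
            using k ab by (intro prod.cong) (auto simp: box_freqs_def order_trans[of 1 "int a"])
          also have "\<dots> = complex_of_real (s ^ CARD('d) / Wt k)"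
            by (simp add: Wt_def prod_dividef)
          also have "s ^ CARD('d) = lg powr (- real CARD('d) / q)"
            using s by (simp add: s_def powr_realpow[symmetric] powr_powr)
          finally show ?thesis .
        qed
        then show ?thesis by simp
      qed
      also have "\<dots> = fourier f k" unfolding f_def[abs_def] by (simp only: fourier_poly[OF finite_box_freqs])
      finally show "fourier f k = fourier (convolution \<phi> (F_kernel_mixed (1/q))) k" by simp
    qed
    then have "f \<in> W_class (1/q) q"
      unfolding W_class_def using nq per\<phi> by auto
    then show "(\<lambda>x. \<Sum>k\<in>box_freqs a b. of_real ((C * ln (4 * real b + 1)) powr (- real CARD('d) / q) / Wt k) * character k x) \<in> (W_class (1/q) q :: 'd tfun set)"
      unfolding f_def[abs_def] lg_def .
  qed
qed

section \<open>The lower bound\<close>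

lemma m_term_as_poly:
  assumes "u \<in> m_term m"
  obtains K a where "finite K" "card K \<le> m" "u = (\<lambda>x. \<Sum>l\<in>K. a l * character l x)"
proof -
  from assms obtain k c where u: "u = (\<lambda>x. \<Sum>j<m. c j * character (k j) x)" by (auto simp: m_term_def)
  show thesis
    by (intro that[of "k ` {..<m}" "\<lambda>l. \<Sum>j\<in>{j\<in>{..<m}. k j = l}. c j"])
       (auto simp: u collect_frequencies intro: card_image_le[THEN order_trans])
qed

text \<open>A Fejer kernel with an arbitrary finite set in place of an interval; nonnegativity and the integral
  \<open>1\<close> do not depend on the shape of \<open>Q\<close>.\<close>

definition fejer :: "(int^'d::finite) set \<Rightarrow> real^'d \<Rightarrow> real" where
  "fejer Q x = (cmod (\<Sum>k\<in>Q. character k x))\<^sup>2 / real (card Q)"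

lemma measurable_fejer [measurable]: "fejer Q \<in> borel_measurable borel"
  unfolding fejer_def[abs_def] by measurable

text \<open>The coefficient at \<open>n\<close> counts the pairs in \<open>Q\<close> with difference \<open>n\<close>.\<close>

lemma fejer_props:
  fixes Q :: "(int^'d::finite) set"
  assumes Q: "finite Q" "Q \<noteq> {}"
  shows "0 \<le> fejer Q x" "fejer Q x \<le> real (card Q)" "(\<integral>x. fejer Q x \<partial>torus) = 1"
    and "fourier (\<lambda>x. complex_of_real (fejer Q x)) n = of_real (real (card {l\<in>Q. l + n \<in> Q}) / real (card Q))"
proof -
  have c: "0 < real (card Q)" using Q by (simp add: card_gt_0_iff)
  show "0 \<le> fejer Q x" by (simp add: fejer_def)
  have "cmod (\<Sum>k\<in>Q. character k x) \<le> real (card Q)" using norm_sum[of "\<lambda>k. character k x" Q] by simp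
  then have "(cmod (\<Sum>k\<in>Q. character k x))\<^sup>2 \<le> (real (card Q))\<^sup>2" by (intro power_mono) auto
  then show "fejer Q x \<le> real (card Q)" using c by (simp add: fejer_def divide_le_eq power2_eq_square)
  show "(\<integral>x. fejer Q x \<partial>torus) = 1"
    using characters.parseval_poly[OF Q(1), of "\<lambda>_. 1"] c by (simp add: fejer_def)
  have poly: "(\<Sum>k\<in>Q. character k x) = (\<Sum>k\<in>Q. 1 * character k x)" for x by simp
  have e: "complex_of_real (fejer Q x) * cnj (character n x)
      = (1 / of_nat (card Q)) * ((\<Sum>k\<in>Q. 1 * character k x) * cnj (\<Sum>l\<in>(\<lambda>l. l + n) ` Q. 1 * character l x))" for x
  proof -
    have "(\<Sum>l\<in>(\<lambda>l. l + n) ` Q. 1 * character l x) = (\<Sum>k\<in>Q. character k x) * character n x"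
      by (subst sum.reindex) (auto simp: character_add sum_distrib_right)
    moreover have "complex_of_real (fejer Q x) = (\<Sum>k\<in>Q. character k x) * cnj (\<Sum>k\<in>Q. character k x) / of_nat (card Q)"
      by (simp only: fejer_def of_real_divide complex_norm_square of_real_of_nat_eq)
    ultimately show ?thesis by (simp add: mult.assoc)
  qed
  have "fourier (\<lambda>x. complex_of_real (fejer Q x)) n = (1 / of_nat (card Q)) *
      (\<integral>x. (\<Sum>k\<in>Q. 1 * character k x) * cnj (\<Sum>l\<in>(\<lambda>l. l + n) ` Q. 1 * character l x) \<partial>torus)"
    unfolding fourier_def e by (rule integral_mult_right_zero)
  also have "(\<integral>x. (\<Sum>k\<in>Q. 1 * character k x) * cnj (\<Sum>l\<in>(\<lambda>l. l + n) ` Q. 1 * character l x) \<partial>torus)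
      = (\<Sum>l\<in>(\<lambda>l. l + n) ` Q. cnj 1 * (\<integral>x. (\<Sum>k\<in>Q. 1 * character k x) * cnj (character l x) \<partial>torus))"
    by (rule characters.integral_times_cnj_poly[OF characters.integrable_poly])
  also have "\<dots> = (\<Sum>l\<in>(\<lambda>l. l + n) ` Q. if l \<in> Q then 1 else 0)"
    unfolding characters.integral_poly_e[OF Q(1)] by simp
  also have "\<dots> = (\<Sum>l\<in>Q. if l + n \<in> Q then 1 else 0)"
    by (subst sum.reindex) (auto simp: inj_on_def)
  also have "\<dots> = of_nat (card {l\<in>Q. l + n \<in> Q})"
    using Q by (simp add: sum.If_cases Int_def)
  finally show "fourier (\<lambda>x. complex_of_real (fejer Q x)) n = of_real (real (card {l\<in>Q. l + n \<in> Q}) / real (card Q))"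
    by simp
qed

text \<open>Let \<open>K\<close> be the set of frequencies of \<open>u\<close>, and \<open>h\<close> the part of the Fejer kernel with frequencies in
  \<open>K\<close>.  The kernel minus \<open>h\<close> is orthogonal to \<open>u\<close>, and pairing it with the error returns the
  weighted sum of the coefficients \<open>F n\<close> outside \<open>K\<close>.  Hoelder's inequality bounds this pairing: the
  kernel has \<open>L_p'\<close> norm at most \<open>|Q| powr (1/p)\<close>, because it is nonnegative with integral \<open>1\<close> and
  bounded by \<open>|Q|\<close>, while \<open>h\<close> has \<open>L_2\<close> norm at most \<open>sqrt m\<close>.\<close>

lemma m_term_error_lower_bound:
  fixes Q S :: "(int^'d::finite) set" and F :: "int^'d \<Rightarrow> real"
  assumes p: "2 < p" and Q: "finite Q" "Q \<noteq> {}" and S: "finite S"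
    and F: "\<And>n. n \<in> S \<Longrightarrow> 0 \<le> F n" "\<And>n. n \<in> S \<Longrightarrow> F n \<le> \<beta>" "0 \<le> \<beta>"
    and r0: "0 \<le> r0" "\<And>n. n \<in> S \<Longrightarrow> r0 * real (card Q) \<le> real (card {l\<in>Q. l + n \<in> Q})"
    and u: "u \<in> m_term m"
  shows "r0 * ((\<Sum>n\<in>S. F n) - real m * \<beta>)
     \<le> (real (card Q) powr (1/p) + real m powr (1/2)) *
        (\<integral>x. cmod ((\<Sum>n\<in>S. of_real (F n) * character n x) - u x) powr p \<partial>torus) powr (1/p)"
proof -
  obtain K a where K: "finite K" "card K \<le> m" and ua: "u = (\<lambda>x. \<Sum>l\<in>K. a l * character l x)"
    using m_term_as_poly[OF u] by blast
  define r where "r n = real (card {l\<in>Q. l + n \<in> Q}) / real (card Q)" for n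
  have c: "0 < real (card Q)" using Q by (simp add: card_gt_0_iff)
  have r1: "0 \<le> r n" "r n \<le> 1" for n
    using c Q card_mono[of Q "{l\<in>Q. l + n \<in> Q}"] by (auto simp: r_def divide_le_eq)
  define v where "v n = (if n \<in> S then of_real (F n) else 0) - (if n \<in> K then a n else 0)" for n
  define e where "e x = (\<Sum>n\<in>S \<union> K. v n * character n x)" for x
  have e_eq: "(\<Sum>n\<in>S. of_real (F n) * character n x) - u x = e x" for x
  proof -
    have "(\<Sum>n\<in>S. of_real (F n) * character n x) = (\<Sum>n\<in>S \<union> K. (if n \<in> S then of_real (F n) else 0) * character n x)"
      by (rule sum.mono_neutral_cong_left) (use S K in auto)
    moreover have "u x = (\<Sum>n\<in>S \<union> K. (if n \<in> K then a n else 0) * character n x)"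
      unfolding ua by (rule sum.mono_neutral_cong_left) (use S K in auto)
    ultimately show ?thesis by (simp only: e_def v_def left_diff_distrib sum_subtractf)
  qed
  have me [measurable]: "e \<in> borel_measurable borel" unfolding e_def[abs_def] by measurable
  define E where "E = (\<Sum>n\<in>S \<union> K. cmod (v n))"
  have eb: "cmod (e x) \<le> E" for x unfolding e_def E_def by (rule characters.bounded_poly)
  have ei: "integrable torus (\<lambda>x. cmod (e x) powr s)" if "0 \<le> s" for s
    by (rule torus.integrable_const_bound[of _ "E powr s"]) (use eb that in \<open>auto intro!: powr_mono2\<close>)
  define h where "h x = (\<Sum>n\<in>K. of_real (r n) * character n x)" for x
  have mh [measurable]: "h \<in> borel_measurable borel" unfolding h_def[abs_def] by measurable
  define I where "I = (\<integral>x. cmod (e x) powr p \<partial>torus)"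
  let ?g = "\<lambda>x. complex_of_real (fejer Q x)"
  have gi: "integrable torus ?g"
    by (rule torus.integrable_const_bound[of _ "real (card Q)"]) (use fejer_props(1,2)[OF Q] in auto)
  have fQ: "integrable torus (fejer Q)" using gi by (simp only: complex_of_real_integrable_eq)
  have hi: "integrable torus h" unfolding h_def by (rule characters.integrable_poly)
  have four: "fourier (\<lambda>x. ?g x - h x) n = (if n \<in> K then 0 else of_real (r n))" for n
  proof -
    have "fourier (\<lambda>x. ?g x - h x) n = fourier ?g n - fourier h n"
      unfolding fourier_def left_diff_distrib
      by (rule Bochner_Integration.integral_diff) (rule characters.integrable_times_e gi hi)+
    also have "fourier h n = (if n \<in> K then of_real (r n) else 0)"
      unfolding h_def[abs_def] by (rule fourier_poly[OF K(1)])
    also have "fourier ?g n = of_real (r n)" unfolding r_def by (rule fejer_props(4)[OF Q])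
    finally show ?thesis by simp
  qed
  have "(\<integral>x. (?g x - h x) * cnj (e x) \<partial>torus) = (\<Sum>n\<in>S \<union> K. cnj (v n) * fourier (\<lambda>x. ?g x - h x) n)"
    unfolding e_def fourier_def by (rule characters.integral_times_cnj_poly) (use gi hi in auto)
  also have "\<dots> = (\<Sum>n\<in>S - K. of_real (F n * r n))"
    unfolding four by (rule sum.mono_neutral_cong_right) (use S K in \<open>auto simp: v_def\<close>)
  also have "\<dots> = of_real (\<Sum>n\<in>S - K. F n * r n)" by simp
  finally have J: "cmod (\<integral>x. (?g x - h x) * cnj (e x) \<partial>torus) = (\<Sum>n\<in>S - K. F n * r n)"
    using F(1) r1 by (simp only: norm_of_real) (auto intro!: abs_of_nonneg sum_nonneg)
  have low: "r0 * ((\<Sum>n\<in>S. F n) - real m * \<beta>) \<le> (\<Sum>n\<in>S - K. F n * r n)"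
  proof -
    have "(\<Sum>n\<in>S \<inter> K. F n) \<le> real (card (S \<inter> K)) * \<beta>"
      using F(2) sum_bounded_above[of "S \<inter> K" F \<beta>] by simp
    also have "\<dots> \<le> real m * \<beta>"
      using K card_mono[of K "S \<inter> K"] F(3) by (intro mult_right_mono) auto
    finally have "(\<Sum>n\<in>S. F n) - real m * \<beta> \<le> (\<Sum>n\<in>S - K. F n)"
      using sum.Int_Diff[OF S, of F K] by simp
    then have "r0 * ((\<Sum>n\<in>S. F n) - real m * \<beta>) \<le> r0 * (\<Sum>n\<in>S - K. F n)" using r0(1) by (rule mult_left_mono)
    also have "\<dots> \<le> (\<Sum>n\<in>S - K. F n * r n)"
      unfolding sum_distrib_left
    proof (rule sum_mono)
      fix n assume n: "n \<in> S - K"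
      then have "r0 \<le> r n" using r0(2)[of n] c by (simp add: r_def le_divide_eq)
      then have "F n * r0 \<le> F n * r n" using F(1)[of n] n by (intro mult_left_mono) auto
      then show "r0 * F n \<le> F n * r n" by (simp add: mult.commute)
    qed
    finally show ?thesis .
  qed
  have I0: "0 \<le> I" by (simp add: I_def)
  define p' where "p' = p / (p - 1)"
  have p': "1 < p'" "1/p + 1/p' = 1" using p by (auto simp: p'_def field_simps)
  have gpi: "integrable torus (\<lambda>x. fejer Q x powr p')"
    by (rule torus.integrable_const_bound[of _ "real (card Q) powr p'"]) (use fejer_props(1,2)[OF Q] p' in \<open>auto intro!: powr_mono2\<close>)
  have b1: "(\<integral>x. fejer Q x * cmod (e x) \<partial>torus) \<le> real (card Q) powr (1/p) * I powr (1/p)"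
  proof -
    have H: "integrable torus (\<lambda>x. cmod (e x) * fejer Q x)"
      "(\<integral>x. cmod (e x) * fejer Q x \<partial>torus) \<le> I powr (1/p) * (\<integral>x. fejer Q x powr p' \<partial>torus) powr (1/p')"
      unfolding I_def using p p' fejer_props(1)[OF Q] ei[of p] gpi
        integral_hoelder[of p p' "\<lambda>x. cmod (e x)" torus "fejer Q"] by auto
    have "(\<integral>x. fejer Q x powr p' \<partial>torus) \<le> (\<integral>x. real (card Q) powr (p' - 1) * fejer Q x \<partial>torus)"
    proof (rule integral_mono[OF gpi])
      show "integrable torus (\<lambda>x. real (card Q) powr (p' - 1) * fejer Q x)" using fQ by simp
      fix x
      have "fejer Q x powr p' = fejer Q x powr (p' - 1) * fejer Q x"
        using fejer_props(1)[OF Q, of x] by (cases "fejer Q x = 0") (simp_all add: powr_diff)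
      also have "\<dots> \<le> real (card Q) powr (p' - 1) * fejer Q x"
        using fejer_props(1,2)[OF Q, of x] p' by (intro mult_right_mono powr_mono2) auto
      finally show "fejer Q x powr p' \<le> real (card Q) powr (p' - 1) * fejer Q x" .
    qed
    also have "\<dots> = real (card Q) powr (p' - 1)" by (simp add: fejer_props(3)[OF Q])
    finally have "(\<integral>x. fejer Q x powr p' \<partial>torus) powr (1/p') \<le> (real (card Q) powr (p' - 1)) powr (1/p')"
      using p' by (intro powr_mono2) auto
    also have "\<dots> = real (card Q) powr (1/p)"
    proof -
      have "(p' - 1) * (1/p') = 1/p" using p' by (simp add: diff_divide_distrib)
      then show ?thesis by (simp only: powr_powr)
    qed
    finally have "I powr (1/p) * (\<integral>x. fejer Q x powr p' \<partial>torus) powr (1/p') \<le> I powr (1/p) * real (card Q) powr (1/p)"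
      by (rule mult_left_mono) simp
    with H(2) show ?thesis by (simp add: mult.commute)
  qed
  have b2: "(\<integral>x. cmod (h x) * cmod (e x) \<partial>torus) \<le> real m powr (1/2) * I powr (1/p)"
  proof -
    have hb: "cmod (h x) \<le> (\<Sum>n\<in>K. cmod (of_real (r n)))" for x unfolding h_def by (rule characters.bounded_poly)
    have h2: "integrable torus (\<lambda>x. cmod (h x) powr 2)"
      by (rule torus.integrable_const_bound[of _ "(\<Sum>n\<in>K. cmod (of_real (r n))) powr 2"]) (use hb in \<open>auto intro!: power_mono sum_nonneg\<close>)
    have "(\<integral>x. cmod (h x) * cmod (e x) \<partial>torus) \<le> (\<integral>x. cmod (h x) powr 2 \<partial>torus) powr (1/2) * (\<integral>x. cmod (e x) powr 2 \<partial>torus) powr (1/2)"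
      using h2 ei[of 2] by (intro integral_hoelder) auto
    also have "(\<integral>x. cmod (e x) powr 2 \<partial>torus) powr (1/2) \<le> (I powr (2/p)) powr (1/2)"
      unfolding I_def using p ei by (intro powr_mono2 torus.integral_powr_mono(2)) auto
    also have "(I powr (2/p)) powr (1/2) = I powr (1/p)" by (simp add: powr_powr)
    also have "(\<integral>x. cmod (h x) powr 2 \<partial>torus) powr (1/2) \<le> real m powr (1/2)"
    proof (rule powr_mono2)
      have "(\<integral>x. cmod (h x) powr 2 \<partial>torus) = (\<integral>x. (cmod (h x))\<^sup>2 \<partial>torus)" by simp
      also have "\<dots> = (\<Sum>n\<in>K. (cmod (of_real (r n)))\<^sup>2)" unfolding h_def by (rule characters.parseval_poly[OF K(1)])
      also have "\<dots> \<le> (\<Sum>n\<in>K. 1)" using r1 by (intro sum_mono) (simp add: power_le_one)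
      also have "\<dots> \<le> real m" using K(2) by simp
      finally show "(\<integral>x. cmod (h x) powr 2 \<partial>torus) \<le> real m" .
    qed auto
    finally show ?thesis by (simp add: mult_right_mono mult_left_mono)
  qed
  have B: "integrable torus (\<lambda>x. k x * cmod (e x))" if "integrable torus k" for k :: "real^'d \<Rightarrow> real"
  proof -
    have "integrable torus (\<lambda>x. complex_of_real (k x) * complex_of_real (cmod (e x)))"
      by (rule integrable_times_bounded[of _ _ _ E]) (use that eb in auto)
    then show ?thesis by (simp only: of_real_mult[symmetric] complex_of_real_integrable_eq)
  qed
  have "cmod (\<integral>x. (?g x - h x) * cnj (e x) \<partial>torus) \<le> (\<integral>x. fejer Q x * cmod (e x) + cmod (h x) * cmod (e x) \<partial>torus)"
  proof (rule order_trans[OF integral_norm_bound integral_mono])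
    show "integrable torus (\<lambda>x. fejer Q x * cmod (e x) + cmod (h x) * cmod (e x))"
      by (intro Bochner_Integration.integrable_add B fQ integrable_norm hi)
    show "cmod ((?g x - h x) * cnj (e x)) \<le> fejer Q x * cmod (e x) + cmod (h x) * cmod (e x)" for x
    proof -
      have "cmod (?g x - h x) \<le> fejer Q x + cmod (h x)"
        using norm_triangle_ineq4[of "?g x" "h x"] fejer_props(1)[OF Q, of x] by simp
      then have "cmod (?g x - h x) * cmod (e x) \<le> (fejer Q x + cmod (h x)) * cmod (e x)" by (rule mult_right_mono) simp
      then show ?thesis by (simp add: norm_mult distrib_right)
    qed
    have "integrable torus (\<lambda>x. (?g x - h x) * cnj (e x))"
      by (rule integrable_times_bounded[of _ _ _ E]) (use gi hi eb in auto)
    then show "integrable torus (\<lambda>x. cmod ((?g x - h x) * cnj (e x)))" by (rule integrable_norm)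
  qed
  also have "\<dots> = (\<integral>x. fejer Q x * cmod (e x) \<partial>torus) + (\<integral>x. cmod (h x) * cmod (e x) \<partial>torus)"
  proof (rule Bochner_Integration.integral_add)
    show "integrable torus (\<lambda>x. fejer Q x * cmod (e x))" by (rule B[OF fQ])
    show "integrable torus (\<lambda>x. cmod (h x) * cmod (e x))" by (rule B[OF integrable_norm[OF hi]])
  qed
  also have "\<dots> \<le> (real (card Q) powr (1/p) + real m powr (1/2)) * I powr (1/p)"
    using b1 b2 by (simp add: distrib_right)
  finally show ?thesis using low unfolding J e_eq I_def by linarith
qed

lemma card_box_freqs: "real (card (box_freqs a b :: (int^'d::finite) set)) = real (Suc b - a) ^ CARD('d)"
proof -
  have "nat (int b - int a + 1) = Suc b - a" by linarith
  then show ?thesis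
    using sum_product_box[of "{int a..int b}" "\<lambda>_. 1", where ?'d = 'd] by (simp add: box_freqs_def)
qed

lemma sum_inverse_Wt_box:
  assumes "1 \<le> a"
  shows "(\<Sum>k\<in>box_freqs a b. 1 / Wt (k :: int^'d::finite)) = (\<Sum>n=a..b. 1 / real n) ^ CARD('d)"
proof -
  have "(\<Sum>k\<in>box_freqs a b. 1 / Wt (k :: int^'d)) = (\<Sum>n\<in>{int a..int b}. 1 / wt n) ^ CARD('d)"
    using sum_product_box[of "{int a..int b}" "\<lambda>n. 1 / wt n", where ?'d = 'd]
    by (simp add: box_freqs_def Wt_def prod_dividef)
  also have "(\<Sum>n\<in>{int a..int b}. 1 / wt n) = (\<Sum>n=a..b. 1 / real n)"
    by (rule sum.reindex_bij_witness[of _ int nat]) (use assms in \<open>auto simp: wt_def max_def\<close>)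
  finally show ?thesis .
qed

lemma harmonic_block_ge:
  assumes "1 \<le> a" "a \<le> b"
  shows "ln (real (Suc b)) - ln (real a) \<le> (\<Sum>n=a..b. 1 / real n)"
  using assms(2)
proof (induction b rule: dec_induct)
  have step: "ln (real (Suc n)) - ln (real n) \<le> 1 / real n" if "1 \<le> n" for n
  proof -
    have "ln (real (Suc n)) - ln (real n) = ln (1 + 1 / real n)"
    proof -
      have "1 + 1 / real n = real (Suc n) / real n" using that by (simp add: field_simps)
      then show ?thesis using that by (simp add: ln_div)
    qed
    also have "\<dots> \<le> 1 / real n" by (rule ln_add_one_self_le_self) simp
    finally show ?thesis .
  qed
  case base
  then show ?case using step[OF assms(1)] by simp
  fix n assume n: "a \<le> n" and IH: "ln (real (Suc n)) - ln (real a) \<le> (\<Sum>n=a..n. 1 / real n)"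
  show "ln (real (Suc (Suc n))) - ln (real a) \<le> (\<Sum>n=a..Suc n. 1 / real n)"
    using IH n step[of "Suc n"] by simp
qed

text \<open>The box \<open>[a, b]^d\<close> starts at \<open>a \<approx> m powr (1/d)\<close>, where \<open>W\<close> reaches \<open>m\<close>, and the cube
  \<open>[0, L)^d\<close> of the Fejer kernel has at most \<open>m powr (p/2)\<close> points.  Since \<open>b \<approx> L / 2\<close>, every frequency
  of the box keeps at least the fraction \<open>2^(-d)\<close> of the kernel.  The harmonic sum over
  \<open>[a, b]\<close> is of order \<open>(p/2 - 1) (log m) / d\<close>, which is positive because \<open>p > 2\<close>.\<close>

lemma best_m_term_class_lower:
  fixes q p :: real
  assumes q: "1 < q" "q \<le> 2" and p: "2 < p"
  obtains c where "0 < c" and "\<forall>\<^sub>F m in sequentially.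
    ennreal (c * (real m powr (- 1/2) * ln (real m) powr (real CARD('d) * (1 - 1 / q))))
      \<le> best_m_term_class m (W_class (1 / q) q :: 'd::finite tfun set) p"
proof -
  define d where "d = real CARD('d)"
  have d: "1 \<le> d" by (simp add: d_def Suc_leI)
  obtain C where C: "0 < C" and W: "\<And>a b. 1 \<le> a \<Longrightarrow> a \<le> b \<Longrightarrow>
     (\<lambda>x. \<Sum>k\<in>box_freqs a b. of_real ((C * ln (4 * real b + 1)) powr (- real CARD('d) / q) / Wt k) * character k x) \<in> (W_class (1/q) q :: 'd tfun set)"
    using extremal_function[OF q] by blast
  \<comment> \<open>The logarithm of the ratio of the end points of the box is about \<open>\<epsilon> ln m\<close>; half of it absorbs the rounding.\<close>
  define \<epsilon> where "\<epsilon> = p / (2 * d) - 1 / d"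
  have \<epsilon>: "0 < \<epsilon>" using p d by (simp add: \<epsilon>_def field_simps)
  define c1 where "c1 = \<epsilon> / 2"
  have c1: "0 < c1" using \<epsilon> by (simp add: c1_def)
  define c where "c = (1/2) powr d * (C * p) powr (- d / q) * c1 powr d / 4"
  have c: "0 < c" using C p c1 by (simp add: c_def)
  have main: "ennreal (c * (real m powr (- 1/2) * ln (real m) powr (real CARD('d) * (1 - 1 / q))))
      \<le> best_m_term_class m (W_class (1 / q) q :: 'd tfun set) p" if m3: "3 \<le> m" and ml: "2 \<le> c1 * ln (real m)" for m
  proof -
    have m0: "0 < real m" "1 \<le> real m" using m3 by auto
    have lm: "0 < ln (real m)" using m3 by simp
    define a where "a = nat \<lceil>real m powr (1/d)\<rceil>"
    define L where "L = nat \<lfloor>real m powr (p / (2 * d))\<rfloor>"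
    define b where "b = L div 2"
    have m1d: "1 \<le> real m powr (1/d)" using m0 d by (intro ge_one_powr_ge_zero) auto
    have a1: "1 \<le> a" "real m powr (1/d) \<le> real a" unfolding a_def using m1d by linarith+
    have a2: "real a \<le> 2 * real m powr (1/d)" unfolding a_def using m1d by linarith
    have mpd: "1 \<le> real m powr (p / (2 * d))" using m0 d p by (intro ge_one_powr_ge_zero) auto
    have L1: "1 \<le> L" "real L \<le> real m powr (p / (2 * d))" "real m powr (p / (2 * d)) \<le> real L + 1"
      unfolding L_def using mpd by (linarith, linarith, linarith)
    have bL: "2 * b \<le> L" "real L + 1 \<le> 2 * real (Suc b)"
    proof -
      show "2 * b \<le> L" unfolding b_def by simp
      have "L + 1 \<le> 2 * Suc b" unfolding b_def by presburger
      then have "real (L + 1) \<le> real (2 * Suc b)" by (simp only: of_nat_le_iff)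
      then show "real L + 1 \<le> 2 * real (Suc b)" by simp
    qed
    have ratio: "c1 * ln (real m) \<le> ln (real (Suc b)) - ln (real a)"
    proof -
      have "ln (real m powr (p / (2 * d)) / 2) \<le> ln (real (Suc b))"
        using L1 bL mpd m0 by (intro ln_mono) auto
      moreover have "ln (real a) \<le> ln (2 * real m powr (1/d))" using a1 a2 m0 by (intro ln_mono) auto
      moreover have "ln (real m powr (p / (2 * d)) / 2) = p / (2 * d) * ln (real m) - ln 2"
        using m0 by (simp add: ln_div ln_powr)
      moreover have "ln (2 * real m powr (1/d)) = ln 2 + 1/d * ln (real m)"
        using m0 by (simp add: ln_mult ln_powr)
      moreover have "p / (2 * d) * ln (real m) - 1/d * ln (real m) = 2 * (c1 * ln (real m))"
        by (simp add: c1_def \<epsilon>_def algebra_simps)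
      moreover have "ln 2 \<le> (1::real)" using ln_add_one_self_le_self[of 1] by simp
      ultimately show ?thesis using ml by linarith
    qed
    have ab: "a \<le> b"
    proof -
      have "ln (real a) < ln (real (Suc b))" using ratio ml by linarith
      then have "real a < real (Suc b)" using a1 by simp
      then show ?thesis by simp
    qed
    have b1: "1 \<le> b" using ab a1 by simp
    define H where "H = (\<Sum>n=a..b. 1 / real n)"
    have H: "c1 * ln (real m) \<le> H" unfolding H_def using ratio harmonic_block_ge[OF a1(1) ab] by linarith
    define lg where "lg = (C * ln (4 * real b + 1)) powr (- d / q)"
    have lg0: "0 < lg" using C b1 by (simp add: lg_def)
    have lg: "(C * p) powr (- d / q) * ln (real m) powr (- d / q) \<le> lg"
    proof -
      have "4 * real b + 1 \<le> real m powr p"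
      proof -
        have "4 * real b + 1 \<le> 3 * real L" using bL(1) L1(1) by linarith
        also have "\<dots> \<le> real m powr (p / 2) * real m powr (p / 2)"
        proof (rule mult_mono)
          have "3 \<le> real m powr 1" using m3 by simp
          also have "\<dots> \<le> real m powr (p / 2)" using m0 p by (intro powr_mono) auto
          finally show "3 \<le> real m powr (p / 2)" .
          have "p / (2 * d) \<le> p / 2" using p d by (intro divide_left_mono) auto
          then show "real L \<le> real m powr (p / 2)" using L1(2) m0 powr_mono[of "p / (2 * d)" "p / 2" "real m"] by linarith
        qed auto
        also have "\<dots> = real m powr p" by (simp add: powr_add[symmetric])
        finally show ?thesis .
      qed
      then have "ln (4 * real b + 1) \<le> p * ln (real m)"
        using m0 b1 ln_mono[of "4 * real b + 1" "real m powr p"] by (simp add: ln_powr)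
      then have "C * ln (4 * real b + 1) \<le> C * p * ln (real m)" using C by simp
      then have "(C * p * ln (real m)) powr (- d / q) \<le> lg"
        unfolding lg_def using C b1 d q by (intro powr_mono2') auto
      then show ?thesis by (simp only: powr_mult)
    qed
    let ?S = "box_freqs a b :: (int^'d) set" and ?Q = "box_freqs 0 (L - 1) :: (int^'d) set"
    define f :: "'d tfun" where "f x = (\<Sum>k\<in>?S. of_real (lg / Wt k) * character k x)" for x
    have fW: "f \<in> W_class (1/q) q" using W[OF a1(1) ab] unfolding f_def[abs_def] lg_def d_def .
    have cQ: "real (card ?Q) = real L ^ CARD('d)" using card_box_freqs[of 0 "L - 1", where ?'d='d] L1(1) by simp
    have Q: "finite ?Q" "?Q \<noteq> {}"
    proof -
      show "finite ?Q" by (rule finite_box_freqs)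
      have "real (card ?Q) > 0" unfolding cQ using L1(1) by simp
      then show "?Q \<noteq> {}" by auto
    qed
    have Wm: "real m \<le> Wt k" if k: "k \<in> ?S" for k
    proof -
      have "real m = (real m powr (1/d)) powr d" using m0 d by (simp add: powr_powr)
      also have "\<dots> \<le> real a powr d" using a1 m1d d by (intro powr_mono2) auto
      also have "\<dots> = (\<Prod>j\<in>(UNIV::'d set). real a)" using a1 by (simp add: d_def powr_realpow)
      also have "\<dots> \<le> Wt k"
        unfolding Wt_def
      proof (rule prod_mono, safe)
        fix j
        have "int a \<le> k $ j" using k by (auto simp: box_freqs_def)
        then show "real a \<le> wt (k $ j)" by (simp add: wt_def max_def)
      qed simp
      finally show ?thesis .
    qed
    have Lb: "ennreal (c * (real m powr (- 1/2) * ln (real m) powr (real CARD('d) * (1 - 1 / q)))) \<le> Lp_norm p (\<lambda>x. f x - u x)"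
      if u: "u \<in> m_term m" for u :: "'d tfun"
    proof (cases "(\<lambda>x. f x - u x) \<in> Lp p")
      case True
      define J where "J = (\<integral>x. cmod (f x - u x) powr p \<partial>torus) powr (1/p)"
      have J0: "0 \<le> J" by (simp add: J_def)
      have key: "(1/2) ^ CARD('d) * ((\<Sum>n\<in>?S. lg / Wt n) - real m * (lg / real m)) \<le> (real (card ?Q) powr (1/p) + real m powr (1/2)) * J"
        unfolding J_def f_def
      proof (rule m_term_error_lower_bound[OF p Q finite_box_freqs _ _ _ _ _ u])
        fix n assume n: "n \<in> ?S"
        show "0 \<le> lg / Wt n" using lg0 Wt_ge_1[of n] by simp
        show "lg / Wt n \<le> lg / real m" using lg0 Wm[OF n] m0 by (intro divide_left_mono) auto
        have sub: "(box_freqs 0 (L - 1 - b) :: (int^'d) set) \<subseteq> {l \<in> ?Q. l + n \<in> ?Q}"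
        proof
          fix l :: "int^'d" assume l: "l \<in> box_freqs 0 (L - 1 - b)"
          have "0 \<le> l $ j \<and> l $ j \<le> int (L - 1) \<and> 0 \<le> l $ j + n $ j \<and> l $ j + n $ j \<le> int (L - 1)" for j
          proof -
            have "0 \<le> l $ j" "l $ j \<le> int (L - 1 - b)" using l by (auto simp: box_freqs_def)
            moreover have "0 \<le> n $ j" "n $ j \<le> int b" using n by (auto simp: box_freqs_def intro: order_trans[of 0 "int a"])
            moreover have "int (L - 1 - b) + int b \<le> int (L - 1)" using bL(1) L1(1) by linarith
            ultimately show ?thesis by linarith
          qed
          then show "l \<in> {l \<in> ?Q. l + n \<in> ?Q}" by (auto simp: box_freqs_def)
        qed
        have "(1/2) ^ CARD('d) * real (card ?Q) = (real L / 2) ^ CARD('d)" unfolding cQ by (simp add: power_divide)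
        also have "\<dots> \<le> real (Suc (L - 1 - b) - 0) ^ CARD('d)" using bL(1) L1(1) by (intro power_mono) auto
        also have "\<dots> = real (card (box_freqs 0 (L - 1 - b) :: (int^'d) set))" by (rule card_box_freqs[symmetric])
        also have "\<dots> \<le> real (card {l \<in> ?Q. l + n \<in> ?Q})"
          using sub Q(1) by (intro of_nat_mono card_mono) auto
        finally show "(1/2) ^ CARD('d) * real (card ?Q) \<le> real (card {l \<in> ?Q. l + n \<in> ?Q})" .
      qed (use lg0 m0 in auto)
      have sumS: "(\<Sum>n\<in>?S. lg / Wt n) = lg * H ^ CARD('d)"
        using sum_inverse_Wt_box[OF a1(1), of b, where ?'d='d] by (simp add: H_def sum_distrib_left[symmetric] sum_divide_distrib[symmetric] divide_inverse)
      have QJ: "real (card ?Q) powr (1/p) \<le> real m powr (1/2)"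
      proof -
        have "real (card ?Q) = real L powr d" unfolding cQ using L1(1) by (simp add: d_def powr_realpow)
        also have "\<dots> \<le> (real m powr (p / (2 * d))) powr d" using L1 d by (intro powr_mono2) auto
        also have "\<dots> = real m powr (p / 2)" using d by (simp add: powr_powr)
        finally have "real (card ?Q) powr (1/p) \<le> (real m powr (p / 2)) powr (1/p)" using p by (intro powr_mono2) auto
        also have "\<dots> = real m powr (1/2)" using p by (simp add: powr_powr)
        finally show ?thesis .
      qed
      define y where "y = c1 * ln (real m)"
      have y: "2 \<le> y" using ml by (simp add: y_def)
      have Hd: "y ^ CARD('d) / 2 \<le> H ^ CARD('d) - 1"
      proof -
        have "y ^ CARD('d) \<le> H ^ CARD('d)" using H y by (intro power_mono) (auto simp: y_def)
        moreover have "2 \<le> y ^ CARD('d)" using y self_le_power[of y "CARD('d)"] by (simp add: Suc_leI)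
        ultimately show ?thesis by linarith
      qed
      have "(1/2) ^ CARD('d) * ((C * p) powr (- d / q) * ln (real m) powr (- d / q) * (y ^ CARD('d) / 2)) \<le> (1/2) ^ CARD('d) * (lg * (H ^ CARD('d) - 1))"
        using lg Hd lg0 y by (intro mult_left_mono mult_mono) auto
      also have "\<dots> = (1/2) ^ CARD('d) * ((\<Sum>n\<in>?S. lg / Wt n) - real m * (lg / real m))"
        unfolding sumS using m0 by (simp add: right_diff_distrib)
      also have "\<dots> \<le> (real (card ?Q) powr (1/p) + real m powr (1/2)) * J" by (rule key)
      also have "\<dots> \<le> (real m powr (1/2) + real m powr (1/2)) * J" using QJ J0 by (intro mult_right_mono) auto
      finally have fin: "(1/2) ^ CARD('d) * ((C * p) powr (- d / q) * ln (real m) powr (- d / q) * (y ^ CARD('d) / 2)) \<le> 2 * real m powr (1/2) * J" by simp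
      have yd: "y ^ CARD('d) = c1 powr d * ln (real m) powr d"
        using y by (simp add: d_def powr_realpow[symmetric] y_def powr_mult[symmetric])
      have ld: "ln (real m) powr (- d / q) * ln (real m) powr d = ln (real m) powr (d * (1 - 1/q))"
        unfolding powr_add[symmetric] by (simp add: algebra_simps)
      have "c * (real m powr (- 1/2) * ln (real m) powr (d * (1 - 1 / q)))
         = real m powr (- 1/2) / 2 * ((1/2) ^ CARD('d) * ((C * p) powr (- d / q) * ln (real m) powr (- d / q) * (y ^ CARD('d) / 2)))"
        unfolding yd ld[symmetric] by (simp add: c_def d_def powr_realpow mult_ac)
      also have "\<dots> \<le> real m powr (- 1/2) / 2 * (2 * real m powr (1/2) * J)"
        by (intro mult_left_mono fin) auto
      also have "\<dots> = (real m powr (- 1/2) * real m powr (1/2)) * J" by simp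
      also have "real m powr (- 1/2) * real m powr (1/2) = 1" using m0 unfolding powr_add[symmetric] by simp
      finally have "c * (real m powr (- 1/2) * ln (real m) powr (d * (1 - 1 / q))) \<le> J" by simp
      then show ?thesis using True by (simp add: Lp_norm_def J_def d_def ennreal_leI)
    qed (simp add: Lp_norm_def)
    have "ennreal (c * (real m powr (- 1/2) * ln (real m) powr (real CARD('d) * (1 - 1 / q)))) \<le> best_m_term m f p"
      unfolding best_m_term_def by (rule INF_greatest) (rule Lb)
    also have "\<dots> \<le> best_m_term_class m (W_class (1/q) q :: 'd tfun set) p"
      unfolding best_m_term_class_def by (rule SUP_upper[OF fW])
    finally show ?thesis .
  qed
  have "filterlim (\<lambda>m. c1 * ln (real m)) at_top sequentially"
    using c1 by (intro filterlim_tendsto_pos_mult_at_top[OF tendsto_const] filterlim_compose[OF ln_at_top filterlim_real_sequentially]) auto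
  then have "\<forall>\<^sub>F m in sequentially. 2 \<le> c1 * ln (real m)" by (auto simp: filterlim_at_top)
  then have "\<forall>\<^sub>F m in sequentially. ennreal (c * (real m powr (- 1/2) * ln (real m) powr (real CARD('d) * (1 - 1 / q))))
      \<le> best_m_term_class m (W_class (1 / q) q :: 'd tfun set) p"
    using eventually_ge_at_top[of 3] by eventually_elim (rule main)
  then show thesis using that c by blast
qed

section \<open>The upper bound and the exact order\<close>

lemma finite_dyadic_freqs: "finite (dyadic_freqs s :: (int^'d::finite) set)"
proof -
  have "\<forall>j. s $ j \<le> (\<Sum>j\<in>UNIV. s $ j)" by (auto intro: member_le_sum)
  then have "dyadic_freqs s \<subseteq> cube_freqs (\<Sum>j\<in>UNIV. s $ j)"
    by (auto simp: dyadic_freqs_def cube_freqs_def intro: less_le_trans power_increasing)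
  then show ?thesis using finite_cube_freqs finite_subset by blast
qed

lemma dyadic_interval_unique:
  fixes k :: int
  assumes "2 ^ s div 2 \<le> k" "k < 2 ^ s" "2 ^ s' div 2 \<le> k" "k < 2 ^ s'"
  shows "s = s'"
proof (rule ccontr)
  have *: False if "u < v" "k < 2 ^ u" "2 ^ v div 2 \<le> k" for u v :: nat
  proof -
    from that(1) obtain w where v: "v = Suc w" "u \<le> w" by (cases v) auto
    have "(2::int) ^ u \<le> 2 ^ w" using v by (intro power_increasing) auto
    with that v show False by simp
  qed
  assume "s \<noteq> s'"
  then show False using *[of s s'] *[of s' s] assms by (meson linorder_neqE_nat)
qed

lemma finite_bounded_levels: "finite {s :: nat^'d::finite. \<forall>j. s $ j \<le> n}"
  using finite_vec_box[of "{..n}"] by simp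

lemma cube_freqs_eq_dyadic: "cube_freqs n = (\<Union>s\<in>{s :: nat^'d::finite. \<forall>j. s $ j \<le> n}. dyadic_freqs s)"
proof safe
  fix k :: "int^'d" assume k: "k \<in> cube_freqs n"
  define s :: "nat^'d" where "s = (\<chi> j. LEAST u. \<bar>k $ j\<bar> < 2 ^ u)"
  have b: "\<bar>k $ j\<bar> < 2 ^ n" for j using k by (simp add: cube_freqs_def)
  have s1: "\<bar>k $ j\<bar> < 2 ^ (s $ j)" for j unfolding s_def using LeastI[of "\<lambda>u. \<bar>k $ j\<bar> < 2 ^ u" n] b by simp
  have s2: "s $ j \<le> n" for j unfolding s_def using Least_le[of "\<lambda>u. \<bar>k $ j\<bar> < 2 ^ u" n] b by simp
  have s3: "2 ^ (s $ j) div 2 \<le> \<bar>k $ j\<bar>" for j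
  proof (cases "s $ j")
    case (Suc u)
    then have "\<not> \<bar>k $ j\<bar> < 2 ^ u" using not_less_Least[of u "\<lambda>u. \<bar>k $ j\<bar> < 2 ^ u"] by (simp add: s_def)
    then show ?thesis using Suc by simp
  qed simp
  show "k \<in> (\<Union>s\<in>{s. \<forall>j. s $ j \<le> n}. dyadic_freqs s)"
    using s1 s2 s3 by (auto simp: dyadic_freqs_def intro!: exI[of _ s])
next
  fix k :: "int^'d" and s :: "nat^'d" assume s: "\<forall>j. s $ j \<le> n" and k: "k \<in> dyadic_freqs s"
  have "\<bar>k $ j\<bar> < 2 ^ n" for j
  proof -
    have "\<bar>k $ j\<bar> < 2 ^ (s $ j)" using k by (simp add: dyadic_freqs_def)
    also have "\<dots> \<le> 2 ^ n" using s by (intro power_increasing) auto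
    finally show ?thesis .
  qed
  then show "k \<in> cube_freqs n" by (simp add: cube_freqs_def)
qed

text \<open>Every integer of modulus less than \<open>2^n\<close> lies in exactly one dyadic interval of level at most \<open>n\<close>.\<close>

lemma sum_dyadic_blocks: "(\<Sum>s\<in>{s :: nat^'d::finite. \<forall>j. s $ j \<le> n}. dyadic_block s f x) = cube_sum n f x"
  unfolding dyadic_block_def cube_sum_def cube_freqs_eq_dyadic
proof (rule sum.UNION_disjoint[symmetric])
  show "\<forall>s\<in>{s :: nat^'d. \<forall>j. s $ j \<le> n}. \<forall>s'\<in>{s. \<forall>j. s $ j \<le> n}. s \<noteq> s' \<longrightarrow> dyadic_freqs s \<inter> dyadic_freqs s' = {}"
  proof (intro ballI impI)
    fix s s' :: "nat^'d" assume "s \<noteq> s'"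
    then obtain j where "s $ j \<noteq> s' $ j" by (auto simp: vec_eq_iff)
    then show "dyadic_freqs s \<inter> dyadic_freqs s' = {}"
      using dyadic_interval_unique[of "s $ j" _ "s' $ j"] by (fastforce simp: dyadic_freqs_def)
  qed
qed (auto simp: finite_bounded_levels finite_dyadic_freqs)

lemma cube_sum_Wiener:
  shows "cube_sum n f \<in> Wiener" and "A_norm (cube_sum n f) = (\<Sum>k\<in>cube_freqs n. cmod (fourier f k))"
proof -
  have "integrable torus (cube_sum n f)" unfolding cube_sum_def[abs_def] by (rule characters.integrable_poly)
  then have "integrable torus (\<lambda>x. cmod (cube_sum n f x) powr 1)" by simp
  moreover have "periodic (cube_sum n f)" by (simp add: periodic_def cube_sum_def character_periodic)
  moreover have e: "(\<lambda>k. cmod (fourier (cube_sum n f) k)) = (\<lambda>k. if k \<in> cube_freqs n then cmod (fourier f k) else 0)"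
    by (auto simp: fourier_cube_sum)
  have "(\<lambda>k. cmod (fourier (cube_sum n f) k)) summable_on UNIV"
    by (rule finite_nonzero_values_imp_summable_on)
       (rule finite_subset[OF _ finite_cube_freqs[of n]], auto simp: fourier_cube_sum)
  ultimately show "cube_sum n f \<in> Wiener" by (simp add: Wiener_def Lp_def)
  have "A_norm (cube_sum n f) = (\<Sum>\<^sub>\<infinity>k\<in>cube_freqs n. cmod (fourier f k))"
    unfolding A_norm_def by (rule infsum_cong_neutral) (auto simp: fourier_cube_sum)
  then show "A_norm (cube_sum n f) = (\<Sum>k\<in>cube_freqs n. cmod (fourier f k))"
    by (simp only: infsum_finite[OF finite_cube_freqs])
qed

lemma add_powr_le:
  fixes x y p :: real
  assumes "0 \<le> x" "0 \<le> y" "0 \<le> p"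
  shows "(x + y) powr p \<le> 2 powr p * (x powr p + y powr p)"
proof -
  have "(x + y) powr p \<le> (2 * max x y) powr p" using assms by (intro powr_mono2) auto
  also have "\<dots> = 2 powr p * max x y powr p" by (rule powr_mult)
  also have "max x y powr p \<le> x powr p + y powr p" by (auto simp: max_def)
  finally show ?thesis by (simp add: mult_left_mono)
qed

text \<open>Any enumeration of the blocks serves, as their order does not influence the partial sum.\<close>

definition cube_scheme :: "real \<Rightarrow> nat \<Rightarrow> nat \<Rightarrow> 'd::finite scheme" where
  "cube_scheme p n m = Compose (Greedy p m) (Partial_Sum (SOME ss. set ss = {s. \<forall>j. s $ j \<le> n}))"

lemma run_cube_scheme:
  fixes f :: "'d::finite tfun"
  shows "run G (cube_scheme p n m) f = G p m (cube_sum n f)"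
proof -
  have "set (SOME ss. set ss = {s :: nat^'d. \<forall>j. s $ j \<le> n}) = {s :: nat^'d. \<forall>j. s $ j \<le> n}"
    by (rule someI_ex[OF finite_list[OF finite_bounded_levels]])
  then show ?thesis by (simp add: cube_scheme_def sum_dyadic_blocks)
qed

text \<open>The constant \<open>\<kappa>\<close> is chosen such that \<open>n \<ge> \<kappa> ln m\<close> makes the \<open>p\<close>-th power \<open>\<rho> ^ n\<close> of the remainder at
  most \<open>m powr (-p/2)\<close>.  It depends on \<open>q\<close>, \<open>p\<close> and \<open>d\<close> only, and so the same schemes serve all greedy-type methods.\<close>

lemma cube_schemes_attain_order:
  fixes q p :: real
  assumes q: "1 < q" "q \<le> 2" and p: "2 < p"
  obtains n :: "nat \<Rightarrow> nat" where "\<And>(G :: real \<Rightarrow> nat \<Rightarrow> 'd::finite tfun \<Rightarrow> 'd tfun) C1 C2. greedy_type_methods C1 C2 G \<Longrightarrow>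
     attains_order G (\<lambda>m. cube_scheme p (n m) m) (W_class (1/q) q) p
       (\<lambda>m. real m powr (- 1/2) * ln (real m) powr (real CARD('d) * (1 - 1 / q)))"
proof -
  obtain C \<rho> where C: "0 < C" and \<rho>: "0 < \<rho>" "\<rho> < 1"
    and Wi: "\<And>(f :: 'd tfun) N. f \<in> W_class (1/q) q \<Longrightarrow> integrable torus (\<lambda>x. cmod (f x - cube_sum N f x) powr p)"
    and WE: "\<And>(f :: 'd tfun) N. f \<in> W_class (1/q) q \<Longrightarrow> (\<integral>x. cmod (f x - cube_sum N f x) powr p \<partial>torus) \<le> C * \<rho> ^ N"
    and WA: "\<And>(f :: 'd tfun) N. f \<in> W_class (1/q) q \<Longrightarrow> (\<Sum>k\<in>cube_freqs N. cmod (fourier f k)) \<le> C * (real (N + 1)) powr (CARD('d) * (1 - 1/q))"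
    using cube_sum_approximation[OF q p] by blast
  define e where "e = real CARD('d) * (1 - 1/q)"
  have e: "0 \<le> e" using q by (simp add: e_def)
  define \<kappa> where "\<kappa> = p / 2 / (- ln \<rho>)"
  have ln\<rho>: "ln \<rho> < 0" using \<rho> by simp
  have \<kappa>: "0 < \<kappa>" unfolding \<kappa>_def using p ln\<rho> by (intro divide_pos_pos) auto
  define n where "n m = nat \<lceil>\<kappa> * ln (real m)\<rceil>" for m
  define B where "B m = real m powr (- 1/2) * ln (real m) powr e" for m
  have ln1: "1 \<le> ln (real m)" if "3 \<le> m" for m
  proof -
    have "exp 1 \<le> (3::real)" by (rule exp_le)
    also have "\<dots> \<le> real m" using that by simp
    finally show ?thesis using that by (simp add: ln_ge_iff)
  qed
  have tail: "\<rho> ^ n m \<le> B m powr p" if m: "3 \<le> m" for m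
  proof -
    have "\<kappa> * ln (real m) \<le> real (n m)" unfolding n_def by linarith
    then have "real (n m) * ln \<rho> \<le> \<kappa> * ln (real m) * ln \<rho>" using ln\<rho> by (intro mult_right_mono_neg) auto
    also have "\<dots> = - (p/2) * ln (real m)" using ln\<rho> by (simp add: \<kappa>_def)
    finally have "exp (real (n m) * ln \<rho>) \<le> exp (- (p/2) * ln (real m))" by simp
    then have "\<rho> ^ n m \<le> real m powr (- (p/2))" using \<rho> m by (simp add: powr_def exp_of_nat_mult)
    also have "\<dots> = (real m powr (- 1/2)) powr p * 1" by (simp add: powr_powr)
    also have "\<dots> \<le> (real m powr (- 1/2)) powr p * (ln (real m) powr e) powr p"
      using ln1[OF m] e p by (intro mult_left_mono ge_one_powr_ge_zero) auto
    also have "\<dots> = B m powr p" unfolding B_def by (rule powr_mult[symmetric])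
    finally show ?thesis .
  qed
  have n1: "real (n m + 1) \<le> (\<kappa> + 2) * ln (real m)" if m: "3 \<le> m" for m
  proof -
    have "0 \<le> \<kappa> * ln (real m)" using \<kappa> ln1[OF m] by simp
    then have "real (n m) \<le> \<kappa> * ln (real m) + 1" unfolding n_def by linarith
    then show ?thesis using ln1[OF m] by (simp add: distrib_right)
  qed
  show thesis
  proof (rule that[of n])
    fix G :: "real \<Rightarrow> nat \<Rightarrow> 'd tfun \<Rightarrow> 'd tfun" and C1 C2
    assume G: "greedy_type_methods C1 C2 G"
    define K1 where "K1 = \<bar>C1\<bar> * p powr (1/2) * (C * (\<kappa> + 2) powr e)"
    have K1: "0 \<le> K1" using C by (simp add: K1_def)
    define K where "K = (2 powr p * (C + K1 powr p)) powr (1/p)"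
    have "0 < C + K1 powr p" using C by (simp add: add_pos_nonneg)
    then have K: "0 < K" by (simp add: K_def)
    have main: "run G (cube_scheme p (n m) m) f \<in> m_term m \<and> Lp_norm p (\<lambda>x. f x - run G (cube_scheme p (n m) m) f x) \<le> ennreal (K * B m)"
      if m: "3 \<le> m" and f: "f \<in> W_class (1/q) q" for m and f :: "'d tfun"
    proof -
      define S where "S = cube_sum (n m) f"
      define h where "h = G p m S"
      have S: "S \<in> Wiener" unfolding S_def by (rule cube_sum_Wiener)
      have hm: "h \<in> m_term m" and hn: "Lp_norm p (\<lambda>x. S x - h x) \<le> ennreal (C1 * real (max m 1) powr (- 1/2) * p powr (1/2) * A_norm S)"
        using G S p unfolding greedy_type_methods_def h_def by auto
      have B0: "0 \<le> B m" by (simp add: B_def)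
      have X: "C1 * real (max m 1) powr (- 1/2) * p powr (1/2) * A_norm S \<le> K1 * B m"
      proof -
        have "A_norm S \<le> C * (real (n m + 1)) powr e"
          unfolding S_def cube_sum_Wiener(2) e_def by (rule WA[OF f])
        also have "\<dots> \<le> C * ((\<kappa> + 2) * ln (real m)) powr e"
          using C e n1[OF m] by (intro mult_left_mono powr_mono2) auto
        also have "\<dots> = C * (\<kappa> + 2) powr e * ln (real m) powr e" by (simp add: powr_mult)
        finally have AS: "A_norm S \<le> C * (\<kappa> + 2) powr e * ln (real m) powr e" .
        have mm: "real (max m 1) = real m" using m by simp
        have "C1 * real (max m 1) powr (- 1/2) * p powr (1/2) * A_norm S = C1 * (real m powr (- 1/2) * p powr (1/2) * A_norm S)"
          unfolding mm by (simp only: mult.assoc)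
        also have "\<dots> \<le> \<bar>C1\<bar> * (real m powr (- 1/2) * p powr (1/2) * A_norm S)"
          using A_norm_nonneg[of S] by (intro mult_right_mono) auto
        also have "\<dots> \<le> \<bar>C1\<bar> * (real m powr (- 1/2) * p powr (1/2) * (C * (\<kappa> + 2) powr e * ln (real m) powr e))"
          by (intro mult_left_mono AS) auto
        also have "\<dots> = K1 * B m" by (simp only: K1_def B_def mult_ac)
        finally show ?thesis .
      qed
      have "Lp_norm p (\<lambda>x. S x - h x) \<le> ennreal (K1 * B m)"
        using hn ennreal_leI[OF X] by (rule order_trans)
      then have SL: "(\<lambda>x. S x - h x) \<in> Lp p" and Sn: "(\<integral>x. cmod (S x - h x) powr p \<partial>torus) powr (1/p) \<le> K1 * B m"
        using K1 B0 by (auto simp: Lp_norm_def top_unique ennreal_le_iff split: if_splits)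
      have Si: "integrable torus (\<lambda>x. cmod (S x - h x) powr p)" using SL by (simp add: Lp_def)
      have SI: "(\<integral>x. cmod (S x - h x) powr p \<partial>torus) \<le> (K1 * B m) powr p"
      proof -
        have "((\<integral>x. cmod (S x - h x) powr p \<partial>torus) powr (1/p)) powr p \<le> (K1 * B m) powr p"
          using Sn p by (intro powr_mono2) auto
        then show ?thesis using p by (simp add: powr_powr)
      qed
      have fm: "f \<in> borel_measurable borel" "periodic f" using f by (auto simp: W_class_def)
      note [measurable] = fm(1) m_term_properties(1)[OF hm]
      have pt: "cmod (f x - h x) powr p \<le> 2 powr p * (cmod (f x - S x) powr p + cmod (S x - h x) powr p)" for x
      proof -
        have "cmod (f x - h x) powr p \<le> (cmod (f x - S x) + cmod (S x - h x)) powr p"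
          using p norm_triangle_ineq[of "f x - S x" "S x - h x"] by (intro powr_mono2) auto
        also have "\<dots> \<le> 2 powr p * (cmod (f x - S x) powr p + cmod (S x - h x) powr p)"
          using p by (intro add_powr_le) auto
        finally show ?thesis .
      qed
      have ri: "integrable torus (\<lambda>x. 2 powr p * (cmod (f x - S x) powr p + cmod (S x - h x) powr p))"
        using Si Wi[OF f, of "n m"] by (simp add: S_def)
      have fi: "integrable torus (\<lambda>x. cmod (f x - h x) powr p)"
        by (rule Bochner_Integration.integrable_bound[OF ri]) (use pt in \<open>auto intro!: AE_I2 order_trans[OF _ abs_ge_self]\<close>)
      have fL: "(\<lambda>x. f x - h x) \<in> Lp p"
        using fi fm m_term_properties(2)[OF hm] by (auto simp: Lp_def intro!: periodic_diff)
      have "(\<integral>x. cmod (f x - h x) powr p \<partial>torus) \<le> (\<integral>x. 2 powr p * (cmod (f x - S x) powr p + cmod (S x - h x) powr p) \<partial>torus)"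
        by (rule integral_mono[OF fi ri pt])
      also have "\<dots> = 2 powr p * ((\<integral>x. cmod (f x - S x) powr p \<partial>torus) + (\<integral>x. cmod (S x - h x) powr p \<partial>torus))"
        using Si Wi[OF f, of "n m"] by (simp add: S_def)
      also have "\<dots> \<le> 2 powr p * (C * B m powr p + K1 powr p * B m powr p)"
      proof (intro mult_left_mono add_mono)
        show "(\<integral>x. cmod (f x - S x) powr p \<partial>torus) \<le> C * B m powr p"
          unfolding S_def using WE[OF f, of "n m"] mult_left_mono[OF tail[OF m], of C] C by linarith
        show "(\<integral>x. cmod (S x - h x) powr p \<partial>torus) \<le> K1 powr p * B m powr p"
          using SI by (simp only: powr_mult)
      qed simp
      also have "\<dots> = (2 powr p * (C + K1 powr p)) * B m powr p" by (simp add: algebra_simps)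
      finally have "(\<integral>x. cmod (f x - h x) powr p \<partial>torus) powr (1/p) \<le> ((2 powr p * (C + K1 powr p)) * B m powr p) powr (1/p)"
        using p by (intro powr_mono2) auto
      also have "\<dots> = K * B m" using p B0 unfolding K_def by (simp only: powr_mult powr_powr) simp
      finally have "Lp_norm p (\<lambda>x. f x - h x) \<le> ennreal (K * B m)" using fL by (simp add: Lp_norm_def ennreal_leI)
      then show ?thesis using hm unfolding run_cube_scheme h_def S_def by simp
    qed
    have "\<forall>\<^sub>F m in sequentially. \<forall>f\<in>W_class (1/q) q :: 'd tfun set.
        run G (cube_scheme p (n m) m) f \<in> m_term m \<and> Lp_norm p (\<lambda>x. f x - run G (cube_scheme p (n m) m) f x) \<le> ennreal (K * B m)"
      using eventually_ge_at_top[of 3] by eventually_elim (use main in blast)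
    then show "attains_order G (\<lambda>m. cube_scheme p (n m) m) (W_class (1/q) q) p
       (\<lambda>m. real m powr (- 1/2) * ln (real m) powr (real CARD('d) * (1 - 1 / q)))"
      unfolding attains_order_def using K by (auto simp: B_def e_def)
  qed
qed

theorem theorem3p6:
  fixes q p :: real
  defines "W \<equiv> (W_class (1 / q) q :: (real ^ 'd::finite \<Rightarrow> complex) set)"
    and "B \<equiv> (\<lambda>m. real m powr (- 1/2) * ln (real m) powr (real CARD('d) * (1 - 1 / q)))"
  assumes "1 < q" and "q \<le> 2" and "2 < p"
  shows "same_order (\<lambda>m. best_m_term_class m W p) B \<and>
    (\<exists>G :: real \<Rightarrow> nat \<Rightarrow> (real ^ 'd \<Rightarrow> complex) \<Rightarrow> (real ^ 'd \<Rightarrow> complex).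
       incremental_greedy G \<and> (\<exists>C1 C2. greedy_type_methods C1 C2 G)) \<and>
    (\<exists>a :: nat \<Rightarrow> 'd scheme.
       \<forall>G C1 C2. greedy_type_methods C1 C2 G \<longrightarrow> attains_order G a W p B)"
proof -
  note q = assms(3,4) and p = assms(5)
  obtain G :: "real \<Rightarrow> nat \<Rightarrow> 'd tfun \<Rightarrow> 'd tfun" where G: "incremental_greedy G" "greedy_type_methods 4 1 G"
    by (rule incremental_greedy_exists)
  obtain n :: "nat \<Rightarrow> nat" where n: "\<And>(G :: real \<Rightarrow> nat \<Rightarrow> 'd tfun \<Rightarrow> 'd tfun) C1 C2. greedy_type_methods C1 C2 G \<Longrightarrow>
     attains_order G (\<lambda>m. cube_scheme p (n m) m) W p B"
    using cube_schemes_attain_order[OF q p] unfolding W_def B_def by blast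
  obtain c where c: "0 < c" and low: "\<forall>\<^sub>F m in sequentially. ennreal (c * B m) \<le> best_m_term_class m W p"
    using best_m_term_class_lower[OF q p] unfolding W_def B_def by blast
  obtain C where C: "0 < C" and up: "\<forall>\<^sub>F m in sequentially. \<forall>f\<in>W. run G (cube_scheme p (n m) m) f \<in> m_term m \<and>
        Lp_norm p (\<lambda>x. f x - run G (cube_scheme p (n m) m) f x) \<le> ennreal (C * B m)"
    using n[OF G(2)] unfolding attains_order_def by blast
  have "\<forall>\<^sub>F m in sequentially. best_m_term_class m W p \<le> ennreal (max c C * B m)"
    using up
  proof eventually_elim
    case (elim m)
    have "best_m_term m f p \<le> ennreal (max c C * B m)" if "f \<in> W" for f
    proof -
      have "best_m_term m f p \<le> Lp_norm p (\<lambda>x. f x - run G (cube_scheme p (n m) m) f x)"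
        unfolding best_m_term_def using elim that by (intro INF_lower) auto
      also have "\<dots> \<le> ennreal (C * B m)" using elim that by blast
      also have "\<dots> \<le> ennreal (max c C * B m)"
        by (intro ennreal_leI mult_right_mono) (auto simp: B_def)
      finally show ?thesis .
    qed
    then show ?case unfolding best_m_term_class_def by (intro SUP_least)
  qed
  with low have "\<forall>\<^sub>F m in sequentially. ennreal (c * B m) \<le> best_m_term_class m W p \<and> best_m_term_class m W p \<le> ennreal (max c C * B m)"
    by eventually_elim simp
  then have "same_order (\<lambda>m. best_m_term_class m W p) B"
    unfolding same_order_def using c by (intro exI[of _ c] exI[of _ "max c C"]) auto
  then show ?thesis using G n by blast
qed

end
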